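(* Let $r\ge2$ be an integer and $T>0$. Suppose that the initial-boundary-value problem $$m=u-u_{xx},\qquad m_t+um_x+2u_xm=0,\qquad 0\le x\le1,\ 0\le t\le T,$$ $$m(0,t)=m(1,t)=u(0,t)=u(1,t)=0,\qquad 0\le t\le T,$$ $$u(x,0)=u_0(x),\qquad m(x,0)=m_0(x),\qquad 0\le x\le1,$$ where $m_0=u_0-u_0''$, has a unique solution $(m,u)$ with $m\in C(0,T;C^{r-2}\cap\mathring H^1)$ and $u\in C(0,T;C^r\cap\mathring H^1)$, which is smooth enough for the purposes of the error estimation. Let $S_h=S_h^{r,\mu}\cap\mathring H^1$, $0\le\mu\le r-2$, be the finite element space on a quasiuniform partition of $[0,1]$ with maximum meshlength $h$. Then, if $h$ is sufficiently small, the semidiscrete problem of finding $m_h,u_h:[0,T]\to S_h$ satisfying for $0\le t\le T$ $$(m_h,\phi)=A(u_h,\phi)\qquad\forall\phi\in S_h,$$ $$(m_{ht},\chi)=-(u_hm_{hx},\chi)-2(u_{hx}m_h,\chi)\qquad\forall\chi\in S_h,$$ with initial conditions $$m_h(0)=P_h(u_0-u_0''),\qquad u_h(0)=R_hu_0,$$ has a unique solution $(m_h,u_h)$ in $[0,T]$, for which $$\max_{0\le t\le T}\big(\|m(t)-m_h(t)\|+\|u(t)-u_h(t)\|_1\big)\le Ch^{r-1},$$ with $C$ a constant independent of $h$.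
   Context: Notation: $(\cdot,\cdot)$ and $\|\cdot\|$ are the inner product and norm of $L^2=L^2(0,1)$; $\|\cdot\|_1$ is the norm of $H^1=H^1(0,1)$; $\mathring H^1$ is the subspace of $H^1$ of functions vanishing at $x=0$ and $x=1$; $C^k$ denotes the $k$-times continuously differentiable functions on $[0,1]$; $C(0,T;X)$ denotes the continuous maps from $[0,T]$ into $X$. For $v,w\in\mathring H^1$, $A(v,w)=(v,w)+(v',w')$. "Smooth enough" means having as many continuous derivatives (in $x$ and $t$) as needed for the estimate. Finite element spaces: $0=x_1<x_2<\dots<x_{N+1}=1$ is a partition of $[0,1]$ with maximum meshlength $h$, belonging to a quasiuniform family (the ratio of maximum to minimum meshlength is bounded independently of $h$). For integers $r\ge2$, $0\le\mu\le r-2$, $$S_h^{r,\mu}=\{\phi\in C^\mu[0,1]:\ \phi|_{[x_i,x_{i+1}]}\in\mathbb P_{r-1},\ i=1,\dots,N\},\qquad S_h=S_h^{r,\mu}\cap\mathring H^1,$$ where $\mathbb P_{r-1}$ is the set of polynomials of degree at most $r-1$. $P_h:L^2\to S_h$ is the $L^2$-projection onto $S_h$, and $R_h:\mathring H^1\to S_h$ is the elliptic projection: $A(R_hv,\phi)=A(v,\phi)$ for all $\phi\in S_h$. *)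

theory Defs
  imports "HOL-Analysis.Analysis" "HOL-Computational_Algebra.Polynomial"
begin

text \<open>
  Functions of \<open>x \<in> [0,1]\<close> are represented by functions \<open>real \<Rightarrow> real\<close> whose values outside
  \<open>[0,1]\<close> are irrelevant to every notion below. A function of \<open>x\<close> and \<open>t\<close> takes time as its
  first argument, so that \<open>v t\<close> is the function \<open>v(\<sqdot>,t)\<close> of \<open>x\<close>.
\<close>

section \<open>Function spaces on the unit interval\<close>

definition L2 :: "(real \<Rightarrow> real) set" where
  "L2 = {f. f \<in> borel_measurable (lebesgue_on {0..1}) \<and>
            integrable (lebesgue_on {0..1}) (\<lambda>x. (f x)\<^sup>2)}"

definition l2_inner :: "(real \<Rightarrow> real) \<Rightarrow> (real \<Rightarrow> real) \<Rightarrow> real" where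
  "l2_inner f g = (LINT x|lebesgue_on {0..1}. f x * g x)"

definition l2_norm :: "(real \<Rightarrow> real) \<Rightarrow> real" where
  "l2_norm f = sqrt (l2_inner f f)"

definition test_fun :: "(real \<Rightarrow> real) \<Rightarrow> bool" where
  "test_fun \<phi> \<longleftrightarrow> \<phi> C1_differentiable_on UNIV \<and>
     (\<exists>a b. 0 < a \<and> b < 1 \<and> (\<forall>x. x \<notin> {a..b} \<longrightarrow> \<phi> x = 0))"

definition has_weak_deriv :: "(real \<Rightarrow> real) \<Rightarrow> (real \<Rightarrow> real) \<Rightarrow> bool" where
  "has_weak_deriv f g \<longleftrightarrow>
     (\<forall>\<phi>. test_fun \<phi> \<longrightarrow> l2_inner f (deriv \<phi>) = - l2_inner g \<phi>)"

definition H1 :: "(real \<Rightarrow> real) set" where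
  "H1 = {f \<in> L2. \<exists>g \<in> L2. has_weak_deriv f g}"

text \<open>The weak derivative is determined only almost everywhere; it is used below only under integrals.\<close>

definition wderiv :: "(real \<Rightarrow> real) \<Rightarrow> real \<Rightarrow> real" where
  "wderiv f = (SOME g. g \<in> L2 \<and> has_weak_deriv f g)"

definition h1_norm :: "(real \<Rightarrow> real) \<Rightarrow> real" where
  "h1_norm f = sqrt ((l2_norm f)\<^sup>2 + (l2_norm (wderiv f))\<^sup>2)"

text \<open>The boundary values are those of the continuous representative of an \<open>H1\<close> function.\<close>

definition H10 :: "(real \<Rightarrow> real) set" where
  "H10 = {f \<in> H1. continuous_on {0..1} f \<and> f 0 = 0 \<and> f 1 = 0}"

definition bilin_A :: "(real \<Rightarrow> real) \<Rightarrow> (real \<Rightarrow> real) \<Rightarrow> real" where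
  "bilin_A v w = l2_inner v w + l2_inner (wderiv v) (wderiv w)"

text \<open>Classical derivative on \<open>[0,1]\<close>, one-sided at the endpoints.\<close>

definition dx :: "(real \<Rightarrow> real) \<Rightarrow> real \<Rightarrow> real" where
  "dx f x = vector_derivative f (at x within {0..1})"

definition Ck :: "nat \<Rightarrow> (real \<Rightarrow> real) set" where
  "Ck k = {f. (\<forall>j<k. (dx ^^ j) f differentiable_on {0..1}) \<and>
              (\<forall>j\<le>k. continuous_on {0..1} ((dx ^^ j) f))}"

definition Ck_norm :: "nat \<Rightarrow> (real \<Rightarrow> real) \<Rightarrow> real" where
  "Ck_norm k f = (\<Sum>j\<le>k. SUP x\<in>{0..1}. \<bar>(dx ^^ j) f x\<bar>)"

section \<open>Functions of space and time\<close>

text \<open>\<open>C(0,T;X)\<close> for a set \<open>X\<close> of functions normed by \<open>nrm\<close>.\<close>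

definition cont_into ::
  "real \<Rightarrow> (real \<Rightarrow> real) set \<Rightarrow> ((real \<Rightarrow> real) \<Rightarrow> real) \<Rightarrow> (real \<Rightarrow> real \<Rightarrow> real) set" where
  "cont_into T X nrm = {v. \<forall>t\<in>{0..T}. v t \<in> X \<and>
     ((\<lambda>s. nrm (\<lambda>x. v s x - v t x)) \<longlongrightarrow> 0) (at t within {0..T})}"

definition dt :: "real \<Rightarrow> (real \<Rightarrow> real \<Rightarrow> real) \<Rightarrow> real \<Rightarrow> real \<Rightarrow> real" where
  "dt T v t x = vector_derivative (\<lambda>s. v s x) (at t within {0..T})"

text \<open>All partial derivatives in \<open>x\<close> and \<open>t\<close> of total order at most \<open>K\<close> exist and are continuous
  on \<open>[0,T] \<times> [0,1]\<close>.\<close>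

primrec smooth_upto :: "real \<Rightarrow> nat \<Rightarrow> (real \<Rightarrow> real \<Rightarrow> real) \<Rightarrow> bool" where
  "smooth_upto T 0 v \<longleftrightarrow> continuous_on ({0..T} \<times> {0..1}) (\<lambda>(t, x). v t x)"
| "smooth_upto T (Suc k) v \<longleftrightarrow>
     continuous_on ({0..T} \<times> {0..1}) (\<lambda>(t, x). v t x) \<and>
     (\<forall>t\<in>{0..T}. \<forall>x\<in>{0..1}.
        (\<lambda>s. v s x) differentiable (at t within {0..T}) \<and>
        v t differentiable (at x within {0..1})) \<and>
     smooth_upto T k (dt T v) \<and> smooth_upto T k (\<lambda>t. dx (v t))"

section \<open>The Camassa--Holm initial-boundary-value problem\<close>

definition CH_solution ::
  "nat \<Rightarrow> real \<Rightarrow> (real \<Rightarrow> real) \<Rightarrow> (real \<Rightarrow> real) \<Rightarrow>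
   (real \<Rightarrow> real \<Rightarrow> real) \<Rightarrow> (real \<Rightarrow> real \<Rightarrow> real) \<Rightarrow> bool" where
  "CH_solution r T u0 m0 m u \<longleftrightarrow>
     m \<in> cont_into T (Ck (r - 2) \<inter> H10) (\<lambda>f. Ck_norm (r - 2) f + h1_norm f) \<and>
     u \<in> cont_into T (Ck r \<inter> H10) (\<lambda>f. Ck_norm r f + h1_norm f) \<and>
     (\<forall>t\<in>{0..T}. \<forall>x\<in>{0..1}.
        (\<lambda>s. m s x) differentiable (at t within {0..T}) \<and>
        m t differentiable (at x within {0..1}) \<and>
        m t x = u t x - dx (dx (u t)) x \<and>
        dt T m t x + u t x * dx (m t) x + 2 * dx (u t) x * m t x = 0) \<and>
     (\<forall>t\<in>{0..T}. m t 0 = 0 \<and> m t 1 = 0 \<and> u t 0 = 0 \<and> u t 1 = 0) \<and>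
     (\<forall>x\<in>{0..1}. u 0 x = u0 x \<and> m 0 x = m0 x)"

definition CH_unique_solution ::
  "nat \<Rightarrow> real \<Rightarrow> (real \<Rightarrow> real) \<Rightarrow> (real \<Rightarrow> real) \<Rightarrow>
   (real \<Rightarrow> real \<Rightarrow> real) \<Rightarrow> (real \<Rightarrow> real \<Rightarrow> real) \<Rightarrow> bool" where
  "CH_unique_solution r T u0 m0 m u \<longleftrightarrow>
     CH_solution r T u0 m0 m u \<and>
     (\<forall>m' u'. CH_solution r T u0 m0 m' u' \<longrightarrow>
        (\<forall>t\<in>{0..T}. \<forall>x\<in>{0..1}. m' t x = m t x \<and> u' t x = u t x))"

section \<open>Finite element spaces\<close>

text \<open>A pair \<open>(N, z)\<close> stands for the nodes \<open>z 1 < \<dots> < z (N + 1)\<close>.\<close>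

type_synonym mesh = "nat \<times> (nat \<Rightarrow> real)"

definition is_mesh :: "mesh \<Rightarrow> bool" where
  "is_mesh = (\<lambda>(N, z). N \<ge> 1 \<and> z 1 = 0 \<and> z (N + 1) = 1 \<and> (\<forall>i\<in>{1..N}. z i < z (i + 1)))"

definition max_length :: "mesh \<Rightarrow> real" where
  "max_length = (\<lambda>(N, z). Max ((\<lambda>i. z (i + 1) - z i) ` {1..N}))"

definition min_length :: "mesh \<Rightarrow> real" where
  "min_length = (\<lambda>(N, z). Min ((\<lambda>i. z (i + 1) - z i) ` {1..N}))"

definition quasiuniform_family :: "mesh set \<Rightarrow> bool" where
  "quasiuniform_family \<T> \<longleftrightarrow>
     (\<forall>P\<in>\<T>. is_mesh P) \<and> (\<exists>\<gamma>. \<forall>P\<in>\<T>. max_length P / min_length P \<le> \<gamma>)"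

definition spline_space :: "nat \<Rightarrow> nat \<Rightarrow> mesh \<Rightarrow> (real \<Rightarrow> real) set" where
  "spline_space r \<mu> = (\<lambda>(N, z). {\<phi> \<in> Ck \<mu>. \<forall>i\<in>{1..N}.
     \<exists>p :: real poly. degree p \<le> r - 1 \<and> (\<forall>x\<in>{z i..z (i + 1)}. \<phi> x = poly p x)})"

definition fe_space :: "nat \<Rightarrow> nat \<Rightarrow> mesh \<Rightarrow> (real \<Rightarrow> real) set" where
  "fe_space r \<mu> P = spline_space r \<mu> P \<inter> H10"

text \<open>Since values outside \<open>[0,1]\<close> are not normalised, the projections are stated as relations
  (\<open>p\<close> is a projection of \<open>v\<close> onto \<open>S\<close>); they determine \<open>p\<close> on \<open>[0,1]\<close>.\<close>

definition is_L2_projection ::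
  "(real \<Rightarrow> real) set \<Rightarrow> (real \<Rightarrow> real) \<Rightarrow> (real \<Rightarrow> real) \<Rightarrow> bool" where
  "is_L2_projection S v p \<longleftrightarrow> p \<in> S \<and> (\<forall>\<phi>\<in>S. l2_inner p \<phi> = l2_inner v \<phi>)"

definition is_elliptic_projection ::
  "(real \<Rightarrow> real) set \<Rightarrow> (real \<Rightarrow> real) \<Rightarrow> (real \<Rightarrow> real) \<Rightarrow> bool" where
  "is_elliptic_projection S v p \<longleftrightarrow> p \<in> S \<and> (\<forall>\<phi>\<in>S. bilin_A p \<phi> = bilin_A v \<phi>)"

section \<open>The semidiscrete problem\<close>

text \<open>\<open>S\<close> being finite dimensional, differentiability in time of \<open>m\<^sub>h\<close> as a map into \<open>S\<close>
  is the same as differentiability of \<open>t \<mapsto> m\<^sub>h(x,t)\<close> for every \<open>x\<close>.\<close>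

definition semidiscrete_solution ::
  "(real \<Rightarrow> real) set \<Rightarrow> real \<Rightarrow> (real \<Rightarrow> real) \<Rightarrow>
   (real \<Rightarrow> real \<Rightarrow> real) \<Rightarrow> (real \<Rightarrow> real \<Rightarrow> real) \<Rightarrow> bool" where
  "semidiscrete_solution S T u0 mh uh \<longleftrightarrow>
     (\<forall>t\<in>{0..T}. mh t \<in> S \<and> uh t \<in> S) \<and>
     (\<forall>t\<in>{0..T}. \<forall>x\<in>{0..1}. (\<lambda>s. mh s x) differentiable (at t within {0..T})) \<and>
     (\<forall>t\<in>{0..T}. \<forall>\<phi>\<in>S. l2_inner (mh t) \<phi> = bilin_A (uh t) \<phi>) \<and>
     (\<forall>t\<in>{0..T}. \<forall>\<psi>\<in>S.
        l2_inner (dt T mh t) \<psi> =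
          - l2_inner (\<lambda>x. uh t x * wderiv (mh t) x) \<psi>
          - 2 * l2_inner (\<lambda>x. wderiv (uh t) x * mh t x) \<psi>) \<and>
     is_L2_projection S (\<lambda>x. u0 x - dx (dx u0) x) (mh 0) \<and>
     is_elliptic_projection S u0 (uh 0)"

end

theory Submission
  imports Defs
begin

text \<open>
  Let \<open>\<theta> = m\<^sub>h - P\<^sub>h m\<close>, so that \<open>\<theta>(0) = 0\<close>. Testing the difference of the two equations with \<open>\<theta>\<close>
  and using \<open>(u\<^sub>h \<theta>\<^sub>x, \<theta>) = -(u\<^sub>h\<^sub>x \<theta>, \<theta>) / 2\<close> bounds \<open>d/dt \<parallel>\<theta>\<parallel>\<^sup>2\<close> by \<open>C (\<parallel>\<theta>\<parallel>\<^sup>2 + h\<^sup>2\<^sup>r\<^sup>-\<^sup>2)\<close>, provided that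
  \<open>u\<^sub>h\<^sub>x\<close> is bounded in the maximum norm. By an inverse inequality this is so as long as \<open>\<parallel>\<theta>\<parallel> \<le> h\<^sup>1\<^sup>/\<^sup>2\<close>,
  and Gronwall's inequality then yields \<open>\<parallel>\<theta>\<parallel> \<le> C h\<^sup>r\<^sup>-\<^sup>1 < h\<^sup>1\<^sup>/\<^sup>2\<close>, so the bound never fails.
  Existence comes from the same argument applied to a system in which the coordinates of \<open>m\<^sub>h\<close>
  in an \<open>L2\<close>-orthonormal basis are truncated: the truncation is never active.

  The approximation property of splines needs no quasi-interpolation. If \<open>e = v - w\<close> where \<open>w\<close> is the
  projection of \<open>v\<close> in the energy \<open>(v', w')\<close>, orthogonality to truncated powers says that the
  \<open>(r-2)\<close>-fold primitive \<open>F\<close> of \<open>e\<close> vanishes at all nodes and that all the intermediate primitives vanish at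
  \<open>0\<close> and \<open>1\<close>. By Rolle, every primitive down to \<open>e\<close> has a zero in each interval of length \<open>O(h)\<close>, which
  gains a factor \<open>h\<close> per derivative, and \<open>\<parallel>e'\<parallel>\<^sup>2 = \<plusminus>(F, v\<^sup>(\<^sup>r\<^sup>))\<close> gives \<open>\<parallel>e'\<parallel> \<le> C h\<^sup>r\<^sup>-\<^sup>1\<close>.
\<close>

section \<open>Bounded measurable functions and the inner product of \<open>L2\<close>\<close>

text \<open>Testing with \<open>\<theta>\<close> makes \<open>P_h m\<close> the right comparison:
  only \<open>(m_t, \<theta>)\<close> occurs, so the projection error is never differentiated in
  time. The rate \<open>r - 1\<close> comes from \<open>m_x - (P_h m)_x\<close>, where the inverse
  inequality costs one power of \<open>h\<close>, and from the energy error of \<open>u\<close>; the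
  elliptic equation passes the error of \<open>m_h\<close> on to \<open>u_h\<close> with factor 1.
  The bootstrap closes because \<open>r \<ge> 2\<close> makes the squared error
  \<open>O(h\<^sup>2)\<close>, below the threshold \<open>h\<close> once \<open>h\<close> is small.
  Two features of the setting shape the rest. Weak derivatives are chosen by \<open>SOME\<close>, so
  a du Bois-Reymond lemma must identify them almost everywhere with classical ones. Functions are
  free off \<open>[0,1]\<close>, so the spline space is infinite-dimensional as a set of functions
  on the reals; its linear algebra goes through finitely many point values, and identities hold on
  \<open>[0,1]\<close> or almost everywhere. Every constant is a function of \<open>r\<close>,
  \<open>M\<close>, \<open>T\<close> and one number \<open>c\<close>, which is how independence of
  the mesh is obtained.\<close>

abbreviation UI :: "real measure" where "UI \<equiv> lebesgue_on {0..1}"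

text \<open>Unlike \<open>L2\<close>, this class is closed under products. Splines, their
  derivatives and the smooth solution all lie in it, so the trilinear terms of the equation are
  integrable without further argument.\<close>

definition bdd_meas :: "(real \<Rightarrow> real) set" where
  "bdd_meas = {f \<in> borel_measurable UI. \<exists>B. \<forall>x\<in>{0..1}. \<bar>f x\<bar> \<le> B}"

lemma bdd_measI: "f \<in> borel_measurable UI \<Longrightarrow> (\<And>x. x \<in> {0..1} \<Longrightarrow> \<bar>f x\<bar> \<le> B) \<Longrightarrow> f \<in> bdd_meas"
  unfolding bdd_meas_def by blast

lemma finite_measure_UI: "finite_measure UI"
  by (rule finite_measureI) (simp add: emeasure_restrict_space)

lemma measure_UI: "measure UI {0..1} = 1"
  by (simp add: measure_restrict_space)

lemma bdd_meas_measurable [measurable_dest]: "f \<in> bdd_meas \<Longrightarrow> f \<in> borel_measurable UI"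
  by (simp add: bdd_meas_def)

lemma bdd_meas_integrable [simp]:
  assumes "f \<in> bdd_meas" shows "integrable UI f"
proof -
  obtain B where B: "\<And>x. x \<in> {0..1} \<Longrightarrow> \<bar>f x\<bar> \<le> B" using assms unfolding bdd_meas_def by blast
  show ?thesis
    by (rule finite_measure.integrable_const_bound[OF finite_measure_UI, of _ B])
       (use B assms in \<open>auto intro!: AE_I2 simp: bdd_meas_def\<close>)
qed

lemma bdd_meas_cont [simp, intro]:
  assumes "continuous_on {0..1} f" shows "f \<in> bdd_meas"
proof -
  have "bounded (f ` {0..1})" using assms by (intro compact_imp_bounded compact_continuous_image) auto
  then obtain B where "\<forall>x\<in>{0..1}. \<bar>f x\<bar> \<le> B" by (auto simp: bounded_iff)
  moreover have "f \<in> borel_measurable UI"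
    using assms by (simp add: continuous_imp_measurable_on_sets_lebesgue)
  ultimately show ?thesis unfolding bdd_meas_def by blast
qed

lemma bdd_meas_add [simp, intro]:
  assumes "f \<in> bdd_meas" "g \<in> bdd_meas" shows "(\<lambda>x. f x + g x) \<in> bdd_meas"
proof -
  obtain B C where "\<And>x. x \<in> {0..1} \<Longrightarrow> \<bar>f x\<bar> \<le> B" "\<And>x. x \<in> {0..1} \<Longrightarrow> \<bar>g x\<bar> \<le> C"
    using assms unfolding bdd_meas_def by blast
  then have "\<And>x. x \<in> {0..1} \<Longrightarrow> \<bar>f x + g x\<bar> \<le> B + C" by (smt (verit))
  then show ?thesis using assms by (intro bdd_measI[where B="B + C"]) (auto simp: bdd_meas_def)
qed

lemma bdd_meas_mult [simp, intro]:
  assumes "f \<in> bdd_meas" "g \<in> bdd_meas" shows "(\<lambda>x. f x * g x) \<in> bdd_meas"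
proof -
  obtain B C where "\<And>x. x \<in> {0..1} \<Longrightarrow> \<bar>f x\<bar> \<le> B" "\<And>x. x \<in> {0..1} \<Longrightarrow> \<bar>g x\<bar> \<le> C"
    using assms unfolding bdd_meas_def by blast
  then have "\<And>x. x \<in> {0..1} \<Longrightarrow> \<bar>f x * g x\<bar> \<le> B * C"
    unfolding abs_mult by (intro mult_mono') auto
  then show ?thesis using assms by (intro bdd_measI[where B="B * C"]) (auto simp: bdd_meas_def)
qed

lemma bdd_meas_const [simp, intro]: "(\<lambda>x. c) \<in> bdd_meas"
  by (intro bdd_meas_cont continuous_on_const)

lemma bdd_meas_cmult [simp, intro]: "f \<in> bdd_meas \<Longrightarrow> (\<lambda>x. c * f x) \<in> bdd_meas"
  by (intro bdd_meas_mult bdd_meas_const)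

lemma bdd_meas_minus [simp, intro]: "f \<in> bdd_meas \<Longrightarrow> (\<lambda>x. - f x) \<in> bdd_meas"
  using bdd_meas_cmult[of f "-1"] by simp

lemma bdd_meas_diff [simp, intro]: "f \<in> bdd_meas \<Longrightarrow> g \<in> bdd_meas \<Longrightarrow> (\<lambda>x. f x - g x) \<in> bdd_meas"
  using bdd_meas_add[of f "\<lambda>x. - g x"] bdd_meas_minus[of g] by simp

lemma bdd_meas_sum [simp, intro]:
  "(\<And>i. i \<in> A \<Longrightarrow> f i \<in> bdd_meas) \<Longrightarrow> (\<lambda>x. \<Sum>i\<in>A. f i x) \<in> bdd_meas"
  by (induction A rule: infinite_finite_induct) auto

lemma bdd_meas_power2 [simp, intro]: "f \<in> bdd_meas \<Longrightarrow> (\<lambda>x. (f x)\<^sup>2) \<in> bdd_meas"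
  by (simp add: power2_eq_square)

lemma bdd_meas_indicator [simp, intro]:
  assumes "A \<in> sets borel" shows "(indicator A :: real \<Rightarrow> real) \<in> bdd_meas"
proof (rule bdd_measI[where B=1])
  have "A \<in> sets lebesgue" using assms by simp
  then show "(indicator A :: real \<Rightarrow> real) \<in> borel_measurable UI"
    by (intro measurable_restrict_space1 borel_measurable_indicator)
qed (simp add: indicator_def)

lemma bdd_meas_cong: "f \<in> bdd_meas \<Longrightarrow> (\<And>x. x \<in> {0..1} \<Longrightarrow> f x = g x) \<Longrightarrow> g \<in> bdd_meas"
  using measurable_lebesgue_cong[of "{0..1}" f g borel] by (auto simp: bdd_meas_def)

lemma bdd_meas_L2: "f \<in> bdd_meas \<Longrightarrow> f \<in> L2"
  unfolding L2_def using bdd_meas_integrable[OF bdd_meas_power2] by (simp add: bdd_meas_def)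

lemma integral_UI: "f \<in> bdd_meas \<Longrightarrow> (LINT x|UI. f x) = integral {0..1} f"
  by (intro lebesgue_integral_eq_integral) auto

lemma has_integral_UI: "f \<in> bdd_meas \<Longrightarrow> (f has_integral (LINT x|UI. f x)) {0..1}"
  by (intro has_integral_integral_lebesgue_on) auto

lemma AE_UI_interior: "AE x in UI. 0 < x \<and> x < 1"
proof -
  have "{0,1::real} \<in> null_sets lebesgue"
    using negligible_iff_null_sets by (metis negligible_finite finite.emptyI finite.insertI)
  then have "AE x in lebesgue. x \<notin> {0,1::real}" by (rule AE_not_in)
  then have "AE x in lebesgue. x \<in> {0..1::real} \<longrightarrow> 0 < x \<and> x < 1" by eventually_elim auto
  then show ?thesis by (subst AE_restrict_space_iff) auto
qed

lemma AE_UI_finite: "finite Z \<Longrightarrow> AE x in UI. x \<notin> Z"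
proof -
  assume "finite Z"
  then have "Z \<in> null_sets lebesgue" using negligible_iff_null_sets negligible_finite by blast
  then have "AE x in lebesgue. x \<notin> Z" by (rule AE_not_in)
  then have "AE x in lebesgue. x \<in> {0..1::real} \<longrightarrow> x \<notin> Z" by eventually_elim auto
  then show ?thesis by (subst AE_restrict_space_iff) auto
qed

lemma l2_commute: "l2_inner f g = l2_inner g f"
  unfolding l2_inner_def by (simp add: mult.commute)

lemma l2_add_left: "f \<in> bdd_meas \<Longrightarrow> g \<in> bdd_meas \<Longrightarrow> k \<in> bdd_meas \<Longrightarrow>
    l2_inner (\<lambda>x. f x + g x) k = l2_inner f k + l2_inner g k"
  unfolding l2_inner_def by (simp add: ring_distribs)

lemma l2_add_right: "f \<in> bdd_meas \<Longrightarrow> g \<in> bdd_meas \<Longrightarrow> k \<in> bdd_meas \<Longrightarrow>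
    l2_inner k (\<lambda>x. f x + g x) = l2_inner k f + l2_inner k g"
  unfolding l2_inner_def by (simp add: ring_distribs)

lemma l2_diff_left: "f \<in> bdd_meas \<Longrightarrow> g \<in> bdd_meas \<Longrightarrow> k \<in> bdd_meas \<Longrightarrow>
    l2_inner (\<lambda>x. f x - g x) k = l2_inner f k - l2_inner g k"
  unfolding l2_inner_def by (simp add: ring_distribs)

lemma l2_diff_right: "f \<in> bdd_meas \<Longrightarrow> g \<in> bdd_meas \<Longrightarrow> k \<in> bdd_meas \<Longrightarrow>
    l2_inner k (\<lambda>x. f x - g x) = l2_inner k f - l2_inner k g"
  unfolding l2_inner_def by (simp add: ring_distribs)

lemma l2_cmult_left [simp]: "l2_inner (\<lambda>x. c * f x) g = c * l2_inner f g"
  unfolding l2_inner_def by (simp add: mult.assoc)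

lemma l2_cmult_right [simp]: "l2_inner g (\<lambda>x. c * f x) = c * l2_inner g f"
  using l2_cmult_left[of c f g] by (simp only: l2_commute)

lemma l2_cong:
  "(\<And>x. x \<in> {0..1} \<Longrightarrow> f x = f' x) \<Longrightarrow> (\<And>x. x \<in> {0..1} \<Longrightarrow> g x = g' x) \<Longrightarrow>
    l2_inner f g = l2_inner f' g'"
  unfolding l2_inner_def by (intro Bochner_Integration.integral_cong) auto

lemma l2_cong_AE:
  assumes "AE x in UI. f x = f' x" "AE x in UI. g x = g' x"
    and "f \<in> borel_measurable UI" "f' \<in> borel_measurable UI"
    and "g \<in> borel_measurable UI" "g' \<in> borel_measurable UI"
  shows "l2_inner f g = l2_inner f' g'"
  unfolding l2_inner_def
proof (rule integral_cong_AE)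
  show "AE x in UI. f x * g x = f' x * g' x" using assms(1,2) by eventually_elim simp
qed (use assms in measurable)

lemma l2_self_nonneg: "0 \<le> l2_inner f f"
  unfolding l2_inner_def by simp

lemma l2_norm_nonneg [simp]: "0 \<le> l2_norm f"
  unfolding l2_norm_def using l2_self_nonneg by simp

lemma l2_norm_sq: "(l2_norm f)\<^sup>2 = l2_inner f f"
  unfolding l2_norm_def using l2_self_nonneg by simp

lemma l2_minus_left [simp]: "l2_inner (\<lambda>x. - f x) g = - l2_inner f g"
  unfolding l2_inner_def by simp

lemma quadratic_discr:
  fixes a b c :: real
  assumes "\<And>t. 0 \<le> a + 2 * b * t + c * t\<^sup>2" "0 \<le> a" "0 \<le> c"
  shows "b\<^sup>2 \<le> a * c"
proof (cases "c = 0")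
  case True
  have "b = 0"
  proof (rule ccontr)
    assume "b \<noteq> 0"
    \<comment> \<open>At this point the affine function \<open>a + 2 * b * t\<close> equals
      \<open>-1\<close>.\<close>
    then show False using assms(1)[of "- (a + 1) / (2 * b)"] True by (simp add: field_simps)
  qed
  then show ?thesis using True by simp
next
  case False
  then have c: "c > 0" using assms(3) by simp
  have "0 \<le> c * (a + 2 * b * (- b / c) + c * (- b / c)\<^sup>2)" using assms(1)[of "- b / c"] c by simp
  also have "\<dots> = a * c - b\<^sup>2" using c by (simp add: field_simps power2_eq_square)
  finally show ?thesis by simp
qed

lemma l2_Cauchy_Schwarz:
  assumes f: "f \<in> bdd_meas" and g: "g \<in> bdd_meas"
  shows "\<bar>l2_inner f g\<bar> \<le> l2_norm f * l2_norm g"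
proof -
  have "(l2_inner f g)\<^sup>2 \<le> l2_inner f f * l2_inner g g"
  proof (rule quadratic_discr[OF _ l2_self_nonneg l2_self_nonneg])
    fix t
    have "0 \<le> l2_inner (\<lambda>x. f x + t * g x) (\<lambda>x. f x + t * g x)" by (rule l2_self_nonneg)
    also have "\<dots> = l2_inner f f + 2 * l2_inner f g * t + l2_inner g g * t\<^sup>2"
      using f g by (simp add: l2_add_left l2_add_right l2_commute[of g f] power2_eq_square algebra_simps)
    finally show "0 \<le> l2_inner f f + 2 * l2_inner f g * t + l2_inner g g * t\<^sup>2" .
  qed
  also have "\<dots> = (l2_norm f * l2_norm g)\<^sup>2" by (simp add: power_mult_distrib l2_norm_sq)
  finally show ?thesis by (simp add: power2_le_iff_abs_le)
qed

lemma l2_norm_triangle: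
  assumes f: "f \<in> bdd_meas" and g: "g \<in> bdd_meas"
  shows "l2_norm (\<lambda>x. f x + g x) \<le> l2_norm f + l2_norm g"
proof (rule power2_le_imp_le)
  have "(l2_norm (\<lambda>x. f x + g x))\<^sup>2 = (l2_norm f)\<^sup>2 + 2 * l2_inner f g + (l2_norm g)\<^sup>2"
    using f g by (simp add: l2_norm_sq l2_add_left l2_add_right l2_commute[of g f])
  also have "\<dots> \<le> (l2_norm f)\<^sup>2 + 2 * (l2_norm f * l2_norm g) + (l2_norm g)\<^sup>2"
    using l2_Cauchy_Schwarz[OF f g] by linarith
  also have "\<dots> = (l2_norm f + l2_norm g)\<^sup>2" by (simp add: power2_eq_square algebra_simps)
  finally show "(l2_norm (\<lambda>x. f x + g x))\<^sup>2 \<le> (l2_norm f + l2_norm g)\<^sup>2" .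
qed simp

lemma l2_norm_cmult: "l2_norm (\<lambda>x. c * f x) = \<bar>c\<bar> * l2_norm f"
  unfolding l2_norm_def by (simp add: real_sqrt_mult flip: mult.assoc)

lemma l2_norm_minus: "l2_norm (\<lambda>x. f x - g x) = l2_norm (\<lambda>x. g x - f x)"
  using l2_norm_cmult[of "-1" "\<lambda>x. f x - g x"] by simp

lemma l2_norm_triangle_diff:
  assumes f: "f \<in> bdd_meas" and g: "g \<in> bdd_meas" and k: "k \<in> bdd_meas"
  shows "l2_norm (\<lambda>x. f x - g x) \<le> l2_norm (\<lambda>x. f x - k x) + l2_norm (\<lambda>x. k x - g x)"
  using l2_norm_triangle[of "\<lambda>x. f x - k x" "\<lambda>x. k x - g x"] assms by auto

lemma l2_mono_AE:
  assumes "AE x in UI. f x \<le> g x" "f \<in> bdd_meas" "g \<in> bdd_meas"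
  shows "(LINT x|UI. f x) \<le> (LINT x|UI. g x)"
  using assms by (intro integral_mono_AE) auto

lemma l2_norm_mono_AE:
  assumes "AE x in UI. \<bar>f x\<bar> \<le> \<bar>g x\<bar>" "f \<in> bdd_meas" "g \<in> bdd_meas"
  shows "l2_norm f \<le> l2_norm g"
proof -
  have "l2_inner f f \<le> l2_inner g g" unfolding l2_inner_def
  proof (rule l2_mono_AE)
    show "AE x in UI. f x * f x \<le> g x * g x" using assms(1)
      by eventually_elim (metis abs_le_square_iff power2_eq_square)
  qed (use assms in auto)
  then show ?thesis unfolding l2_norm_def by simp
qed

lemma l2_norm_const: "l2_norm (\<lambda>x. c) = \<bar>c\<bar>"
  unfolding l2_norm_def l2_inner_def by (simp add: measure_UI lebesgue_integral_const)

lemma l2_norm_mult_bound: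
  assumes "AE x in UI. \<bar>f x\<bar> \<le> B" "0 \<le> B" "f \<in> bdd_meas" "g \<in> bdd_meas"
  shows "l2_norm (\<lambda>x. f x * g x) \<le> B * l2_norm g"
proof -
  have "l2_norm (\<lambda>x. f x * g x) \<le> l2_norm (\<lambda>x. B * g x)"
  proof (rule l2_norm_mono_AE)
    show "AE x in UI. \<bar>f x * g x\<bar> \<le> \<bar>B * g x\<bar>" using assms(1)
      by eventually_elim (use \<open>B \<ge> 0\<close> in \<open>auto simp: abs_mult intro!: mult_right_mono\<close>)
  qed (use assms in auto)
  then show ?thesis using \<open>B \<ge> 0\<close> by (simp add: l2_norm_cmult)
qed

lemma l2_zero_cont:
  assumes f: "continuous_on {0..1} f" and 0: "l2_inner f f = 0" and x: "x \<in> {0..1}"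
  shows "f x = 0"
proof -
  have c: "continuous_on {0..1} (\<lambda>x. f x * f x)" using f by (intro continuous_intros)
  have "((\<lambda>x. f x * f x) has_integral 0) {0..1}"
    using has_integral_UI[OF bdd_meas_cont[OF c]] 0 unfolding l2_inner_def by simp
  then have "f x * f x = 0"
    using has_integral_0_cbox_imp_0[of 0 1 "\<lambda>x. f x * f x" x] c x by auto
  then show ?thesis by simp
qed

section \<open>Piecewise continuously differentiable functions and weak derivatives\<close>

text \<open>A common home for splines and \<open>C1\<close> functions: the fundamental theorem of
  calculus and integration by parts hold despite finitely many exceptional points. The values of
  \<open>g\<close> at those points are arbitrary, so \<open>g\<close> is determined only almost
  everywhere.\<close>

definition pw_deriv :: "(real \<Rightarrow> real) \<Rightarrow> (real \<Rightarrow> real) \<Rightarrow> bool" where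
  "pw_deriv f g \<longleftrightarrow> continuous_on {0..1} f \<and> g \<in> bdd_meas \<and>
     (\<exists>Z. finite Z \<and> (\<forall>x\<in>{0<..<1} - Z. (f has_real_derivative g x) (at x)))"

lemma pw_deriv_bdd: "pw_deriv f g \<Longrightarrow> f \<in> bdd_meas" "pw_deriv f g \<Longrightarrow> g \<in> bdd_meas"
  by (auto simp: pw_deriv_def)

lemma pw_deriv_cont: "pw_deriv f g \<Longrightarrow> continuous_on {0..1} f"
  by (auto simp: pw_deriv_def)

lemma pw_deriv_const: "pw_deriv (\<lambda>x. c) (\<lambda>x. 0)"
  by (auto simp: pw_deriv_def intro!: exI[of _ "{}"])

lemma pw_deriv_add:
  assumes "pw_deriv f g" "pw_deriv f' g'"
  shows "pw_deriv (\<lambda>x. f x + f' x) (\<lambda>x. g x + g' x)"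
proof -
  obtain Z Z' where "finite Z" "finite Z'"
    "\<forall>x\<in>{0<..<1} - Z. (f has_real_derivative g x) (at x)"
    "\<forall>x\<in>{0<..<1} - Z'. (f' has_real_derivative g' x) (at x)"
    using assms unfolding pw_deriv_def by blast
  then show ?thesis using assms unfolding pw_deriv_def
    by (intro conjI exI[of _ "Z \<union> Z'"]) (auto intro!: continuous_intros derivative_intros)
qed

lemma pw_deriv_mult:
  assumes "pw_deriv f g" "pw_deriv f' g'"
  shows "pw_deriv (\<lambda>x. f x * f' x) (\<lambda>x. f x * g' x + g x * f' x)"
proof -
  obtain Z Z' where *: "finite Z" "finite Z'"
    "\<forall>x\<in>{0<..<1} - Z. (f has_real_derivative g x) (at x)"
    "\<forall>x\<in>{0<..<1} - Z'. (f' has_real_derivative g' x) (at x)"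
    using assms unfolding pw_deriv_def by blast
  have "((\<lambda>x. f x * f' x) has_real_derivative f x * g' x + g x * f' x) (at x)"
    if "x \<in> {0<..<1} - (Z \<union> Z')" for x
    using DERIV_mult[of f "g x" x UNIV f' "g' x"] * that by (simp add: algebra_simps)
  then show ?thesis using assms * unfolding pw_deriv_def
    by (intro conjI exI[of _ "Z \<union> Z'"]) (auto intro!: continuous_intros)
qed

lemma pw_deriv_cmult: "pw_deriv f g \<Longrightarrow> pw_deriv (\<lambda>x. c * f x) (\<lambda>x. c * g x)"
  using pw_deriv_mult[OF pw_deriv_const[of c]] by simp

lemma pw_deriv_diff:
  "pw_deriv f g \<Longrightarrow> pw_deriv f' g' \<Longrightarrow> pw_deriv (\<lambda>x. f x - f' x) (\<lambda>x. g x - g' x)"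
  using pw_deriv_add[of f g "\<lambda>x. (-1) * f' x" "\<lambda>x. (-1) * g' x"] pw_deriv_cmult[of f' g' "-1"] by simp

lemma has_real_derivative_cong_interior:
  assumes "x \<in> {0<..<1}" "\<And>y. y \<in> {0..1} \<Longrightarrow> f y = g y" "(f has_real_derivative d) (at x)"
  shows "(g has_real_derivative d) (at x)"
  using assms(3)
proof (rule DERIV_cong_ev[OF refl _ refl, THEN iffD1, rotated])
  have "\<forall>\<^sub>F y in nhds x. y \<in> {0<..<1}" using assms(1) by (intro eventually_nhds_in_open) auto
  then show "\<forall>\<^sub>F y in nhds x. f y = g y" by eventually_elim (use assms(2) in auto)
qed

lemma pw_deriv_cong:
  assumes "pw_deriv f g" "\<And>x. x \<in> {0..1} \<Longrightarrow> f x = f' x"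
  shows "pw_deriv f' g"
proof -
  obtain Z where Z: "finite Z" "\<forall>x\<in>{0<..<1} - Z. (f has_real_derivative g x) (at x)"
    using assms(1) unfolding pw_deriv_def by blast
  have "continuous_on {0..1} f'" using continuous_on_cong[of "{0..1}" "{0..1}" f f'] assms
    by (auto simp: pw_deriv_def)
  moreover have "\<forall>x\<in>{0<..<1} - Z. (f' has_real_derivative g x) (at x)"
    using has_real_derivative_cong_interior[of _ f f'] assms(2) Z(2) by blast
  ultimately show ?thesis using assms(1) Z(1) unfolding pw_deriv_def by blast
qed

lemma pw_deriv_unique:
  assumes "pw_deriv f g" "pw_deriv f g'"
  shows "AE x in UI. g x = g' x"
proof -
  obtain Z Z' where *: "finite Z" "finite Z'"
    "\<forall>x\<in>{0<..<1} - Z. (f has_real_derivative g x) (at x)"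
    "\<forall>x\<in>{0<..<1} - Z'. (f has_real_derivative g' x) (at x)"
    using assms unfolding pw_deriv_def by blast
  have "AE x in UI. x \<notin> Z \<union> Z'" using * by (intro AE_UI_finite) auto
  then show ?thesis using AE_UI_interior
  proof eventually_elim
    case (elim x)
    then have "(f has_real_derivative g x) (at x)" "(f has_real_derivative g' x) (at x)" using * by auto
    then show ?case by (rule DERIV_unique)
  qed
qed

lemma pw_deriv_has_integral:
  assumes "pw_deriv f g" "0 \<le> a" "a \<le> b" "b \<le> 1"
  shows "(g has_integral (f b - f a)) {a..b}"
proof -
  obtain Z where Z: "finite Z" "\<forall>x\<in>{0<..<1} - Z. (f has_real_derivative g x) (at x)"
    using assms unfolding pw_deriv_def by blast
  show ?thesis
  proof (rule fundamental_theorem_of_calculus_interior_strong[OF Z(1) assms(3)])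
    show "(f has_vector_derivative g x) (at x)" if "x \<in> {a<..<b} - Z" for x
      using Z(2) that assms by (auto simp: has_real_derivative_iff_has_vector_derivative)
    show "continuous_on {a..b} f"
      using pw_deriv_cont[OF assms(1)] continuous_on_subset assms by fastforce
  qed
qed

lemma pw_deriv_integral: "pw_deriv f g \<Longrightarrow> (LINT x|UI. g x) = f 1 - f 0"
  using has_integral_unique[OF has_integral_UI pw_deriv_has_integral[of f g 0 1]]
  by (simp add: pw_deriv_bdd)

lemma pw_deriv_parts:
  assumes f: "pw_deriv f f'" and g: "pw_deriv g g'" and "f 0 * g 0 = f 1 * g 1"
  shows "l2_inner f g' = - l2_inner f' g"
proof -
  have "(LINT x|UI. f x * g' x + f' x * g x) = 0"
    using pw_deriv_integral[OF pw_deriv_mult[OF f g]] assms(3) by simp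
  then show ?thesis using pw_deriv_bdd[OF f] pw_deriv_bdd[OF g] unfolding l2_inner_def
    by (simp add: bdd_meas_mult)
qed

lemma pw_deriv_dx:
  assumes "f differentiable_on {0..1}" "continuous_on {0..1} (dx f)"
  shows "pw_deriv f (dx f)"
  unfolding pw_deriv_def
proof (intro conjI exI[of _ "{}"] ballI)
  fix x :: real assume "x \<in> {0<..<1} - {}"
  then have x: "x \<in> {0..1}" "0 < x" "x < 1" by auto
  have "(f has_vector_derivative dx f x) (at x within {0..1})"
    using assms(1) x(1) unfolding dx_def differentiable_on_def vector_derivative_works by blast
  then show "(f has_real_derivative dx f x) (at x)"
    using x by (simp add: has_real_derivative_iff_has_vector_derivative at_within_Icc_at)
qed (use assms in \<open>auto intro: differentiable_imp_continuous_on\<close>)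

section \<open>Weak derivatives and their identification with classical ones\<close>

lemma test_fun_pw_deriv:
  assumes "test_fun \<phi>"
  shows "pw_deriv \<phi> (deriv \<phi>)" "\<phi> 0 = 0" "\<phi> 1 = 0"
proof -
  obtain D where D: "\<And>x. (\<phi> has_vector_derivative D x) (at x)" "continuous_on UNIV D"
    using assms unfolding test_fun_def C1_differentiable_on_def by auto
  have d: "(\<phi> has_real_derivative D x) (at x)" for x
    using D(1)[of x] by (simp add: has_real_derivative_iff_has_vector_derivative)
  then have eq: "deriv \<phi> = D" by (intro ext DERIV_imp_deriv)
  show "pw_deriv \<phi> (deriv \<phi>)" unfolding pw_deriv_def eq
  proof (intro conjI exI[of _ "{}"] bdd_meas_cont)
    show "continuous_on {0..1} \<phi>"
      by (rule DERIV_continuous_on) (rule has_field_derivative_at_within[OF d])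
    show "continuous_on {0..1} D" by (rule continuous_on_subset[OF D(2)]) simp
  qed (use d in auto)
  show "\<phi> 0 = 0" "\<phi> 1 = 0" using assms unfolding test_fun_def by fastforce+
qed

lemma pw_deriv_has_weak_deriv: "pw_deriv f g \<Longrightarrow> has_weak_deriv f g"
  unfolding has_weak_deriv_def using pw_deriv_parts test_fun_pw_deriv by (metis mult_zero_right)

lemma pw_deriv_H1: "pw_deriv f g \<Longrightarrow> f \<in> H1"
  unfolding H1_def using pw_deriv_has_weak_deriv bdd_meas_L2 pw_deriv_bdd by blast

lemma integrable_L2:
  assumes "f \<in> L2" shows "integrable UI f"
proof (rule Bochner_Integration.integrable_bound)
  show "integrable UI (\<lambda>x. 1 + (f x)\<^sup>2)" using assms by (auto simp: L2_def intro!: bdd_meas_integrable)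
  show "AE x in UI. norm (f x) \<le> norm (1 + (f x)\<^sup>2)"
  proof (intro AE_I2)
    fix x
    have "0 \<le> (\<bar>f x\<bar> - 1)\<^sup>2" by simp
    then have "2 * \<bar>f x\<bar> \<le> 1 + (f x)\<^sup>2" by (simp add: power2_eq_square algebra_simps)
    then show "norm (f x) \<le> norm (1 + (f x)\<^sup>2)" by simp
  qed
qed (use assms in \<open>simp add: L2_def\<close>)

lemma integrable_mult_bdd:
  assumes "integrable UI f" "g \<in> bdd_meas"
  shows "integrable UI (\<lambda>x. f x * g x)"
proof -
  obtain B where B: "\<And>x. x \<in> {0..1} \<Longrightarrow> \<bar>g x\<bar> \<le> B" using assms(2) unfolding bdd_meas_def by blast
  show ?thesis
  proof (rule Bochner_Integration.integrable_bound)
    show "integrable UI (\<lambda>x. B * f x)" using assms(1) by simp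
    show "AE x in UI. norm (f x * g x) \<le> norm (B * f x)"
    proof (intro AE_I2)
      fix x assume "x \<in> space UI"
      then have "\<bar>g x\<bar> \<le> \<bar>B\<bar>" using B[of x] by simp
      then show "norm (f x * g x) \<le> norm (B * f x)"
        using mult_left_mono[of "\<bar>g x\<bar>" "\<bar>B\<bar>" "\<bar>f x\<bar>"] by (simp add: abs_mult mult.commute)
    qed
    show "(\<lambda>x. f x * g x) \<in> borel_measurable UI"
      using assms by (intro borel_measurable_times) (auto simp: bdd_meas_def)
  qed
qed

text \<open>The exponent starts at 2 because the truncated power of degree 1 has a kink; at
  \<open>0\<close> the difference quotient is bounded by a positive power of its step and tends to
  \<open>0\<close>.\<close>

lemma max_power_deriv:
  "((\<lambda>x::real. (max 0 x) ^ Suc (Suc n)) has_real_derivative real (Suc (Suc n)) * (max 0 x) ^ Suc n) (at x)"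
proof (cases x "0::real" rule: linorder_cases)
  case less
  have "\<forall>\<^sub>F y in nhds x. (max 0 y) ^ Suc (Suc n) = (0::real)"
    using eventually_nhds_in_open[of "{..<0}" x] less by (auto elim!: eventually_mono)
  then show ?thesis using less by (subst DERIV_cong_ev[OF refl _ refl, of _ "\<lambda>y. 0"]) auto
next
  case greater
  have "\<forall>\<^sub>F y in nhds x. (max 0 y) ^ Suc (Suc n) = y ^ Suc (Suc n)"
    using eventually_nhds_in_open[of "{0<..}" x] greater by (auto elim!: eventually_mono)
  moreover have "((\<lambda>y. y ^ Suc (Suc n)) has_real_derivative real (Suc (Suc n)) * x ^ Suc n) (at x)"
    by (rule DERIV_cong[OF DERIV_pow]) simp
  ultimately show ?thesis using greater
    by (subst DERIV_cong_ev[OF refl _ refl, of _ "\<lambda>y. y ^ Suc (Suc n)"]) auto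
next
  case equal
  have "((\<lambda>h. (max 0 h) ^ Suc (Suc n) / h) \<longlongrightarrow> 0) (at (0::real))"
  proof (rule Lim_null_comparison)
    have "norm ((max 0 h) ^ Suc (Suc n) / h) \<le> \<bar>h\<bar> ^ Suc n" for h :: real
    proof (cases "0 \<le> h")
      case False
      then have "max 0 h = 0" by simp
      moreover have "0 \<le> \<bar>h\<bar> ^ Suc n" by (rule zero_le_power) simp
      ultimately show ?thesis by (simp only: power_Suc mult_zero_left div_0 norm_zero)
    qed (simp add: max_absorb2)
    then show "\<forall>\<^sub>F h in at (0::real). norm ((max 0 h) ^ Suc (Suc n) / h) \<le> \<bar>h\<bar> ^ Suc n"
      by (rule always_eventually[OF allI])
    show "((\<lambda>h. \<bar>h\<bar> ^ Suc n) \<longlongrightarrow> 0) (at (0::real))" by (auto intro!: tendsto_eq_intros)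
  qed
  then show ?thesis using equal by (simp add: DERIV_def)
qed

lemma max_sq_deriv: "((\<lambda>x::real. (max 0 x)\<^sup>2) has_real_derivative 2 * max 0 x) (at x)"
  using max_power_deriv[of 0 x] by (simp add: numeral_2_eq_2)

text \<open>The squared truncated factors give a \<open>C1\<close> weight that is positive exactly
  on the open interval; for large \<open>n\<close> the exponential turns it into an approximation of
  the indicator function of that interval.\<close>

lemma test_fun_bump:
  assumes "0 < a" "a < b" "b < 1"
  shows "test_fun (\<lambda>x. 1 - exp (- (n * ((max 0 (x - a))\<^sup>2 * (max 0 (b - x))\<^sup>2))))" (is "test_fun ?f")
  unfolding test_fun_def
proof
  let ?w = "\<lambda>x. (max 0 (x - a))\<^sup>2 * (max 0 (b - x))\<^sup>2"
  let ?w' = "\<lambda>x. 2 * max 0 (x - a) * (max 0 (b - x))\<^sup>2 - 2 * max 0 (b - x) * (max 0 (x - a))\<^sup>2"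
  have 1: "((\<lambda>x. (max 0 (x - a))\<^sup>2) has_real_derivative 2 * max 0 (x - a)) (at x)" for x
    by (rule DERIV_cong[OF DERIV_chain2[OF max_sq_deriv]]) (rule derivative_eq_intros refl | simp)+
  have 2: "((\<lambda>x. (max 0 (b - x))\<^sup>2) has_real_derivative - 2 * max 0 (b - x)) (at x)" for x
    by (rule DERIV_cong[OF DERIV_chain2[OF max_sq_deriv]]) (rule derivative_eq_intros refl | simp)+
  have w: "(?w has_real_derivative ?w' x) (at x)" for x
    using DERIV_mult[OF 1 2, of x] by (simp add: algebra_simps)
  have "(?f has_real_derivative exp (- (n * ?w x)) * (n * ?w' x)) (at x)" for x
    by (rule derivative_eq_intros w | simp)+
  then have "\<forall>x\<in>UNIV. (?f has_vector_derivative exp (- (n * ?w x)) * (n * ?w' x)) (at x)"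
    by (simp add: has_real_derivative_iff_has_vector_derivative)
  moreover have "continuous_on UNIV (\<lambda>x. exp (- (n * ?w x)) * (n * ?w' x))"
    by (intro continuous_intros)
  ultimately show "?f C1_differentiable_on UNIV" unfolding C1_differentiable_on_def
    by (intro exI[of _ "\<lambda>x. exp (- (n * ?w x)) * (n * ?w' x)"] conjI)
  show "\<exists>a b. 0 < a \<and> b < 1 \<and> (\<forall>x. x \<notin> {a..b} \<longrightarrow> ?f x = 0)"
    using assms by (intro exI[of _ a] exI[of _ b]) (auto simp: max_def)
qed

text \<open>Bumps converging to an indicator show that \<open>d\<close> integrates to zero over
  every interval inside \<open>(0,1)\<close>, and Lebesgue differentiation recovers \<open>d\<close>
  from these integrals.\<close>

lemma du_Bois_Reymond:
  assumes d: "integrable UI d" and 0: "\<And>\<phi>. test_fun \<phi> \<Longrightarrow> (LINT x|UI. d x * \<phi> x) = 0"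
  shows "AE x in UI. d x = 0"
proof -
  have ind: "(LINT x|UI. d x * indicator {a<..<b} x) = 0" if ab: "0 < a" "a < b" "b < 1" for a b
  proof -
    define w where "w = (\<lambda>x. (max 0 (x - a))\<^sup>2 * (max 0 (b - x))\<^sup>2)"
    define \<phi> where "\<phi> = (\<lambda>(n::nat) x. 1 - exp (- (real n * w x)))"
    have w0: "w x \<ge> 0" for x unfolding w_def by simp
    have t: "test_fun (\<phi> n)" for n unfolding \<phi>_def w_def by (rule test_fun_bump[OF ab])
    have bm: "\<phi> n \<in> bdd_meas" for n using test_fun_pw_deriv(1)[OF t] pw_deriv_bdd by blast
    have "(\<lambda>n. LINT x|UI. d x * \<phi> n x) \<longlonglongrightarrow> (LINT x|UI. d x * indicator {a<..<b} x)"
    proof (rule integral_dominated_convergence[where w="\<lambda>x. \<bar>d x\<bar>"])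
      show "integrable UI (\<lambda>x. \<bar>d x\<bar>)" using d by simp
      show "AE x in UI. norm (d x * \<phi> n x) \<le> \<bar>d x\<bar>" for n
      proof (intro AE_I2)
        fix x
        have "0 \<le> \<phi> n x" "\<phi> n x \<le> 1" using w0 unfolding \<phi>_def by auto
        then show "norm (d x * \<phi> n x) \<le> \<bar>d x\<bar>"
          by (simp add: abs_mult mult_left_le)
      qed
      show "AE x in UI. (\<lambda>n. d x * \<phi> n x) \<longlonglongrightarrow> d x * indicator {a<..<b} x"
      proof (intro AE_I2 tendsto_mult tendsto_const)
        fix x
        show "(\<lambda>n. \<phi> n x) \<longlonglongrightarrow> indicator {a<..<b} x"
        proof (cases "x \<in> {a<..<b}")
          case True
          then have "w x > 0" unfolding w_def by (auto simp: max_def)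
          have "(\<lambda>n. 1 - exp (- w x) ^ n) \<longlonglongrightarrow> 1 - 0"
            by (intro tendsto_intros LIMSEQ_realpow_zero) (use \<open>w x > 0\<close> in auto)
          then show ?thesis using True by (simp add: \<phi>_def flip: exp_of_nat_mult)
        next
          case False
          then have "w x = 0" unfolding w_def by (auto simp: max_def)
          then show ?thesis using False by (simp add: \<phi>_def)
        qed
      qed
      show "(\<lambda>x. d x * \<phi> n x) \<in> borel_measurable UI" for n
        using bm d by (intro borel_measurable_integrable integrable_mult_bdd)
      show "(\<lambda>x. d x * indicator {a<..<b} x) \<in> borel_measurable UI"
        using d by (intro borel_measurable_times borel_measurable_integrable measurable_restrict_space1
            borel_measurable_indicator) auto
    qed
    then show ?thesis using 0[OF t] LIMSEQ_unique[OF _ tendsto_const[of 0]] by simp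
  qed
  define f where "f x = (if x \<in> {0..1} then d x else 0)" for x
  have fL: "integrable lebesgue f" unfolding f_def using d by (subst Lebesgue_Measure.integrable_restrict_UNIV) auto
  have "f absolutely_integrable_on UNIV" using fL by (simp add: set_integrable_def)
  then have "f integrable_on UNIV" using absolutely_integrable_on_def by blast
  then have fi: "f integrable_on cbox a b" for a b :: real
    by (metis integrable_on_subcbox subset_UNIV)
  have f0: "integral {a..b} f = 0" if "0 < a" "a < b" "b < 1" for a b
  proof -
    have "integral {a..b} f = integral {a<..<b} f" by (rule integral_open_interval_real)
    also have "\<dots> = integral UNIV (\<lambda>x. if x \<in> {a<..<b} then f x else 0)"
      by (rule integral_restrict_UNIV[symmetric])
    also have "(\<lambda>x. if x \<in> {a<..<b} then f x else 0) = (\<lambda>x. if x \<in> {0..1} then d x * indicator {a<..<b} x else 0)"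
      using that by (auto simp: f_def indicator_def)
    also have "integral UNIV \<dots> = integral {0..1} (\<lambda>x. d x * indicator {a<..<b} x)"
      by (rule integral_restrict_UNIV)
    also have "\<dots> = (LINT x|UI. d x * indicator {a<..<b} x)"
    proof (rule lebesgue_integral_eq_integral[symmetric])
      show "integrable UI (\<lambda>x. d x * indicator {a<..<b} x)"
      proof (rule integrable_mult_bdd[OF d])
        show "indicator {a<..<b} \<in> bdd_meas" by simp
      qed
    qed simp
    finally show ?thesis using ind that by simp
  qed
  \<comment> \<open>Lebesgue's differentiation theorem: off a null set, \<open>f x\<close> is the
    limit of its means over \<open>[x, x + h]\<close>.\<close>
  obtain N where N: "negligible N"
    "\<And>x e. \<lbrakk>x \<notin> N; 0 < e\<rbrakk> \<Longrightarrow> \<exists>k>0. \<forall>h. 0 < h \<and> h < k \<longrightarrow>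
        norm (integral (cbox x (x + h *\<^sub>R One)) f /\<^sub>R h ^ DIM(real) - f x) < e"
    using integrable_ccontinuous_explicit[of f] fi by metis
  have "d x = 0" if x: "0 < x" "x < 1" "x \<notin> N" for x
  proof (rule ccontr)
    assume "d x \<noteq> 0"
    then obtain k where k: "k > 0" "\<And>h. 0 < h \<Longrightarrow> h < k \<Longrightarrow> \<bar>integral {x..x+h} f / h - f x\<bar> < \<bar>d x\<bar>"
      using N(2)[of x "\<bar>d x\<bar>"] x by (auto simp: divide_inverse mult.commute)
    define h where "h = min k (1 - x) / 2"
    have h: "0 < h" "h < k" "x + h < 1" using k(1) x unfolding h_def by (auto simp: min_def field_simps)
    then show False using k(2)[of h] f0[of x "x + h"] x by (simp add: f_def)
  qed
  moreover have "AE x in UI. x \<notin> N"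
  proof -
    have "AE x in lebesgue. x \<notin> N" using N(1) negligible_iff_null_sets AE_not_in by blast
    then have "AE x in lebesgue. x \<in> {0..1} \<longrightarrow> x \<notin> N" by eventually_elim auto
    then show ?thesis by (subst AE_restrict_space_iff) auto
  qed
  ultimately show ?thesis using AE_UI_interior by (auto elim!: eventually_elim2)
qed

lemma wderiv_L2:
  assumes "f \<in> H1" shows "wderiv f \<in> L2" "has_weak_deriv f (wderiv f)"
proof -
  have "\<exists>g. g \<in> L2 \<and> has_weak_deriv f g" using assms unfolding H1_def by blast
  from someI_ex[OF this] show "wderiv f \<in> L2" "has_weak_deriv f (wderiv f)"
    unfolding wderiv_def by auto
qed

text \<open>Two weak derivatives have the same integral against every test function. This removes
  the dependence on the choice made by \<open>SOME\<close>.\<close>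

lemma wderiv_AE:
  assumes "pw_deriv f g"
  shows "AE x in UI. wderiv f x = g x"
proof -
  have w: "wderiv f \<in> L2" "has_weak_deriv f (wderiv f)" using wderiv_L2 pw_deriv_H1[OF assms] by auto
  have gb: "g \<in> bdd_meas" using assms pw_deriv_bdd by blast
  have "AE x in UI. wderiv f x - g x = 0"
  proof (rule du_Bois_Reymond)
    show "integrable UI (\<lambda>x. wderiv f x - g x)" using integrable_L2[OF w(1)] gb by simp
    fix \<phi> assume t: "test_fun \<phi>"
    have b: "\<phi> \<in> bdd_meas" using test_fun_pw_deriv(1)[OF t] pw_deriv_bdd by blast
    have "(LINT x|UI. wderiv f x * \<phi> x) = (LINT x|UI. g x * \<phi> x)"
      using w(2) pw_deriv_has_weak_deriv[OF assms] t unfolding has_weak_deriv_def l2_inner_def by fastforce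
    then show "(LINT x|UI. (wderiv f x - g x) * \<phi> x) = 0"
      using integrable_mult_bdd[OF integrable_L2[OF w(1)] b] gb b by (simp add: left_diff_distrib)
  qed
  then show ?thesis by eventually_elim simp
qed

lemma wderiv_measurable: "pw_deriv f g \<Longrightarrow> wderiv f \<in> borel_measurable UI"
  using wderiv_L2(1) pw_deriv_H1 by (auto simp: L2_def)

lemma l2_wderiv_left:
  assumes "pw_deriv f f'" "g \<in> borel_measurable UI" "k \<in> borel_measurable UI"
  shows "l2_inner (\<lambda>x. wderiv f x * k x) g = l2_inner (\<lambda>x. f' x * k x) g"
proof (rule l2_cong_AE)
  show "AE x in UI. wderiv f x * k x = f' x * k x" using wderiv_AE[OF assms(1)] by eventually_elim simp
qed (use assms wderiv_measurable pw_deriv_bdd(2)[OF assms(1)] in \<open>auto intro!: borel_measurable_times simp: bdd_meas_def\<close>)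

lemma bilin_A_pw:
  assumes "pw_deriv f f'" "pw_deriv g g'"
  shows "bilin_A f g = l2_inner f g + l2_inner f' g'"
proof -
  have "l2_inner (wderiv f) (wderiv g) = l2_inner f' g'"
    using wderiv_AE[OF assms(1)] wderiv_AE[OF assms(2)] wderiv_measurable assms pw_deriv_bdd
    by (intro l2_cong_AE) (auto simp: bdd_meas_def)
  then show ?thesis by (simp add: bilin_A_def)
qed

lemma h1_norm_pw:
  assumes "pw_deriv f f'"
  shows "h1_norm f = sqrt ((l2_norm f)\<^sup>2 + (l2_norm f')\<^sup>2)"
  using bilin_A_pw[OF assms assms] unfolding h1_norm_def bilin_A_def by (simp add: l2_norm_sq)

section \<open>Inverse estimates for polynomials\<close>

text \<open>The recurrence records one step of the degree induction in
  \<open>small_windows_bound\<close>: a mean value step costs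
  \<open>2 * 3 ^ Suc d / (b - a)\<close>, and integrating back over the interval restores the factor
  \<open>b - a\<close>.\<close>

primrec inv_const :: "nat \<Rightarrow> real" where
  "inv_const 0 = 1"
| "inv_const (Suc d) = 1 + 2 * 3 ^ Suc d * inv_const d"

lemma inv_const_ge_1: "1 \<le> inv_const d"
  by (induction d) auto

text \<open>Smallness at one point of every window is all that an integral bound provides; for a
  polynomial of degree at most \<open>d\<close> it already controls the maximum. Windows shrink by
  the factor 3 per degree because the mean value step uses the two outer thirds of a window.\<close>

definition small_windows :: "(real \<Rightarrow> real) \<Rightarrow> nat \<Rightarrow> real \<Rightarrow> real \<Rightarrow> real \<Rightarrow> bool" where
  "small_windows f d a b s \<longleftrightarrow>
     (\<forall>c. a \<le> c \<and> c + (b - a) / 3 ^ d \<le> b \<longrightarrow> (\<exists>\<xi>\<in>{c..c + (b - a) / 3 ^ d}. \<bar>f \<xi>\<bar> \<le> s))"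

text \<open>Points of small value in the first and last third of a window are at least a third of it
  apart, so the mean value theorem gives a point between them where the derivative is small.\<close>

lemma small_windows_pderiv:
  fixes p :: "real poly"
  assumes "a < b" "small_windows (poly p) (Suc d) a b s"
  shows "small_windows (poly (pderiv p)) d a b (2 * 3 ^ Suc d / (b - a) * s)"
  unfolding small_windows_def
proof (intro allI impI)
  fix c assume c: "a \<le> c \<and> c + (b - a) / 3 ^ d \<le> b"
  define e where "e = (b - a) / 3 ^ Suc d"
  have e: "e > 0" "(b - a) / 3 ^ d = 3 * e" using assms(1) by (auto simp: e_def field_simps)
  have w: "\<exists>\<xi>\<in>{k..k + e}. \<bar>poly p \<xi>\<bar> \<le> s" if "a \<le> k" "k + e \<le> b" for k
    using assms(2) that unfolding small_windows_def e_def by blast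
  obtain x where x: "x \<in> {c..c + e}" "\<bar>poly p x\<bar> \<le> s"
    using w[of c] c e by auto
  obtain y where y: "y \<in> {c + 2 * e..c + 2 * e + e}" "\<bar>poly p y\<bar> \<le> s"
    using w[of "c + 2 * e"] c e by auto
  have "x < y" using x y e by auto
  then obtain z where z: "x < z" "z < y" "poly p y - poly p x = (y - x) * poly (pderiv p) z"
    using poly_MVT by blast
  have "e * \<bar>poly (pderiv p) z\<bar> \<le> \<bar>y - x\<bar> * \<bar>poly (pderiv p) z\<bar>"
    using x y e by (intro mult_right_mono) auto
  also have "\<dots> \<le> 2 * s" using z(3) x y by (simp flip: abs_mult)
  finally have "\<bar>poly (pderiv p) z\<bar> \<le> 2 * s / e" using e by (simp add: field_simps)
  also have "2 * s / e = 2 * 3 ^ Suc d / (b - a) * s" by (simp add: e_def)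
  finally show "\<exists>\<xi>\<in>{c..c + (b - a) / 3 ^ d}. \<bar>poly (pderiv p) \<xi>\<bar> \<le> 2 * 3 ^ Suc d / (b - a) * s"
    using z x y e by (intro bexI[of _ z]) auto
qed

text \<open>Induction on the degree: the derivative is bounded everywhere by the induction
  hypothesis, and the polynomial is small at some point, from which the mean value inequality
  reaches the whole interval.\<close>

lemma small_windows_bound:
  fixes p :: "real poly"
  assumes "degree p \<le> d" "a < b" "small_windows (poly p) d a b s" "x \<in> {a..b}"
  shows "\<bar>poly p x\<bar> \<le> inv_const d * s"
  using assms
proof (induction d arbitrary: p s x)
  case 0
  then obtain k where k: "p = [:k:]" using degree_eq_zeroE by blast
  show ?case using 0 k unfolding small_windows_def by auto
next
  case (Suc d)
  define s' where "s' = 2 * 3 ^ Suc d / (b - a) * s"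
  have d: "\<bar>poly (pderiv p) y\<bar> \<le> inv_const d * s'" if "y \<in> {a..b}" for y
    using Suc.prems that small_windows_pderiv[OF Suc.prems(2,3)] unfolding s'_def
    by (intro Suc.IH) (auto simp: degree_pderiv)
  have "a + (b - a) / 3 ^ Suc d \<le> b"
    using divide_left_mono[of 1 "3 ^ Suc d" "b - a"] one_le_power[of "3::real" "Suc d"] Suc.prems(2) by force
  then obtain \<xi> where \<xi>: "\<xi> \<in> {a..b}" "\<bar>poly p \<xi>\<bar> \<le> s"
    using Suc.prems(3) unfolding small_windows_def by fastforce
  have "norm (poly p x - poly p \<xi>) \<le> inv_const d * s' * norm (x - \<xi>)"
  proof (rule field_differentiable_bound[of "{a..b}" "poly p" "poly (pderiv p)"])
    show "(poly p has_field_derivative poly (pderiv p) z) (at z within {a..b})" for z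
      by (rule has_field_derivative_at_within[OF poly_DERIV])
  qed (use d \<xi> Suc.prems in auto)
  also have "\<dots> \<le> inv_const d * s' * (b - a)"
  proof (rule mult_left_mono)
    show "0 \<le> inv_const d * s'" using d[OF \<xi>(1)] abs_ge_zero order_trans by blast
  qed (use \<xi> Suc.prems in auto)
  also have "\<dots> = 2 * 3 ^ Suc d * inv_const d * s" using Suc.prems(2) by (simp add: s'_def)
  finally show ?case using \<xi>(2) by (simp add: algebra_simps)
qed

text \<open>At its minimum over a window, \<open>(f x)\<^sup>2\<close> is at most its mean, hence at
  most the full integral divided by the window length.\<close>

lemma small_windows_L2:
  assumes f: "continuous_on {a..b} f" and "a < b"
  shows "small_windows f d a b (sqrt (3 ^ d * integral {a..b} (\<lambda>x. (f x)\<^sup>2) / (b - a)))"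
  unfolding small_windows_def
proof (intro allI impI)
  fix c assume c: "a \<le> c \<and> c + (b - a) / 3 ^ d \<le> b"
  define e where "e = (b - a) / 3 ^ d"
  have e: "e > 0" using assms(2) by (simp add: e_def)
  have sub: "{c..c + e} \<subseteq> {a..b}" using c by (auto simp: e_def)
  have f2: "continuous_on {a..b} (\<lambda>x. (f x)\<^sup>2)" using f by (intro continuous_intros)
  then have f2': "continuous_on {c..c + e} (\<lambda>x. (f x)\<^sup>2)" using sub continuous_on_subset by blast
  obtain \<xi> where \<xi>: "\<xi> \<in> {c..c + e}" "\<And>y. y \<in> {c..c + e} \<Longrightarrow> (f \<xi>)\<^sup>2 \<le> (f y)\<^sup>2"
    using continuous_attains_inf[OF _ _ f2'] e by auto
  have "e * (f \<xi>)\<^sup>2 = integral {c..c + e} (\<lambda>x. (f \<xi>)\<^sup>2)" using e by simp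
  also have "\<dots> \<le> integral {c..c + e} (\<lambda>x. (f x)\<^sup>2)"
    using f2' \<xi>(2) by (intro integral_le integrable_continuous_interval) auto
  also have "\<dots> \<le> integral {a..b} (\<lambda>x. (f x)\<^sup>2)"
    using f2 f2' sub by (intro integral_subset_le integrable_continuous_interval) auto
  finally have "(f \<xi>)\<^sup>2 \<le> 3 ^ d * integral {a..b} (\<lambda>x. (f x)\<^sup>2) / (b - a)"
    using assms(2) by (simp add: e_def field_simps)
  then have "\<bar>f \<xi>\<bar> \<le> sqrt (3 ^ d * integral {a..b} (\<lambda>x. (f x)\<^sup>2) / (b - a))"
    by (intro real_le_rsqrt) simp
  then show "\<exists>\<xi>\<in>{c..c + (b - a) / 3 ^ d}. \<bar>f \<xi>\<bar> \<le> sqrt (3 ^ d * integral {a..b} (\<lambda>x. (f x)\<^sup>2) / (b - a))"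
    using \<xi>(1) unfolding e_def by blast
qed

text \<open>The powers of \<open>b - a\<close> are those dictated by scaling, so \<open>C\<close>
  depends on the degree bound alone and can serve all cells of all meshes.\<close>

lemma poly_inverse_estimate:
  "\<exists>C\<ge>0::real. \<forall>p a b x. degree p \<le> d \<longrightarrow> a < b \<longrightarrow> x \<in> {a..b} \<longrightarrow>
     (poly p x)\<^sup>2 \<le> C * integral {a..b} (\<lambda>x. (poly p x)\<^sup>2) / (b - a) \<and>
     (poly (pderiv p) x)\<^sup>2 \<le> C * integral {a..b} (\<lambda>x. (poly p x)\<^sup>2) / (b - a) ^ 3"
proof -
  \<comment> \<open>This is the constant of the derivative bound, which uses windows of level
    \<open>Suc d\<close> because differentiation consumes one level; it dominates that of the bound
    for the values.\<close>
  define C where "C = (2 * 3 ^ Suc d * inv_const d)\<^sup>2 * 3 ^ Suc d"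
  have i1: "1 \<le> inv_const d" by (rule inv_const_ge_1)
  have 1: "(poly p x)\<^sup>2 \<le> C * integral {a..b} (\<lambda>x. (poly p x)\<^sup>2) / (b - a)" (is ?P1)
   and 2: "(poly (pderiv p) x)\<^sup>2 \<le> C * integral {a..b} (\<lambda>x. (poly p x)\<^sup>2) / (b - a) ^ 3" (is ?P2)
    if p: "degree p \<le> d" "a < b" "x \<in> {a..b}" for p a b x
  proof -
    define J where "J = integral {a..b} (\<lambda>x. (poly p x)\<^sup>2)"
    have J: "J \<ge> 0" unfolding J_def by (intro integral_nonneg integrable_continuous_interval continuous_intros) auto
    have w: "small_windows (poly p) d' a b (sqrt (3 ^ d' * J / (b - a)))" for d'
      unfolding J_def by (intro small_windows_L2 continuous_intros p)
    have "\<bar>poly p x\<bar> \<le> inv_const d * sqrt (3 ^ d * J / (b - a))"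
      by (rule small_windows_bound[OF p(1,2) w p(3)])
    then have "\<bar>poly p x\<bar>\<^sup>2 \<le> (inv_const d * sqrt (3 ^ d * J / (b - a)))\<^sup>2" by (rule power_mono) simp
    also have "\<dots> = ((inv_const d)\<^sup>2 * 3 ^ d) * (J / (b - a))" using J p(2) by (simp add: power_mult_distrib)
    also have "\<dots> \<le> C * (J / (b - a))"
    proof (rule mult_right_mono)
      have "(inv_const d)\<^sup>2 \<le> (2 * 3 ^ Suc d * inv_const d)\<^sup>2"
      proof (rule power_mono)
        have "1 * inv_const d \<le> 2 * 3 ^ Suc d * inv_const d"
          using i1 one_le_power[of "3::real" "Suc d"] by (intro mult_right_mono) linarith+
        then show "inv_const d \<le> 2 * 3 ^ Suc d * inv_const d" by simp
      qed (use i1 in simp)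
      then show "(inv_const d)\<^sup>2 * 3 ^ d \<le> C" unfolding C_def by (intro mult_mono) auto
    qed (use J p(2) in auto)
    finally show ?P1 by (simp add: J_def)
    have "\<bar>poly (pderiv p) x\<bar> \<le> inv_const d * (2 * 3 ^ Suc d / (b - a) * sqrt (3 ^ Suc d * J / (b - a)))"
      using p(1) by (intro small_windows_bound[OF _ p(2) small_windows_pderiv[OF p(2) w] p(3)]) (simp add: degree_pderiv)
    then have "\<bar>poly (pderiv p) x\<bar>\<^sup>2 \<le> (inv_const d * (2 * 3 ^ Suc d / (b - a) * sqrt (3 ^ Suc d * J / (b - a))))\<^sup>2"
      by (rule power_mono) simp
    also have "\<dots> = (inv_const d)\<^sup>2 * ((2 * 3 ^ Suc d)\<^sup>2 / (b - a)\<^sup>2) * (3 ^ Suc d * J / (b - a))"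
      using J p(2) by (simp only: power_mult_distrib power_divide real_sqrt_pow2_iff real_sqrt_pow2 mult.assoc)
        (subst real_sqrt_pow2, auto)
    also have "\<dots> = C * J / (b - a) ^ 3"
      unfolding C_def power_mult_distrib by (simp add: power2_eq_square power3_eq_cube)
    finally show ?P2 by (simp add: J_def)
  qed
  have "C \<ge> 0" by (simp add: C_def)
  then show ?thesis using 1 2 by blast
qed

text \<open>Allows the canonical \<open>deriv f\<close> to replace an ad hoc \<open>g\<close>. At
  the finitely many exceptional points its value is unspecified, so measurability and boundedness
  are obtained by changing \<open>g\<close> there.\<close>

lemma pw_deriv_deriv:
  assumes "pw_deriv f g" shows "pw_deriv f (deriv f)"
proof -
  obtain Z where Z: "finite Z" "\<forall>x\<in>{0<..<1} - Z. (f has_real_derivative g x) (at x)"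
    using assms unfolding pw_deriv_def by blast
  define F where "F = Z \<union> {0, 1}"
  have F: "finite F" using Z(1) by (simp add: F_def)
  have d: "deriv f x = g x" if "x \<in> {0..1} - F" for x
    using Z(2) that by (intro DERIV_imp_deriv) (auto simp: F_def)
  have "(\<lambda>x. g x * indicator (- F) x + (\<Sum>y\<in>F. deriv f y * indicator {y} x)) \<in> bdd_meas"
    using F pw_deriv_bdd(2)[OF assms]
    by (intro bdd_meas_add bdd_meas_mult bdd_meas_sum bdd_meas_const bdd_meas_indicator)
      (auto intro!: borel_closed borel_open open_Compl finite_imp_closed)
  then have "deriv f \<in> bdd_meas"
  proof (rule bdd_meas_cong)
    fix x :: real assume x: "x \<in> {0..1}"
    have "(\<Sum>y\<in>F. deriv f y * indicator {y} x) = (\<Sum>y\<in>F. if y = x then deriv f y else 0)"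
      by (intro sum.cong) (auto simp: indicator_def)
    also have "\<dots> = (if x \<in> F then deriv f x else 0)" using F by (simp add: sum.delta)
    finally show "g x * indicator (- F) x + (\<Sum>y\<in>F. deriv f y * indicator {y} x) = deriv f x"
      using d[of x] x by (auto simp: indicator_def)
  qed
  moreover have "\<forall>x\<in>{0<..<1} - F. (f has_real_derivative deriv f x) (at x)"
  proof
    fix x assume x: "x \<in> {0<..<1} - F"
    have "(f has_real_derivative g x) (at x)" using Z(2) x by (auto simp: F_def)
    then show "(f has_real_derivative deriv f x) (at x)" using d[of x] x by auto
  qed
  ultimately show ?thesis using assms F unfolding pw_deriv_def by blast
qed

section \<open>Classical derivatives on the closed interval and the spaces \<open>Ck\<close>\<close>

lemma dx_cong: "(\<And>y. y \<in> {0..1} \<Longrightarrow> f y = g y) \<Longrightarrow> x \<in> {0..1} \<Longrightarrow> dx f x = dx g x"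
  unfolding dx_def vector_derivative_def
  by (metis has_vector_derivative_transform)

lemma dx_eqI:
  assumes "(f has_vector_derivative d) (at x within {0..1})" "x \<in> {0..1}"
  shows "dx f x = d"
  unfolding dx_def using vector_derivative_within_cbox[of 0 1 x f d] assms by simp

text \<open>Iterating \<open>dx\<close> produces functions that are uncontrolled off
  \<open>[0,1]\<close>; supplying the intended derivatives as a family \<open>D\<close> avoids
  reasoning about them.\<close>

lemma CkI:
  assumes 0: "\<And>x. x \<in> {0..1} \<Longrightarrow> D 0 x = f x"
    and D: "\<And>j x. j < k \<Longrightarrow> x \<in> {0..1} \<Longrightarrow> (D j has_vector_derivative D (Suc j) x) (at x within {0..1})"
    and c: "continuous_on {0..1} (D k)"
  shows "f \<in> Ck k" "\<And>j x. j \<le> k \<Longrightarrow> x \<in> {0..1} \<Longrightarrow> (dx ^^ j) f x = D j x"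
proof -
  have eq: "(dx ^^ j) f x = D j x" if "j \<le> k" "x \<in> {0..1}" for j x
    using that
  proof (induction j arbitrary: x)
    case (Suc j)
    have "dx ((dx ^^ j) f) x = dx (D j) x" using Suc by (intro dx_cong) auto
    also have "\<dots> = D (Suc j) x" using Suc by (intro dx_eqI D) auto
    finally show ?case by simp
  qed (use 0 in auto)
  then show "\<And>j x. j \<le> k \<Longrightarrow> x \<in> {0..1} \<Longrightarrow> (dx ^^ j) f x = D j x" .
  have d: "((dx ^^ j) f has_vector_derivative D (Suc j) x) (at x within {0..1})"
    if "j < k" "x \<in> {0..1}" for j x
    by (rule has_vector_derivative_transform[OF _ _ D]) (use that eq in auto)
  show "f \<in> Ck k" unfolding Ck_def
  proof (intro CollectI conjI allI impI)
    fix j assume "j < k"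
    then show "(dx ^^ j) f differentiable_on {0..1}" unfolding differentiable_on_def
      using d differentiableI_vector by blast
  next
    fix j assume "j \<le> k"
    show "continuous_on {0..1} ((dx ^^ j) f)"
    proof (cases "j = k")
      case True
      then show ?thesis using c eq[of k] continuous_on_cong[of "{0..1}" "{0..1}" "D k" "(dx ^^ k) f"] by simp
    next
      case False
      then show ?thesis using \<open>j \<le> k\<close> d[of j]
        by (intro continuous_on_vector_derivative[of "{0..1}" _ "D (Suc j)"]) auto
    qed
  qed
qed

lemma Ck_has_vector_derivative:
  assumes "f \<in> Ck k" "j < k" "x \<in> {0..1}"
  shows "((dx ^^ j) f has_vector_derivative (dx ^^ Suc j) f x) (at x within {0..1})"
  using assms unfolding Ck_def differentiable_on_def
  by (auto simp: dx_def[of "(dx ^^ j) f"] vector_derivative_works[symmetric])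

lemma Ck_cont: "f \<in> Ck k \<Longrightarrow> j \<le> k \<Longrightarrow> continuous_on {0..1} ((dx ^^ j) f)"
  unfolding Ck_def by blast

lemma Ck_lincomb:
  assumes f: "f \<in> Ck k" and g: "g \<in> Ck k"
  shows "(\<lambda>x. a * f x + b * g x) \<in> Ck k"
proof (rule CkI(1)[of "\<lambda>j x. a * (dx ^^ j) f x + b * (dx ^^ j) g x"])
  show "((\<lambda>x. a * (dx ^^ j) f x + b * (dx ^^ j) g x) has_vector_derivative
      a * (dx ^^ Suc j) f x + b * (dx ^^ Suc j) g x) (at x within {0..1})" if "j < k" "x \<in> {0..1}" for j x
    using Ck_has_vector_derivative[OF f that] Ck_has_vector_derivative[OF g that]
    by (intro has_vector_derivative_add has_vector_derivative_mult_right)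
  show "continuous_on {0..1} (\<lambda>x. a * (dx ^^ k) f x + b * (dx ^^ k) g x)"
    using Ck_cont[OF f] Ck_cont[OF g] by (intro continuous_intros) auto
qed simp

lemma Ck_zero: "(\<lambda>x. 0) \<in> Ck k"
  by (rule CkI(1)[of "\<lambda>j x. 0"]) auto

lemma Ck_mono: "f \<in> Ck k \<Longrightarrow> j \<le> k \<Longrightarrow> f \<in> Ck j"
  unfolding Ck_def by auto

lemma Ck_pw_deriv: "f \<in> Ck k \<Longrightarrow> j < k \<Longrightarrow> pw_deriv ((dx ^^ j) f) ((dx ^^ Suc j) f)"
  using pw_deriv_dx[of "(dx ^^ j) f"] Ck_cont[of f k "Suc j"] unfolding Ck_def by auto

section \<open>Finite element spaces\<close>

locale fe_mesh =
  fixes r \<mu> N :: nat and z :: "nat \<Rightarrow> real"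
  assumes r: "2 \<le> r" and mu: "\<mu> \<le> r - 2" and mesh: "is_mesh (N, z)"
begin

abbreviation S :: "(real \<Rightarrow> real) set" where "S \<equiv> fe_space r \<mu> (N, z)"
abbreviation h :: real where "h \<equiv> max_length (N, z)"

lemma z_first: "z 1 = 0" "z (Suc 0) = 0" and z_last: "z (N + 1) = 1" "z (Suc N) = 1"
  and N_pos: "1 \<le> N" and z_step: "i \<in> {1..N} \<Longrightarrow> z i < z (i + 1)"
  using mesh by (auto simp: is_mesh_def)

lemma z_mono: "1 \<le> i \<Longrightarrow> i \<le> j \<Longrightarrow> j \<le> N + 1 \<Longrightarrow> z i \<le> z j"
proof (induction j)
  case (Suc j)
  show ?case
  proof (cases "i = Suc j")
    case False
    then have "z i \<le> z j" using Suc by auto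
    also have "z j < z (j + 1)" using Suc False by (intro z_step) auto
    finally show ?thesis by simp
  qed simp
qed simp

lemma z_range: "i \<in> {1..N + 1} \<Longrightarrow> z i \<in> {0..1}"
  using z_mono[of 1 i] z_mono[of i "N + 1"] z_first z_last by auto

lemma cell_sub: "i \<in> {1..N} \<Longrightarrow> {z i..z (i + 1)} \<subseteq> {0..1}"
  using z_range[of i] z_range[of "i + 1"] by auto

lemma cell_ex:
  assumes "x \<in> {0..1}" obtains i where "i \<in> {1..N}" "x \<in> {z i..z (i + 1)}"
proof -
  have "\<exists>i\<in>{1..n}. x \<in> {z i..z (i + 1)}" if "1 \<le> n" "n \<le> N" "x \<le> z (n + 1)" for n
    using that
  proof (induction n rule: dec_induct)
    case base
    then show ?case using assms z_first by auto
  next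
    case (step n)
    show ?case
    proof (cases "x \<le> z (n + 1)")
      case True
      then show ?thesis using step by fastforce
    next
      case False
      then show ?thesis using step by (intro bexI[of _ "Suc n"]) auto
    qed
  qed
  from this[of N] show thesis using that N_pos assms z_last by auto
qed

lemma len_le: "i \<in> {1..N} \<Longrightarrow> z (i + 1) - z i \<le> h"
  by (simp add: max_length_def)

lemma min_len_le: "i \<in> {1..N} \<Longrightarrow> min_length (N, z) \<le> z (i + 1) - z i"
  by (simp add: min_length_def)

lemma min_len_pos: "0 < min_length (N, z)"
  unfolding min_length_def using N_pos z_step by (auto simp: Min_gr_iff)

lemma h_pos: "0 < h"
  using len_le[of 1] z_step[of 1] N_pos by force

lemma fe_spaceD:
  assumes "\<phi> \<in> S"
  shows "\<phi> \<in> Ck \<mu>" "continuous_on {0..1} \<phi>" "\<phi> 0 = 0" "\<phi> 1 = 0"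
    and "\<And>i. i \<in> {1..N} \<Longrightarrow> \<exists>p::real poly. degree p \<le> r - 1 \<and> (\<forall>x\<in>{z i..z (i + 1)}. \<phi> x = poly p x)"
  using assms by (auto simp: fe_space_def spline_space_def H10_def)

lemma piecewise_poly_pw_deriv:
  assumes c: "continuous_on {0..1} \<phi>"
    and p: "\<And>i. i \<in> {1..N} \<Longrightarrow> \<exists>p::real poly. degree p \<le> r - 1 \<and> (\<forall>x\<in>{z i..z (i + 1)}. \<phi> x = poly p x)"
  shows "pw_deriv \<phi> (deriv \<phi>)"
proof -
  obtain p :: "nat \<Rightarrow> real poly" where p: "\<And>i x. i \<in> {1..N} \<Longrightarrow> x \<in> {z i..z (i + 1)} \<Longrightarrow> \<phi> x = poly (p i) x"
    using p by metis
  \<comment> \<open>Open cells are disjoint, so off the nodes exactly one summand survives; at the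
    nodes the sum is \<open>0\<close>, a harmless choice.\<close>
  define g where "g x = (\<Sum>i\<in>{1..N}. indicator {z i<..<z (i + 1)} x * poly (pderiv (p i)) x)" for x
  have gb: "g \<in> bdd_meas" unfolding g_def
    by (intro bdd_meas_sum bdd_meas_mult bdd_meas_indicator bdd_meas_cont continuous_intros) auto
  have "(\<phi> has_real_derivative g x) (at x)" if x: "x \<in> {0<..<1} - z ` {1..N + 1}" for x
  proof -
    obtain i where i: "i \<in> {1..N}" "x \<in> {z i..z (i + 1)}" using cell_ex[of x] x by auto
    have "x \<noteq> z i" "x \<noteq> z (i + 1)" using x i(1) by auto
    then have xi: "x \<in> {z i<..<z (i + 1)}" using i(2) by auto
    have "indicator {z j<..<z (j + 1)} x = (if j = i then 1 else 0 :: real)" if j: "j \<in> {1..N}" for j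
    proof (cases j i rule: linorder_cases)
      case less
      then show ?thesis using z_mono[of "j + 1" i] i j xi by (auto simp: indicator_def)
    next
      case greater
      then show ?thesis using z_mono[of "i + 1" j] i j xi by (auto simp: indicator_def)
    qed (use xi in auto)
    then have "g x = (\<Sum>j\<in>{1..N}. if j = i then poly (pderiv (p j)) x else 0)"
      unfolding g_def by (intro sum.cong) auto
    also have "\<dots> = poly (pderiv (p i)) x" using i(1) by simp
    finally have g: "g x = poly (pderiv (p i)) x" .
    have "\<forall>\<^sub>F y in nhds x. y \<in> {z i<..<z (i + 1)}" using xi by (intro eventually_nhds_in_open) auto
    then have "\<forall>\<^sub>F y in nhds x. \<phi> y = poly (p i) y" by eventually_elim (use p[OF i(1)] in auto)
    then show ?thesis unfolding g
      by (subst DERIV_cong_ev[OF refl _ refl]) (auto intro: poly_DERIV)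
  qed
  then have "pw_deriv \<phi> g" unfolding pw_deriv_def using c gb
    by (intro conjI exI[of _ "z ` {1..N + 1}"]) auto
  then show ?thesis by (rule pw_deriv_deriv)
qed

lemma fe_pw: "\<phi> \<in> S \<Longrightarrow> pw_deriv \<phi> (deriv \<phi>)"
  by (intro piecewise_poly_pw_deriv) (use fe_spaceD in auto)

lemma fe_bdd [simp, intro]: "\<phi> \<in> S \<Longrightarrow> \<phi> \<in> bdd_meas" "\<phi> \<in> S \<Longrightarrow> deriv \<phi> \<in> bdd_meas"
  using fe_pw pw_deriv_bdd by blast+

lemma fe_spaceI:
  assumes "\<phi> \<in> Ck \<mu>" "\<phi> 0 = 0" "\<phi> 1 = 0"
    and p: "\<And>i. i \<in> {1..N} \<Longrightarrow> \<exists>p::real poly. degree p \<le> r - 1 \<and> (\<forall>x\<in>{z i..z (i + 1)}. \<phi> x = poly p x)"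
  shows "\<phi> \<in> S"
proof -
  have c: "continuous_on {0..1} \<phi>" using Ck_cont[OF assms(1), of 0] by simp
  have "\<phi> \<in> H1" using pw_deriv_H1[OF piecewise_poly_pw_deriv[OF c p]] by blast
  then show ?thesis using assms c unfolding fe_space_def spline_space_def H10_def by auto
qed

lemma fe_zero: "(\<lambda>x. 0) \<in> S"
  by (rule fe_spaceI) (auto simp: Ck_zero intro!: exI[of _ "0::real poly"])

lemma fe_lincomb:
  assumes f: "f \<in> S" and g: "g \<in> S"
  shows "(\<lambda>x. a * f x + b * g x) \<in> S"
proof (rule fe_spaceI)
  show "(\<lambda>x. a * f x + b * g x) \<in> Ck \<mu>" using fe_spaceD(1) f g by (intro Ck_lincomb) auto
  fix i assume i: "i \<in> {1..N}"
  obtain p q :: "real poly" where "degree p \<le> r - 1" "\<forall>x\<in>{z i..z (i + 1)}. f x = poly p x"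
    "degree q \<le> r - 1" "\<forall>x\<in>{z i..z (i + 1)}. g x = poly q x"
    using fe_spaceD(5)[OF f i] fe_spaceD(5)[OF g i] by blast
  then show "\<exists>p::real poly. degree p \<le> r - 1 \<and> (\<forall>x\<in>{z i..z (i + 1)}. a * f x + b * g x = poly p x)"
    by (intro exI[of _ "smult a p + smult b q"]) (auto intro!: degree_add_le order_trans[OF degree_smult_le])
qed (simp_all add: fe_spaceD[OF f] fe_spaceD[OF g])

text \<open>A polynomial of degree at most \<open>r - 1\<close> with \<open>r\<close> zeros
  vanishes, so \<open>r\<close> points per cell suffice. This finite set stands in for a basis in
  the later finite-dimensional arguments.\<close>

lemma fe_determining:
  obtains X where "finite X" "X \<subseteq> {0..1}"
    "\<And>\<phi> x. \<phi> \<in> S \<Longrightarrow> (\<And>y. y \<in> X \<Longrightarrow> \<phi> y = 0) \<Longrightarrow> x \<in> {0..1} \<Longrightarrow> \<phi> x = 0"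
proof -
  have "\<exists>Y\<subseteq>{z i..z (i + 1)}. finite Y \<and> card Y = r" if "i \<in> {1..N}" for i
    using infinite_arbitrarily_large[of "{z i..z (i + 1)}" r] z_step[OF that] infinite_Icc by blast
  then obtain Y where Y: "\<And>i. i \<in> {1..N} \<Longrightarrow> Y i \<subseteq> {z i..z (i + 1)} \<and> finite (Y i) \<and> card (Y i) = r"
    by metis
  show thesis
  proof (rule that[of "\<Union>i\<in>{1..N}. Y i"])
    show "finite (\<Union>i\<in>{1..N}. Y i)" "(\<Union>i\<in>{1..N}. Y i) \<subseteq> {0..1}"
      using Y cell_sub by blast+
    fix \<phi> x assume \<phi>: "\<phi> \<in> S" "\<And>y. y \<in> (\<Union>i\<in>{1..N}. Y i) \<Longrightarrow> \<phi> y = 0" and x: "x \<in> {0..1::real}"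
    obtain i where i: "i \<in> {1..N}" "x \<in> {z i..z (i + 1)}" using cell_ex x by blast
    obtain p :: "real poly" where p: "degree p \<le> r - 1" "\<forall>x\<in>{z i..z (i + 1)}. \<phi> x = poly p x"
      using fe_spaceD(5)[OF \<phi>(1) i(1)] by blast
    have "p = 0"
    proof (rule ccontr)
      assume "p \<noteq> 0"
      have "Y i \<subseteq> {x. poly p x = 0}" using Y[OF i(1)] \<phi>(2) p(2) i(1) by fastforce
      then have "r \<le> card {x. poly p x = 0}"
        using Y[OF i(1)] card_mono[OF poly_roots_finite[OF \<open>p \<noteq> 0\<close>]] by metis
      also have "\<dots> \<le> degree p" using \<open>p \<noteq> 0\<close> by (rule card_poly_roots_bound)
      finally show False using p(1) r by simp
    qed
    then show "\<phi> x = 0" using p(2) i(2) by simp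
  qed
qed

lemma cell_deriv:
  assumes "\<phi> \<in> S" "i \<in> {1..N}"
  obtains p :: "real poly" where "degree p \<le> r - 1" "\<And>x. x \<in> {z i..z (i + 1)} \<Longrightarrow> \<phi> x = poly p x"
    "\<And>x. x \<in> {z i<..<z (i + 1)} \<Longrightarrow> deriv \<phi> x = poly (pderiv p) x"
proof -
  obtain p :: "real poly" where p: "degree p \<le> r - 1" "\<forall>x\<in>{z i..z (i + 1)}. \<phi> x = poly p x"
    using fe_spaceD(5)[OF assms] by blast
  have "deriv \<phi> x = poly (pderiv p) x" if x: "x \<in> {z i<..<z (i + 1)}" for x
  proof (rule DERIV_imp_deriv)
    have "\<forall>\<^sub>F y in nhds x. y \<in> {z i<..<z (i + 1)}" using x by (intro eventually_nhds_in_open) auto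
    then have "\<forall>\<^sub>F y in nhds x. \<phi> y = poly p y" by eventually_elim (use p in auto)
    then show "(\<phi> has_real_derivative poly (pderiv p) x) (at x)"
      by (subst DERIV_cong_ev[OF refl _ refl]) (auto intro: poly_DERIV)
  qed
  then show thesis using that p by blast
qed

lemma integral_cells:
  fixes f :: "real \<Rightarrow> real"
  assumes "f integrable_on {0..1}"
  shows "integral {0..1} f = (\<Sum>i\<in>{1..N}. integral {z i..z (i + 1)} f)"
proof -
  have "integral {0..z (n + 1)} f = (\<Sum>i\<in>{1..n}. integral {z i..z (i + 1)} f)" if "n \<le> N" for n
    using that
  proof (induction n)
    case 0
    then show ?case using z_first by simp
  next
    case (Suc n)
    have "f integrable_on {0..z (Suc n + 1)}"
      using integrable_on_subinterval[OF assms] z_range[of "Suc n + 1"] Suc by auto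
    then have "integral {0..z (n + 1)} f + integral {z (n + 1)..z (Suc n + 1)} f = integral {0..z (Suc n + 1)} f"
      using z_range[of "n + 1"] z_step[of "Suc n"] Suc by (intro Henstock_Kurzweil_Integration.integral_combine) auto
    then show ?case using Suc by simp
  qed
  from this[of N] show ?thesis using z_last by simp
qed

lemma AE_cells: "AE x in UI. \<exists>i\<in>{1..N}. x \<in> {z i<..<z (i + 1)}"
  using AE_UI_interior AE_UI_finite[of "z ` {1..N + 1}", simplified]
proof eventually_elim
  case (elim x)
  then obtain i where i: "i \<in> {1..N}" "x \<in> {z i..z (i + 1)}" using cell_ex[of x] by auto
  then have "z i \<in> z ` {Suc 0..Suc N}" "z (i + 1) \<in> z ` {Suc 0..Suc N}" by auto
  then have "x \<noteq> z i" "x \<noteq> z (i + 1)" using elim by metis+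
  then have "x \<in> {z i<..<z (i + 1)}" using i(2) by simp
  then show ?case using i(1) by blast
qed

end

section \<open>Inverse estimates on finite element spaces\<close>

lemma bdd_meas_integrable_on: "f \<in> bdd_meas \<Longrightarrow> {a..b} \<subseteq> {0..1} \<Longrightarrow> f integrable_on {a..b}"
  using has_integral_UI integrable_on_subinterval has_integral_integrable by blast

lemma bdd_meas_integral_le:
  assumes "f \<in> bdd_meas" "\<And>x. x \<in> {0..1} \<Longrightarrow> 0 \<le> f x" "{a..b} \<subseteq> {0..1}"
  shows "integral {a..b} f \<le> (LINT x|UI. f x)"
  unfolding integral_UI[OF assms(1)]
  using assms by (intro integral_subset_le bdd_meas_integrable_on) auto

lemma integral_open_cong:
  fixes f g :: "real \<Rightarrow> real"
  assumes "\<And>x. x \<in> {a<..<b} \<Longrightarrow> f x = g x" shows "integral {a..b} f = integral {a..b} g"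
  using assms by (subst (1 2) integral_open_interval_real) (auto intro: integral_cong)

text \<open>Cellwise applications of the polynomial estimate, with \<open>C\<close> chosen before
  the mesh. In the second one, the \<open>L2\<close> norm of \<open>deriv \<phi>\<close> over a cell
  of length \<open>l\<close> is controlled by its distance to \<open>g\<close> and by
  \<open>sqrt l * M\<close>; dividing by \<open>sqrt l\<close> makes only the distance pay for the
  small cell.\<close>

lemma fe_inverse:
  obtains C :: real where "C \<ge> 0"
    and "\<And>\<mu> N z \<phi>. fe_mesh r \<mu> N z \<Longrightarrow> \<phi> \<in> fe_space r \<mu> (N, z) \<Longrightarrow>
        l2_norm (deriv \<phi>) \<le> C * l2_norm \<phi> / min_length (N, z)"
    and "\<And>\<mu> N z \<phi> g M. fe_mesh r \<mu> N z \<Longrightarrow> \<phi> \<in> fe_space r \<mu> (N, z) \<Longrightarrow> g \<in> bdd_meas \<Longrightarrow>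
        (\<And>x. x \<in> {0..1} \<Longrightarrow> \<bar>g x\<bar> \<le> M) \<Longrightarrow>
        AE x in UI. \<bar>deriv \<phi> x\<bar> \<le> C * (l2_norm (\<lambda>x. deriv \<phi> x - g x) / sqrt (min_length (N, z)) + M)"
proof -
  obtain C :: real where C1: "C \<ge> 0" and C': "\<forall>p a b x. degree p \<le> r \<longrightarrow> a < b \<longrightarrow> x \<in> {a..b} \<longrightarrow>
     (poly p x)\<^sup>2 \<le> C * integral {a..b} (\<lambda>x. (poly p x)\<^sup>2) / (b - a) \<and>
     (poly (pderiv p) x)\<^sup>2 \<le> C * integral {a..b} (\<lambda>x. (poly p x)\<^sup>2) / (b - a) ^ 3"
    using poly_inverse_estimate[of r] by (elim exE conjE)
  have C2: "(poly p x)\<^sup>2 \<le> C * integral {a..b} (\<lambda>x. (poly p x)\<^sup>2) / (b - a)"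
    and C3: "(poly (pderiv p) x)\<^sup>2 \<le> C * integral {a..b} (\<lambda>x. (poly p x)\<^sup>2) / (b - a) ^ 3"
    if "degree p \<le> r" "a < b" "x \<in> {a..b}" for p a b x
    using C' that by blast+
  have 1: "l2_norm (deriv \<phi>) \<le> sqrt (2 * C) * l2_norm \<phi> / min_length (N, z)"
    if m: "fe_mesh r \<mu> N z" and \<phi>: "\<phi> \<in> fe_space r \<mu> (N, z)" for \<mu> N z \<phi>
  proof -
    interpret fe_mesh r \<mu> N z by (rule m)
    define k where "k = min_length (N, z)"
    have k: "k > 0" unfolding k_def by (rule min_len_pos)
    have b: "(\<lambda>x. (deriv \<phi> x)\<^sup>2) \<in> bdd_meas" "(\<lambda>x. (\<phi> x)\<^sup>2) \<in> bdd_meas" using \<phi> by auto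
    have cell: "integral {z i..z (i + 1)} (\<lambda>x. (deriv \<phi> x)\<^sup>2) \<le> C / k\<^sup>2 * integral {z i..z (i + 1)} (\<lambda>x. (\<phi> x)\<^sup>2)"
      if i: "i \<in> {1..N}" for i
    proof -
      obtain p where p: "degree p \<le> r - 1" "\<And>x. x \<in> {z i..z (i + 1)} \<Longrightarrow> \<phi> x = poly p x"
        "\<And>x. x \<in> {z i<..<z (i + 1)} \<Longrightarrow> deriv \<phi> x = poly (pderiv p) x"
        using cell_deriv[OF \<phi> i] by blast
      define l where "l = z (i + 1) - z i"
      define J where "J = integral {z i..z (i + 1)} (\<lambda>x. (poly p x)\<^sup>2)"
      have l: "l > 0" "k \<le> l" unfolding l_def k_def using z_step[OF i] min_len_le[OF i] by auto
      have J0: "J \<ge> 0" unfolding J_def by (intro integral_nonneg integrable_continuous_interval continuous_intros) auto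
      have J: "integral {z i..z (i + 1)} (\<lambda>x. (\<phi> x)\<^sup>2) = J"
        unfolding J_def using p(2) by (intro integral_cong) auto
      have "integral {z i..z (i + 1)} (\<lambda>x. (deriv \<phi> x)\<^sup>2) = integral {z i..z (i + 1)} (\<lambda>x. (poly (pderiv p) x)\<^sup>2)"
        using p(3) by (intro integral_open_cong) auto
      also have "\<dots> \<le> integral {z i..z (i + 1)} (\<lambda>x. C * J / l ^ 3)"
        unfolding l_def J_def using C3[of p "z i" "z (i + 1)"] p(1) z_step[OF i]
        by (intro integral_le integrable_continuous_interval continuous_intros) auto
      also have "\<dots> = l * (C * J / l ^ 3)" using z_step[OF i] by (simp add: l_def)
      also have "\<dots> = C * J / l\<^sup>2" using l by (simp add: power2_eq_square power3_eq_cube)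
      also have "\<dots> \<le> C * J / k\<^sup>2" using C1 J0 k l by (intro divide_left_mono power_mono) auto
      finally show ?thesis unfolding J by simp
    qed
    have "l2_inner (deriv \<phi>) (deriv \<phi>) = integral {0..1} (\<lambda>x. (deriv \<phi> x)\<^sup>2)"
      unfolding l2_inner_def by (simp add: integral_UI[OF b(1)] flip: power2_eq_square)
    also have "\<dots> = (\<Sum>i\<in>{1..N}. integral {z i..z (i + 1)} (\<lambda>x. (deriv \<phi> x)\<^sup>2))"
      using b by (intro integral_cells bdd_meas_integrable_on) auto
    also have "\<dots> \<le> (\<Sum>i\<in>{1..N}. C / k\<^sup>2 * integral {z i..z (i + 1)} (\<lambda>x. (\<phi> x)\<^sup>2))"
      by (intro sum_mono cell)
    also have "\<dots> = C / k\<^sup>2 * integral {0..1} (\<lambda>x. (\<phi> x)\<^sup>2)"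
      using b by (subst integral_cells) (auto intro!: bdd_meas_integrable_on simp: sum_distrib_left)
    also have "\<dots> = C / k\<^sup>2 * l2_inner \<phi> \<phi>"
      unfolding l2_inner_def by (simp add: integral_UI[OF b(2)] flip: power2_eq_square)
    \<comment> \<open>The factor 2 is inserted so that both estimates share the constant
      \<open>sqrt (2 * C)\<close>.\<close>
    also have "\<dots> \<le> 2 * C / k\<^sup>2 * l2_inner \<phi> \<phi>"
      using C1 k l2_self_nonneg by (intro mult_right_mono divide_right_mono) auto
    finally have "sqrt (l2_inner (deriv \<phi>) (deriv \<phi>)) \<le> sqrt (2 * C / k\<^sup>2 * l2_inner \<phi> \<phi>)" by simp
    then show ?thesis using k
      by (simp add: l2_norm_def real_sqrt_mult real_sqrt_divide k_def[symmetric])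
  qed
  have 2: "AE x in UI. \<bar>deriv \<phi> x\<bar> \<le> sqrt (2 * C) * (l2_norm (\<lambda>x. deriv \<phi> x - g x) / sqrt (min_length (N, z)) + M)"
    if m: "fe_mesh r \<mu> N z" and \<phi>: "\<phi> \<in> fe_space r \<mu> (N, z)" and g: "g \<in> bdd_meas"
      and M: "\<And>x. x \<in> {0..1} \<Longrightarrow> \<bar>g x\<bar> \<le> M" for \<mu> N z \<phi> g M
  proof -
    interpret fe_mesh r \<mu> N z by (rule m)
    define k where "k = min_length (N, z)"
    define E where "E = l2_norm (\<lambda>x. deriv \<phi> x - g x)"
    have k: "k > 0" unfolding k_def by (rule min_len_pos)
    have M0: "M \<ge> 0" using M[of 0] by simp
    have E0: "E \<ge> 0" by (simp add: E_def)
    have b: "(\<lambda>x. (deriv \<phi> x - g x)\<^sup>2) \<in> bdd_meas" using \<phi> g by auto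
    have E2: "E\<^sup>2 = (LINT x|UI. (deriv \<phi> x - g x)\<^sup>2)"
      unfolding E_def l2_norm_sq l2_inner_def by (simp add: power2_eq_square)
    have cell: "\<bar>deriv \<phi> x\<bar> \<le> sqrt (2 * C) * (E / sqrt k + M)"
      if i: "i \<in> {1..N}" and x: "x \<in> {z i<..<z (i + 1)}" for i x
    proof -
      obtain p where p: "degree p \<le> r - 1" "\<And>x. x \<in> {z i..z (i + 1)} \<Longrightarrow> \<phi> x = poly p x"
        "\<And>x. x \<in> {z i<..<z (i + 1)} \<Longrightarrow> deriv \<phi> x = poly (pderiv p) x"
        using cell_deriv[OF \<phi> i] by blast
      define l where "l = z (i + 1) - z i"
      have l: "l > 0" "k \<le> l" unfolding l_def k_def using z_step[OF i] min_len_le[OF i] by auto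
      have "integral {z i..z (i + 1)} (\<lambda>x. (poly (pderiv p) x)\<^sup>2) = integral {z i..z (i + 1)} (\<lambda>x. (deriv \<phi> x)\<^sup>2)"
        using p(3) by (intro integral_open_cong) auto
      also have "\<dots> \<le> integral {z i..z (i + 1)} (\<lambda>x. 2 * (deriv \<phi> x - g x)\<^sup>2 + 2 * M\<^sup>2)"
      proof (rule integral_le)
        fix y assume "y \<in> {z i..z (i + 1)}"
        then have y: "(g y)\<^sup>2 \<le> M\<^sup>2" using M[of y] cell_sub[OF i] M0 by (auto simp: abs_le_square_iff[symmetric])
        \<comment> \<open>This square is exactly the gap between the two sides of the next
          inequality.\<close>
        have "0 \<le> (deriv \<phi> y - 2 * g y)\<^sup>2" by simp
        then have "(deriv \<phi> y)\<^sup>2 \<le> 2 * (deriv \<phi> y - g y)\<^sup>2 + 2 * (g y)\<^sup>2"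
          by (simp add: power2_eq_square algebra_simps)
        then show "(deriv \<phi> y)\<^sup>2 \<le> 2 * (deriv \<phi> y - g y)\<^sup>2 + 2 * M\<^sup>2" using y by linarith
      qed (use \<phi> b cell_sub[OF i] in \<open>auto intro!: bdd_meas_integrable_on\<close>)
      also have "\<dots> = 2 * integral {z i..z (i + 1)} (\<lambda>x. (deriv \<phi> x - g x)\<^sup>2) + 2 * l * M\<^sup>2"
        using b cell_sub[OF i] z_step[OF i]
        by (subst Henstock_Kurzweil_Integration.integral_add) (auto intro!: bdd_meas_integrable_on simp: l_def)
      also have "\<dots> \<le> 2 * E\<^sup>2 + 2 * l * M\<^sup>2"
        unfolding E2 using bdd_meas_integral_le[OF b _ cell_sub[OF i]] by simp
      finally have J: "integral {z i..z (i + 1)} (\<lambda>x. (poly (pderiv p) x)\<^sup>2) \<le> 2 * E\<^sup>2 + 2 * l * M\<^sup>2" .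
      have "(deriv \<phi> x)\<^sup>2 \<le> C * integral {z i..z (i + 1)} (\<lambda>x. (poly (pderiv p) x)\<^sup>2) / l"
        using C2[of "pderiv p" "z i" "z (i + 1)" x] x p(1,3) z_step[OF i] by (simp add: degree_pderiv l_def)
      also have "\<dots> \<le> C * (2 * E\<^sup>2 + 2 * l * M\<^sup>2) / l"
        using J C1 l by (intro divide_right_mono mult_left_mono) auto
      also have "\<dots> = 2 * C * (E\<^sup>2 / l + M\<^sup>2)" using l by (simp add: field_simps)
      also have "\<dots> \<le> 2 * C * (E\<^sup>2 / k + M\<^sup>2)"
        using l k C1 by (intro mult_left_mono add_right_mono divide_left_mono) auto
      also have "\<dots> \<le> 2 * C * (E / sqrt k + M)\<^sup>2"
        using C1 k E0 M0 by (intro mult_left_mono) (auto simp: power2_sum power_divide)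
      also have "\<dots> = (sqrt (2 * C) * (E / sqrt k + M))\<^sup>2" using C1 by (simp add: power_mult_distrib)
      finally have "\<bar>deriv \<phi> x\<bar>\<^sup>2 \<le> (sqrt (2 * C) * (E / sqrt k + M))\<^sup>2" by simp
      then show ?thesis
        by (rule power2_le_imp_le) (intro mult_nonneg_nonneg add_nonneg_nonneg divide_nonneg_nonneg real_sqrt_ge_zero; use C1 E0 k M0 in simp)
    qed
    show ?thesis using AE_cells by eventually_elim (use cell in \<open>auto simp: E_def k_def\<close>)
  qed
  show thesis by (rule that[of "sqrt (2 * C)"]) (use C1 in simp, rule 1, assumption+, rule 2)
qed

section \<open>Linear algebra in spaces determined by finitely many point values\<close>

text \<open>Linear structure is a predicate on sets of functions, since the spaces depend on the
  mesh and are cut down point by point in the inductions below.\<close>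

definition lin_set :: "(real \<Rightarrow> real) set \<Rightarrow> bool" where
  "lin_set S \<longleftrightarrow> (\<lambda>x. 0) \<in> S \<and> (\<forall>f\<in>S. \<forall>g\<in>S. \<forall>a b. (\<lambda>x. a * f x + b * g x) \<in> S)"

definition lin_on :: "(real \<Rightarrow> real) set \<Rightarrow> ((real \<Rightarrow> real) \<Rightarrow> real) \<Rightarrow> bool" where
  "lin_on S L \<longleftrightarrow> (\<forall>f\<in>S. \<forall>g\<in>S. \<forall>a b. L (\<lambda>x. a * f x + b * g x) = a * L f + b * L g)"

lemma lin_setD: "lin_set S \<Longrightarrow> f \<in> S \<Longrightarrow> g \<in> S \<Longrightarrow> (\<lambda>x. a * f x + b * g x) \<in> S"
  unfolding lin_set_def by blast

lemma lin_onD: "lin_on S L \<Longrightarrow> f \<in> S \<Longrightarrow> g \<in> S \<Longrightarrow> L (\<lambda>x. a * f x + b * g x) = a * L f + b * L g"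
  unfolding lin_on_def by blast

lemma lin_set_sum:
  fixes n :: nat
  assumes "lin_set S" "\<And>i. i < n \<Longrightarrow> e i \<in> S"
  shows "(\<lambda>x. \<Sum>i<n. c i * e i x) \<in> S"
  using assms(2)
proof (induction n)
  case (Suc n)
  then show ?case using lin_setD[OF assms(1), of "\<lambda>x. \<Sum>i<n. c i * e i x" "e n" 1 "c n"] by simp
qed (use assms(1) in \<open>simp add: lin_set_def\<close>)

lemma lin_on_sum:
  fixes n :: nat
  assumes "lin_set S" "lin_on S L" "\<And>i. i < n \<Longrightarrow> e i \<in> S"
  shows "L (\<lambda>x. \<Sum>i<n. c i * e i x) = (\<Sum>i<n. c i * L (e i))"
  using assms(3)
proof (induction n)
  case 0
  have z: "(\<lambda>x. 0) \<in> S" using assms(1) by (simp add: lin_set_def)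
  show ?case using lin_onD[OF assms(2) z z, of 0 0] by simp
next
  case (Suc n)
  have "(\<lambda>x. \<Sum>i<n. c i * e i x) \<in> S" using Suc.prems by (intro lin_set_sum[OF assms(1)]) auto
  then show ?case using lin_onD[OF assms(2), of "\<lambda>x. \<Sum>i<n. c i * e i x" "e n" 1 "c n"] Suc by simp
qed

text \<open>Induction on the points: the functions of \<open>S\<close> vanishing at \<open>y\<close>
  are the kernel of an evaluation, and one function with nonzero value at \<open>y\<close> fixes the
  remaining coefficient.\<close>

lemma lin_on_point_values:
  assumes "finite X" "lin_set S" "lin_on S L" "\<And>f. f \<in> S \<Longrightarrow> (\<And>x. x \<in> X \<Longrightarrow> f x = 0) \<Longrightarrow> L f = 0"
  shows "\<exists>\<beta>. \<forall>f\<in>S. L f = (\<Sum>x\<in>X. \<beta> x * f x)"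
  using assms
proof (induction X arbitrary: S rule: finite_induct)
  case empty
  then show ?case by simp
next
  case (insert y X)
  define S' where "S' = {f \<in> S. f y = 0}"
  have "\<exists>\<beta>. \<forall>f\<in>S'. L f = (\<Sum>x\<in>X. \<beta> x * f x)"
  proof (rule insert.IH)
    show "lin_set S'" using insert.prems(1) unfolding S'_def lin_set_def by auto
    show "lin_on S' L" using insert.prems(2) unfolding S'_def lin_on_def by auto
  qed (use insert.prems(3) in \<open>auto simp: S'_def\<close>)
  then obtain \<beta> where \<beta>: "\<And>f. f \<in> S' \<Longrightarrow> L f = (\<Sum>x\<in>X. \<beta> x * f x)" by blast
  show ?case
  proof (cases "S' = S")
    case True
    then have "f y = 0" if "f \<in> S" for f using that by (auto simp: S'_def)
    then show ?thesis using \<beta> True insert.hyps by (intro exI[of _ \<beta>]) auto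
  next
    case False
    then obtain \<phi> where \<phi>: "\<phi> \<in> S" "\<phi> y \<noteq> 0" by (auto simp: S'_def)
    define \<gamma> where "\<gamma> = (L \<phi> - (\<Sum>x\<in>X. \<beta> x * \<phi> x)) / \<phi> y"
    have "L f = (\<Sum>x\<in>insert y X. (\<beta>(y := \<gamma>)) x * f x)" if f: "f \<in> S" for f
    proof -
      let ?a = "f y / \<phi> y"
      let ?f = "\<lambda>x. 1 * f x + (- ?a) * \<phi> x"
      have "?f \<in> S'" using lin_setD[OF insert.prems(1) f \<phi>(1), of 1 "- ?a"] \<phi>(2) by (simp add: S'_def)
      then have "L ?f = (\<Sum>x\<in>X. \<beta> x * ?f x)" by (rule \<beta>)
      also have "\<dots> = (\<Sum>x\<in>X. \<beta> x * f x) - ?a * (\<Sum>x\<in>X. \<beta> x * \<phi> x)"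
        by (simp add: sum_subtractf sum_distrib_left algebra_simps)
      finally have "L ?f = (\<Sum>x\<in>X. \<beta> x * f x) - ?a * (\<Sum>x\<in>X. \<beta> x * \<phi> x)" .
      moreover have "L ?f = L f - ?a * L \<phi>"
        using lin_onD[OF insert.prems(2) f \<phi>(1), of 1 "- ?a"] by simp
      ultimately have "L f = (\<Sum>x\<in>X. \<beta> x * f x) + \<gamma> * f y"
        by (simp add: \<gamma>_def diff_divide_distrib algebra_simps)
      moreover have "(\<Sum>x\<in>X. (\<beta>(y := \<gamma>)) x * f x) = (\<Sum>x\<in>X. \<beta> x * f x)"
        using insert.hyps(2) by (intro sum.cong) auto
      ultimately show ?thesis using insert.hyps by simp
    qed
    then show ?thesis by blast
  qed
qed

text \<open>Definiteness and the last clause refer to values on \<open>[0,1]\<close> only: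
  \<open>B\<close> is an inner product on the quotient by the functions vanishing there and must not
  distinguish representatives.\<close>

definition ip_on :: "(real \<Rightarrow> real) set \<Rightarrow> ((real \<Rightarrow> real) \<Rightarrow> (real \<Rightarrow> real) \<Rightarrow> real) \<Rightarrow> bool" where
  "ip_on S B \<longleftrightarrow> (\<forall>f\<in>S. lin_on S (\<lambda>g. B g f)) \<and> (\<forall>f\<in>S. \<forall>g\<in>S. B f g = B g f) \<and>
     (\<forall>f\<in>S. 0 \<le> B f f) \<and> (\<forall>f\<in>S. B f f = 0 \<longrightarrow> (\<forall>x\<in>{0..1}. f x = 0)) \<and>
     (\<forall>f\<in>S. \<forall>g\<in>S. (\<forall>x\<in>{0..1}. f x = 0) \<longrightarrow> B f g = 0)"

definition onb :: "(real \<Rightarrow> real) set \<Rightarrow> ((real \<Rightarrow> real) \<Rightarrow> (real \<Rightarrow> real) \<Rightarrow> real) \<Rightarrow> nat \<Rightarrow> (nat \<Rightarrow> real \<Rightarrow> real) \<Rightarrow> bool" where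
  "onb S B n e \<longleftrightarrow> (\<forall>i<n. e i \<in> S) \<and> (\<forall>i<n. \<forall>j<n. B (e i) (e j) = (if i = j then 1 else 0)) \<and>
     (\<forall>f\<in>S. \<forall>x\<in>{0..1}. f x = (\<Sum>i<n. B f (e i) * e i x))"

text \<open>Gram-Schmidt without a basis to start from: points are removed one at a time, the
  functions vanishing at \<open>y\<close> have an orthonormal basis by induction, and at most one
  further direction is missing.\<close>

lemma onb_exists:
  assumes "finite X" "X \<subseteq> {0..1}" "lin_set S" "ip_on S B"
    "\<And>f x. f \<in> S \<Longrightarrow> (\<And>y. y \<in> X \<Longrightarrow> f y = 0) \<Longrightarrow> x \<in> {0..1} \<Longrightarrow> f x = 0"
  shows "\<exists>n e. onb S B n e"
  using assms
proof (induction X arbitrary: S rule: finite_induct)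
  case empty
  then show ?case by (intro exI[of _ 0]) (auto simp: onb_def)
next
  case (insert y X)
  note lin = insert.prems(2) and ip = insert.prems(3)
  define S' where "S' = {f \<in> S. f y = 0}"
  have "\<exists>n e. onb S' B n e"
  proof (rule insert.IH)
    show "lin_set S'" using lin unfolding S'_def lin_set_def by auto
    show "ip_on S' B" using ip unfolding S'_def ip_on_def lin_on_def by auto
    show "f x = 0" if "f \<in> S'" "\<And>y. y \<in> X \<Longrightarrow> f y = 0" "x \<in> {0..1}" for f x
      by (rule insert.prems(4)) (use that in \<open>auto simp: S'_def\<close>)
  qed (use insert.prems in auto)
  then obtain n e where e: "onb S' B n e" by blast
  have eS: "e i \<in> S" "e i y = 0" if "i < n" for i using e that by (auto simp: onb_def S'_def)
  show ?case
  proof (cases "S' = S")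
    case True
    then show ?thesis using e by blast
  next
    case False
    then obtain \<phi> where \<phi>: "\<phi> \<in> S" "\<phi> y \<noteq> 0" by (auto simp: S'_def)
    have Blin: "lin_on S (\<lambda>g. B g f)" if "f \<in> S" for f using ip that by (simp add: ip_on_def)
    have Bsum: "B (\<lambda>x. \<Sum>i<n. c i * e i x) f = (\<Sum>i<n. c i * B (e i) f)" if "f \<in> S" for f c
      by (rule lin_on_sum[OF lin Blin[OF that] eS(1)])
    have sumS: "(\<lambda>x. \<Sum>i<n. c i * e i x) \<in> S" for c by (rule lin_set_sum[OF lin eS(1)])
    \<comment> \<open>The explicit factors \<open>1\<close> and \<open>-1\<close> make this an
      instance of the combinations in \<open>lin_setD\<close> and \<open>lin_onD\<close>; the same
      shape recurs below.\<close>
    define g where "g = (\<lambda>x. 1 * \<phi> x + (-1) * (\<Sum>i<n. B \<phi> (e i) * e i x))"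
    have gS: "g \<in> S" unfolding g_def by (rule lin_setD[OF lin \<phi>(1) sumS])
    have "g y = \<phi> y" using eS(2) by (simp add: g_def)
    then have "B g g \<noteq> 0" using ip gS \<phi>(2) insert.prems(1) unfolding ip_on_def by fastforce
    then have gg: "B g g > 0" using ip gS unfolding ip_on_def by (metis less_eq_real_def)
    have ge: "B g (e j) = 0" if j: "j < n" for j
    proof -
      have "B g (e j) = B \<phi> (e j) - (\<Sum>i<n. B \<phi> (e i) * B (e i) (e j))"
        unfolding g_def using lin_onD[OF Blin[OF eS(1)[OF j]] \<phi>(1) sumS[of "\<lambda>i. B \<phi> (e i)"], of 1 "-1"] Bsum[OF eS(1)[OF j]]
        by simp
      also have "(\<Sum>i<n. B \<phi> (e i) * B (e i) (e j)) = (\<Sum>i<n. if i = j then B \<phi> (e i) else 0)"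
        using e j unfolding onb_def by (intro sum.cong) auto
      finally show ?thesis using j by simp
    qed
    define s where "s = 1 / sqrt (B g g)"
    define k where "k = (\<lambda>x. s * g x + 0 * g x)"
    have kS: "k \<in> S" unfolding k_def by (rule lin_setD[OF lin gS gS])
    have Bk: "B k f = s * B g f" if "f \<in> S" for f
      unfolding k_def using lin_onD[OF Blin[OF that] gS gS, of s 0] by simp
    have sym: "B f f' = B f' f" if "f \<in> S" "f' \<in> S" for f f' using ip that by (simp add: ip_on_def)
    have kk: "B k k = 1" using Bk[OF kS] sym[OF gS kS] Bk[OF gS] gg by (simp add: s_def)
    have ke: "B k (e j) = 0" "B (e j) k = 0" if "j < n" for j
      using Bk[OF eS(1)[OF that]] ge[OF that] sym[OF kS eS(1)[OF that]] by auto
    have "onb S B (Suc n) (\<lambda>i. if i = n then k else e i)"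
      unfolding onb_def
    proof (intro conjI allI impI ballI)
      fix i j assume "i < Suc n" "j < Suc n"
      then show "B (if i = n then k else e i) (if j = n then k else e j) = (if i = j then 1 else 0)"
        using e kk ke unfolding onb_def by (auto simp: less_Suc_eq)
    next
      fix f x assume f: "f \<in> S" and x: "x \<in> {0..1::real}"
      define a where "a = f y / \<phi> y"
      define f' where "f' = (\<lambda>x. 1 * f x + (- a) * \<phi> x)"
      have f'S: "f' \<in> S" unfolding f'_def by (rule lin_setD[OF lin f \<phi>(1)])
      have f'S': "f' \<in> S'" using f'S \<phi>(2) by (simp add: S'_def f'_def a_def)
      have Bf': "B f' q = B f q - a * B \<phi> q" if "q \<in> S" for q
        unfolding f'_def using lin_onD[OF Blin[OF that] f \<phi>(1), of 1 "- a"] by simp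
      \<comment> \<open>On \<open>[0,1]\<close>, \<open>f'\<close> is its expansion in the old
        basis, to which \<open>k\<close> is orthogonal; the difference \<open>d\<close> vanishes
        there and is invisible to \<open>B\<close>.\<close>
      have f'k: "B f' k = 0"
      proof -
        define d where "d = (\<lambda>x. 1 * f' x + (-1) * (\<Sum>i<n. B f' (e i) * e i x))"
        have "d \<in> S" unfolding d_def by (rule lin_setD[OF lin f'S sumS])
        moreover have "\<forall>x\<in>{0..1}. d x = 0" using e f'S' unfolding onb_def d_def by auto
        ultimately have "B d k = 0" using ip kS unfolding ip_on_def by blast
        then show ?thesis unfolding d_def
          using lin_onD[OF Blin[OF kS] f'S sumS[of "\<lambda>i. B f' (e i)"], of 1 "-1"] Bsum[OF kS] ke by simp
      qed
      have \<phi>x: "\<phi> x = g x + (\<Sum>i<n. B \<phi> (e i) * e i x)" by (simp add: g_def)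
      have \<phi>k: "B \<phi> k = B g k"
        unfolding g_def using lin_onD[OF Blin[OF kS] \<phi>(1) sumS[of "\<lambda>i. B \<phi> (e i)"], of 1 "-1"] Bsum[OF kS] ke by simp
      have gk: "B g k * k x = g x"
        using sym[OF gS kS] Bk[OF gS] gg by (simp add: k_def s_def)
      have "f x = f' x + a * \<phi> x" by (simp add: f'_def)
      also have "f' x = (\<Sum>i<n. B f' (e i) * e i x)" using e f'S' x unfolding onb_def by blast
      also have "\<dots> = (\<Sum>i<n. B f (e i) * e i x - a * (B \<phi> (e i) * e i x))"
        by (intro sum.cong) (auto simp: Bf'[OF eS(1)] algebra_simps)
      also have "\<dots> = (\<Sum>i<n. B f (e i) * e i x) - a * (\<Sum>i<n. B \<phi> (e i) * e i x)"
        by (simp add: sum_subtractf sum_distrib_left)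
      finally have "f x = (\<Sum>i<n. B f (e i) * e i x) + a * g x" using \<phi>x by (simp add: algebra_simps)
      also have "a * g x = B f k * k x"
        using Bf'[OF kS] f'k \<phi>k gk by (simp add: mult.assoc)
      finally show "f x = (\<Sum>i<Suc n. B f (if i = n then k else e i) * (if i = n then k else e i) x)"
        by simp
    qed (use eS kS in auto)
    then show ?thesis by blast
  qed
qed

lemma onb_expand:
  assumes "lin_set S" "ip_on S B" "onb S B n e" "lin_on S L"
    and "\<And>f. f \<in> S \<Longrightarrow> (\<And>x. x \<in> {0..1} \<Longrightarrow> f x = 0) \<Longrightarrow> L f = 0" and f: "f \<in> S"
  shows "L f = (\<Sum>i<n. B f (e i) * L (e i))"
proof -
  have eS: "e i \<in> S" if "i < n" for i using assms(3) that by (simp add: onb_def)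
  have sS: "(\<lambda>x. \<Sum>i<n. B f (e i) * e i x) \<in> S" by (rule lin_set_sum[OF assms(1) eS])
  have "L (\<lambda>x. 1 * f x + (-1) * (\<Sum>i<n. B f (e i) * e i x)) = 0"
    using assms(3) f by (intro assms(5) lin_setD[OF assms(1) f sS]) (simp add: onb_def)
  then show ?thesis using lin_onD[OF assms(4) f sS, of 1 "-1"] lin_on_sum[OF assms(1,4) eS] by simp
qed

text \<open>Supplies the energy projection and the discrete elliptic solutions; the representer has
  the values \<open>L (e i)\<close> as coordinates.\<close>

lemma onb_Riesz:
  assumes "lin_set S" "ip_on S B" "onb S B n e" "lin_on S L"
    and "\<And>f. f \<in> S \<Longrightarrow> (\<And>x. x \<in> {0..1} \<Longrightarrow> f x = 0) \<Longrightarrow> L f = 0"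
  shows "\<exists>w\<in>S. \<forall>f\<in>S. B w f = L f"
proof (intro bexI ballI)
  have eS: "e i \<in> S" if "i < n" for i using assms(3) that by (simp add: onb_def)
  show "(\<lambda>x. \<Sum>i<n. L (e i) * e i x) \<in> S" by (rule lin_set_sum[OF assms(1) eS])
  fix f assume f: "f \<in> S"
  have "lin_on S (\<lambda>g. B g f)" using assms(2) f by (simp add: ip_on_def)
  then have "B (\<lambda>x. \<Sum>i<n. L (e i) * e i x) f = (\<Sum>i<n. L (e i) * B (e i) f)"
    by (rule lin_on_sum[OF assms(1)]) (rule eS)
  also have "\<dots> = (\<Sum>i<n. B f (e i) * L (e i))"
    using assms(2) eS f unfolding ip_on_def by (intro sum.cong) (auto simp: mult.commute)
  also have "\<dots> = L f" by (rule onb_expand[OF assms f, symmetric])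
  finally show "B (\<lambda>x. \<Sum>i<n. L (e i) * e i x) f = L f" .
qed

text \<open>\<open>f x\<close> is the pairing of \<open>f'\<close> with the indicator function of
  \<open>[0, x]\<close>, whose norm is at most 1. Later this acts as the Poincare inequality and
  gives definiteness of the energy product.\<close>

lemma pw_deriv_sup_le:
  assumes f: "pw_deriv f f'" and f0: "f 0 = 0" and x: "x \<in> {0..1}"
  shows "\<bar>f x\<bar> \<le> l2_norm f'"
proof -
  let ?i = "indicator {0..x} :: real \<Rightarrow> real"
  have b: "f' \<in> bdd_meas" using pw_deriv_bdd[OF f] by blast
  have I: "(f' has_integral f x - f 0) {0..x}" using pw_deriv_has_integral[OF f] x by auto
  have k: "(\<lambda>y. f' y * ?i y) \<in> bdd_meas" using b by auto
  have "((\<lambda>y. f' y * ?i y) has_integral f x - f 0) {0..1}"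
  proof (rule has_integral_on_superset[of _ _ "{0..x}"])
    show "((\<lambda>y. f' y * ?i y) has_integral f x - f 0) {0..x}"
      by (rule has_integral_eq[OF _ I]) auto
  qed (use x in auto)
  then have "f x = l2_inner f' ?i"
    using has_integral_unique[OF has_integral_UI[OF k]] f0 by (simp add: l2_inner_def)
  also have "\<bar>\<dots>\<bar> \<le> l2_norm f' * l2_norm ?i" using b by (intro l2_Cauchy_Schwarz) auto
  also have "\<dots> \<le> l2_norm f' * 1"
  proof (rule mult_left_mono)
    have "l2_norm ?i \<le> l2_norm (\<lambda>x. 1)" by (intro l2_norm_mono_AE) (auto simp: indicator_def)
    then show "l2_norm ?i \<le> 1" by (simp add: l2_norm_const)
  qed simp
  finally show ?thesis by simp
qed

section \<open>Inner products and functionals on the finite element space\<close>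

context fe_mesh
begin

lemma fe_lin: "lin_set S"
  unfolding lin_set_def using fe_zero fe_lincomb by blast

text \<open>Only almost everywhere: at \<open>0\<close> and \<open>1\<close> the two-sided
  \<open>deriv\<close> depends on the free values off \<open>[0,1]\<close>.\<close>

lemma fe_zero_AE:
  assumes "f \<in> S" "\<And>x. x \<in> {0..1} \<Longrightarrow> f x = 0"
  shows "AE x in UI. deriv f x = 0"
proof (rule pw_deriv_unique)
  show "pw_deriv f (\<lambda>x. 0)" by (rule pw_deriv_cong[OF pw_deriv_const[of 0]]) (use assms in auto)
qed (rule fe_pw[OF assms(1)])

lemma fe_diff [intro]: "f \<in> S \<Longrightarrow> g \<in> S \<Longrightarrow> (\<lambda>x. f x - g x) \<in> S"
  using fe_lincomb[of f g 1 "-1"] by simp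

lemma deriv_lincomb_AE:
  assumes "f \<in> S" "g \<in> S"
  shows "AE x in UI. deriv (\<lambda>x. a * f x + b * g x) x = a * deriv f x + b * deriv g x"
  by (rule pw_deriv_unique[OF fe_pw[OF fe_lincomb[OF assms]]])
    (intro pw_deriv_add pw_deriv_cmult fe_pw assms)

lemma deriv_diff_AE:
  assumes "f \<in> S" "g \<in> S"
  shows "AE x in UI. deriv (\<lambda>x. f x - g x) x = deriv f x - deriv g x"
  using deriv_lincomb_AE[OF assms, of 1 "-1"] by simp

lemma l2_norm_deriv_diff:
  assumes "f \<in> S" "g \<in> S"
  shows "l2_norm (deriv (\<lambda>x. f x - g x)) = l2_norm (\<lambda>x. deriv f x - deriv g x)"
  unfolding l2_norm_def using deriv_diff_AE[OF assms] assms fe_diff[OF assms]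
  by (subst l2_cong_AE) (auto intro!: bdd_meas_measurable)

lemma l2_lin: "k \<in> bdd_meas \<Longrightarrow> lin_on S (\<lambda>f. l2_inner f k)"
  unfolding lin_on_def by (simp add: l2_add_left bdd_meas_cmult)

lemma l2_deriv_lin:
  assumes k: "k \<in> bdd_meas" shows "lin_on S (\<lambda>f. l2_inner (deriv f) k)"
  unfolding lin_on_def
proof (intro ballI allI)
  fix f g a b assume S: "f \<in> S" "g \<in> S"
  have "l2_inner (deriv (\<lambda>x. a * f x + b * g x)) k = l2_inner (\<lambda>x. a * deriv f x + b * deriv g x) k"
    using deriv_lincomb_AE[OF S] S k fe_lincomb[OF S] by (intro l2_cong_AE) (auto intro!: bdd_meas_measurable)
  also have "\<dots> = a * l2_inner (deriv f) k + b * l2_inner (deriv g) k"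
    using S k by (simp add: l2_add_left)
  finally show "l2_inner (deriv (\<lambda>x. a * f x + b * g x)) k = a * l2_inner (deriv f) k + b * l2_inner (deriv g) k" .
qed

lemma l2_deriv_zero:
  assumes "f \<in> S" "\<And>x. x \<in> {0..1} \<Longrightarrow> f x = 0" "k \<in> bdd_meas"
  shows "l2_inner (deriv f) k = 0"
proof -
  have "l2_inner (deriv f) k = l2_inner (\<lambda>x. 0) k"
    using fe_zero_AE[OF assms(1,2)] assms by (intro l2_cong_AE) (auto intro!: bdd_meas_measurable)
  then show ?thesis by (simp add: l2_inner_def)
qed

lemma l2_zero:
  assumes "\<And>x. x \<in> {0..1} \<Longrightarrow> f x = 0" shows "l2_inner f k = 0"
  using l2_cong[of f "\<lambda>x. 0" k k] assms by (simp add: l2_inner_def)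

lemma ip_l2: "ip_on S l2_inner"
  unfolding ip_on_def
proof (intro conjI ballI impI)
  show "lin_on S (\<lambda>g. l2_inner g f)" if "f \<in> S" for f using that by (intro l2_lin) auto
  show "f x = 0" if "f \<in> S" "l2_inner f f = 0" "x \<in> {0..1}" for f x
    using l2_zero_cont[of f x] fe_spaceD(2) that by blast
  show "l2_inner f g = 0" if "\<forall>x\<in>{0..1}. f x = 0" for f g using that l2_zero by blast
qed (auto simp: l2_commute l2_self_nonneg)

lemma deriv_zero_imp:
  assumes f: "f \<in> S" and 0: "l2_inner (deriv f) (deriv f) = 0" and x: "x \<in> {0..1}"
  shows "f x = 0"
  using pw_deriv_sup_le[OF fe_pw[OF f] fe_spaceD(3)[OF f] x] 0 by (simp add: l2_norm_def)

lemma ip_deriv: "ip_on S (\<lambda>f g. l2_inner (deriv f) (deriv g))"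
  unfolding ip_on_def
proof (intro conjI ballI impI)
  show "lin_on S (\<lambda>g. l2_inner (deriv g) (deriv f))" if "f \<in> S" for f
    using that by (intro l2_deriv_lin) auto
  show "f x = 0" if "f \<in> S" "l2_inner (deriv f) (deriv f) = 0" "x \<in> {0..1}" for f x
    using deriv_zero_imp that by blast
  show "l2_inner (deriv f) (deriv g) = 0" if "f \<in> S" "g \<in> S" "\<forall>x\<in>{0..1}. f x = 0" for f g
    using that by (intro l2_deriv_zero) auto
qed (auto simp: l2_commute l2_self_nonneg)

lemma bilin_A_fe: "f \<in> S \<Longrightarrow> g \<in> S \<Longrightarrow> bilin_A f g = l2_inner f g + l2_inner (deriv f) (deriv g)"
  by (intro bilin_A_pw fe_pw)

lemma ip_A: "ip_on S bilin_A"
  unfolding ip_on_def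
proof (intro conjI ballI impI)
  show "lin_on S (\<lambda>g. bilin_A g f)" if f: "f \<in> S" for f
  proof -
    have "lin_on S (\<lambda>g. l2_inner g f)" "lin_on S (\<lambda>g. l2_inner (deriv g) (deriv f))"
      using f by (auto intro: l2_lin l2_deriv_lin)
    then show ?thesis unfolding lin_on_def
      by (auto simp: bilin_A_fe f fe_lincomb algebra_simps)
  qed
  show "bilin_A f g = bilin_A g f" if "f \<in> S" "g \<in> S" for f g
    using that by (simp add: bilin_A_fe l2_commute)
  show "0 \<le> bilin_A f f" if "f \<in> S" for f using that by (simp add: bilin_A_fe l2_self_nonneg)
  show "f x = 0" if "f \<in> S" "bilin_A f f = 0" "x \<in> {0..1}" for f x
    using that l2_self_nonneg[of f] l2_self_nonneg[of "deriv f"] l2_zero_cont[of f x] fe_spaceD(2)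
    by (auto simp: bilin_A_fe)
  show "bilin_A f g = 0" if "f \<in> S" "g \<in> S" "\<forall>x\<in>{0..1}. f x = 0" for f g
    using that l2_zero[of f g] l2_deriv_zero[of f "deriv g"] by (simp add: bilin_A_fe)
qed

lemma fe_onb:
  assumes "ip_on S B" shows "\<exists>n e. onb S B n e"
proof (rule fe_determining)
  fix X assume X: "finite X" "X \<subseteq> {0..1}"
    "\<And>\<phi> x. \<phi> \<in> S \<Longrightarrow> (\<And>y. y \<in> X \<Longrightarrow> \<phi> y = 0) \<Longrightarrow> x \<in> {0..1} \<Longrightarrow> \<phi> x = 0"
  show ?thesis by (rule onb_exists[OF X(1,2) fe_lin assms]) (rule X(3))
qed

lemma fe_Riesz:
  assumes "ip_on S B" "lin_on S L" "\<And>f. f \<in> S \<Longrightarrow> (\<And>x. x \<in> {0..1} \<Longrightarrow> f x = 0) \<Longrightarrow> L f = 0"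
  obtains w where "w \<in> S" "\<And>f. f \<in> S \<Longrightarrow> B w f = L f"
  using fe_onb[OF assms(1)] onb_Riesz[OF fe_lin assms(1) _ assms(2,3)] by metis

text \<open>Turns pointwise differentiability in time of a curve in \<open>S\<close> into
  differentiability of its coordinates.\<close>

lemma fe_functional:
  assumes "lin_on S L" "\<And>f. f \<in> S \<Longrightarrow> (\<And>x. x \<in> {0..1} \<Longrightarrow> f x = 0) \<Longrightarrow> L f = 0"
  obtains X \<beta> where "finite X" "X \<subseteq> {0..1}" "\<And>f. f \<in> S \<Longrightarrow> L f = (\<Sum>x\<in>X. \<beta> x * f x)"
proof -
  obtain X where X: "finite X" "X \<subseteq> {0..1}"
    "\<And>f x. f \<in> S \<Longrightarrow> (\<And>y. y \<in> X \<Longrightarrow> f y = 0) \<Longrightarrow> x \<in> {0..1} \<Longrightarrow> f x = 0"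
    using fe_determining by blast
  have "\<exists>\<beta>. \<forall>f\<in>S. L f = (\<Sum>x\<in>X. \<beta> x * f x)"
    by (rule lin_on_point_values[OF X(1) fe_lin assms(1)]) (use X(3) assms(2) in blast)
  then show thesis using that X by blast
qed

end

section \<open>Functions with a zero in every short window\<close>

text \<open>For \<open>x = 1\<close> this forces a zero at \<open>1\<close>. Windows extend to the
  right only, which is matched by primitives anchored at the right endpoint.\<close>

definition zero_windows :: "(real \<Rightarrow> real) \<Rightarrow> real \<Rightarrow> bool" where
  "zero_windows f l \<longleftrightarrow> (\<forall>x\<in>{0..1}. \<exists>\<xi>\<in>{0..1}. x \<le> \<xi> \<and> \<xi> \<le> x + l \<and> f \<xi> = 0)"

text \<open>Two zeros at distance at least \<open>l\<close> lie in \<open>[x, x + 3 * l]\<close>,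
  and Rolle gives a zero of \<open>f\<close> between them; when this window reaches
  \<open>1\<close>, the zero \<open>f 1 = 0\<close> is used instead.\<close>

lemma zero_windows_Rolle:
  assumes F: "zero_windows F l" and l: "0 < l" and c: "continuous_on {0..1} F"
    and d: "\<And>x. x \<in> {0<..<1} \<Longrightarrow> (F has_real_derivative f x) (at x)" and f1: "f 1 = 0"
  shows "zero_windows f (3 * l)"
  unfolding zero_windows_def
proof
  fix x :: real assume x: "x \<in> {0..1}"
  show "\<exists>\<xi>\<in>{0..1}. x \<le> \<xi> \<and> \<xi> \<le> x + 3 * l \<and> f \<xi> = 0"
  proof (cases "x + 3 * l \<ge> 1")
    case True
    then show ?thesis using x f1 by (intro bexI[of _ 1]) auto
  next
    case False
    obtain a where a: "x \<le> a" "a \<le> x + l" "F a = 0" using F x unfolding zero_windows_def by blast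
    have "a + l \<in> {0..1}" using a x l False by auto
    then obtain b where b: "a + l \<le> b" "b \<le> a + l + l" "F b = 0"
      using F unfolding zero_windows_def by blast
    have "\<exists>\<xi>>a. \<xi> < b \<and> DERIV F \<xi> :> 0"
    proof (rule Rolle)
      show "a < b" "F a = F b" using a b l by auto
      show "continuous_on {a..b} F" using a b x False l by (intro continuous_on_subset[OF c]) auto
      fix y assume "a < y" "y < b"
      then show "F differentiable (at y)" using d[of y] a b x False l
        by (auto simp: real_differentiable_def)
    qed
    then obtain \<xi> where \<xi>: "a < \<xi>" "\<xi> < b" "DERIV F \<xi> :> 0" by blast
    then have "f \<xi> = 0" using d[of \<xi>] a b x False l by (intro DERIV_unique[OF d \<xi>(3)]) auto
    then show ?thesis using \<xi> a b x False l by (intro bexI[of _ \<xi>]) auto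
  qed
qed

lemma integral_subinterval_UI:
  assumes "g \<in> bdd_meas" "{a..b} \<subseteq> {0..1}"
  shows "integral {a..b} g = (LINT x|UI. g x * indicator {a..b} x)"
proof -
  have k: "(\<lambda>y. g y * indicator {a..b} y) \<in> bdd_meas" using assms by auto
  have "(g has_integral integral {a..b} g) {a..b}"
    using bdd_meas_integrable_on[OF assms] by (rule integrable_integral)
  then have "((\<lambda>y. g y * indicator {a..b} y) has_integral integral {a..b} g) {a..b}"
    by (rule has_integral_eq[rotated]) auto
  then have "((\<lambda>y. g y * indicator {a..b} y) has_integral integral {a..b} g) {0..1}"
    by (rule has_integral_on_superset) (use assms in auto)
  then show ?thesis using has_integral_unique[OF has_integral_UI[OF k]] by simp
qed

lemma integral_Cauchy_Schwarz:
  assumes g: "g \<in> bdd_meas" and ab: "a \<le> b" "{a..b} \<subseteq> {0..1}"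
  shows "(integral {a..b} g)\<^sup>2 \<le> (b - a) * integral {a..b} (\<lambda>x. (g x)\<^sup>2)"
proof -
  let ?i = "indicator {a..b} :: real \<Rightarrow> real"
  have i: "?i x * ?i x = ?i x" for x by (simp add: indicator_def)
  have "integral {a..b} g = l2_inner (\<lambda>x. g x * ?i x) ?i"
    unfolding l2_inner_def integral_subinterval_UI[OF g ab(2)] by (simp add: mult.assoc i)
  then have "\<bar>integral {a..b} g\<bar> \<le> l2_norm (\<lambda>x. g x * ?i x) * l2_norm ?i"
    using g by (simp add: l2_Cauchy_Schwarz)
  then have "\<bar>integral {a..b} g\<bar>\<^sup>2 \<le> (l2_norm (\<lambda>x. g x * ?i x) * l2_norm ?i)\<^sup>2"
    by (rule power_mono) simp
  also have "\<dots> = (l2_norm (\<lambda>x. g x * ?i x))\<^sup>2 * (l2_norm ?i)\<^sup>2" by (simp add: power_mult_distrib)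
  also have "(l2_norm (\<lambda>x. g x * ?i x))\<^sup>2 = integral {a..b} (\<lambda>x. (g x)\<^sup>2)"
    unfolding l2_norm_sq l2_inner_def integral_subinterval_UI[OF bdd_meas_power2[OF g] ab(2)]
    by (intro Bochner_Integration.integral_cong) (auto simp: power2_eq_square indicator_def)
  also have "(l2_norm ?i)\<^sup>2 = b - a"
    using integral_subinterval_UI[of "\<lambda>x. 1" a b] ab
    unfolding l2_norm_sq l2_inner_def by (simp add: i)
  finally show ?thesis by (simp add: mult.commute)
qed

text \<open>Integration from a nearby zero bounds \<open>(G x)\<^sup>2\<close> by \<open>l\<close>
  times the integral of \<open>g\<^sup>2\<close> over the window, and integrating in
  \<open>x\<close> yields another \<open>l\<close>. Writing the inner integral as a difference of
  the primitive \<open>H\<close> replaces the double integral by a shift.\<close>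

lemma zero_windows_L2:
  assumes G: "pw_deriv G g" and zw: "zero_windows G l" and l: "0 < l"
  shows "l2_norm G \<le> l * l2_norm g"
proof -
  have gb: "g \<in> bdd_meas" "(\<lambda>x. (g x)\<^sup>2) \<in> bdd_meas" using pw_deriv_bdd[OF G] by auto
  have int: "(\<lambda>x. (g x)\<^sup>2) integrable_on {a..b}" if "{a..b} \<subseteq> {0..1}" for a b
    by (rule bdd_meas_integrable_on[OF gb(2) that])
  define H where "H x = integral {0..x} (\<lambda>y. (g y)\<^sup>2)" for x
  have Hc: "continuous_on {0..1} H" unfolding H_def
    by (intro indefinite_integral_continuous_1 int) auto
  have Hd: "H b - H a = integral {a..b} (\<lambda>y. (g y)\<^sup>2)" if "0 \<le> a" "a \<le> b" "b \<le> 1" for a b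
    using Henstock_Kurzweil_Integration.integral_combine[of 0 a b "\<lambda>y. (g y)\<^sup>2"] that int[of 0 b]
    unfolding H_def by auto
  have Hmono: "H a \<le> H b" if "0 \<le> a" "a \<le> b" "b \<le> 1" for a b
    using Hd[OF that] integral_nonneg[OF int[of a b]] that by auto
  have H0: "H 0 = 0" by (simp add: H_def)
  \<comment> \<open>Extends \<open>H\<close> by its final value, so that windows reaching beyond
    \<open>1\<close> need no separate treatment.\<close>
  define K where "K x = H (min 1 x)" for x
  have Kc: "continuous_on {0..1 + l} K" unfolding K_def
    by (intro continuous_on_compose2[OF Hc] continuous_intros) auto
  have Kint: "K integrable_on {a..b}" if "0 \<le> a" "b \<le> 1 + l" for a b
    using that by (intro integrable_continuous_interval continuous_on_subset[OF Kc]) auto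
  have K0: "0 \<le> K x" if "0 \<le> x" for x using Hmono[of 0 "min 1 x"] H0 that by (simp add: K_def)
  have pt: "(G x)\<^sup>2 \<le> l * (K (x + l) - K x)" if x: "x \<in> {0..1}" for x
  proof -
    obtain \<xi> where \<xi>: "\<xi> \<in> {0..1}" "x \<le> \<xi>" "\<xi> \<le> x + l" "G \<xi> = 0"
      using zw x unfolding zero_windows_def by blast
    have "integral {x..\<xi>} g = G \<xi> - G x"
      using \<xi> x by (intro integral_unique pw_deriv_has_integral[OF G]) auto
    then have "(G x)\<^sup>2 = (integral {x..\<xi>} g)\<^sup>2" using \<xi>(4) by simp
    also have "\<dots> \<le> (\<xi> - x) * integral {x..\<xi>} (\<lambda>y. (g y)\<^sup>2)"
      using \<xi> x by (intro integral_Cauchy_Schwarz[OF gb(1)]) auto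
    also have "\<dots> = (\<xi> - x) * (H \<xi> - H x)" using Hd[of x \<xi>] \<xi> x by simp
    also have "\<dots> \<le> l * (K (x + l) - H x)"
      using Hmono[of \<xi> "min 1 (x + l)"] Hmono[of x \<xi>] \<xi> x l by (intro mult_mono) (auto simp: K_def)
    also have "H x = K x" using x by (cases "x = 1") (auto simp: K_def min_def)
    finally show ?thesis .
  qed
  have shift: "integral {0..1} (\<lambda>x. K (x + l)) = integral {l..1 + l} K"
    using integral_shift[of 0 l 1 K] continuous_on_subset[OF Kc, of "{l..1 + l}"] l
    by (simp add: o_def add.commute)
  have "integral {0..l} K + integral {l..1 + l} K = integral {0..1 + l} K"
    using l Kint by (intro Henstock_Kurzweil_Integration.integral_combine) auto
  moreover have "integral {0..1} K + integral {1..1 + l} K = integral {0..1 + l} K"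
    using l Kint by (intro Henstock_Kurzweil_Integration.integral_combine) auto
  moreover have "integral {1..1 + l} K = integral {1..1 + l} (\<lambda>x. H 1)"
    by (intro integral_cong) (auto simp: K_def)
  moreover have "0 \<le> integral {0..l} K" using l by (intro integral_nonneg Kint K0) auto
  \<comment> \<open>The two splittings of \<open>[0, 1 + l]\<close> leave the integral of
    \<open>K\<close> over \<open>[1, 1 + l]\<close> minus that over \<open>[0, l]\<close>; the first
    is \<open>l * H 1\<close>, the second is nonnegative.\<close>
  ultimately have KK: "integral {l..1 + l} K - integral {0..1} K \<le> l * H 1" using l by simp
  have c1: "continuous_on {0..1} (\<lambda>x. K (x + l))"
    by (rule continuous_on_compose2[OF Kc]) (use l in \<open>auto intro!: continuous_intros\<close>)
  have c2: "continuous_on {0..1} K" by (rule continuous_on_subset[OF Kc]) (use l in auto)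
  have "(l2_norm G)\<^sup>2 = integral {0..1} (\<lambda>x. (G x)\<^sup>2)"
    using pw_deriv_bdd(1)[OF G] unfolding l2_norm_sq l2_inner_def
    by (simp add: integral_UI[symmetric] power2_eq_square)
  also have "\<dots> \<le> integral {0..1} (\<lambda>x. l * (K (x + l) - K x))"
  proof (rule integral_le)
    show "(\<lambda>x. (G x)\<^sup>2) integrable_on {0..1}"
      using pw_deriv_bdd(1)[OF G] by (intro bdd_meas_integrable_on) auto
    show "(\<lambda>x. l * (K (x + l) - K x)) integrable_on {0..1}"
      using c1 c2 by (intro integrable_continuous_interval continuous_intros)
  qed (use pt in auto)
  also have "\<dots> = l * (integral {l..1 + l} K - integral {0..1} K)"
    using c1 c2 shift by (simp add: Henstock_Kurzweil_Integration.integral_diff integrable_continuous_interval)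
  also have "\<dots> \<le> l * (l * H 1)" using KK l by (intro mult_left_mono) auto
  also have "H 1 = (l2_norm g)\<^sup>2"
    using gb unfolding H_def l2_norm_sq l2_inner_def by (simp add: integral_UI[symmetric] power2_eq_square)
  finally have "(l2_norm G)\<^sup>2 \<le> (l * l2_norm g)\<^sup>2" by (simp add: power2_eq_square algebra_simps)
  then show ?thesis by (rule power2_le_imp_le) (use l in simp)
qed

section \<open>Iterated primitives\<close>

text \<open>Integration runs up to \<open>1\<close> rather than from \<open>0\<close>, since
  truncated powers of \<open>x - a\<close> live on \<open>[a, 1]\<close>; the derivative is
  therefore \<open>- g\<close>.\<close>

definition prim :: "(real \<Rightarrow> real) \<Rightarrow> real \<Rightarrow> real" where
  "prim g x = integral {x..1} g"

lemma prim_1 [simp]: "prim g 1 = 0"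
  by (simp add: prim_def)

lemma prim_deriv:
  assumes "continuous_on {0..1} g" "x \<in> {0..1}"
  shows "(prim g has_real_derivative - g x) (at x within {0..1})"
proof -
  have "((\<lambda>u. integral {0..1} g - integral {0..u} g) has_vector_derivative 0 - g x) (at x within {0..1})"
    by (intro has_vector_derivative_diff has_vector_derivative_const
        integral_has_vector_derivative[OF assms])
  then have "(prim g has_vector_derivative 0 - g x) (at x within {0..1})"
  proof (rule has_vector_derivative_transform[OF assms(2), rotated])
    fix y :: real assume "y \<in> {0..1}"
    then show "prim g y = integral {0..1} g - integral {0..y} g"
      using Henstock_Kurzweil_Integration.integral_combine[of 0 y 1 g] integrable_continuous_interval[OF assms(1)]
      by (auto simp: prim_def)
  qed
  then show ?thesis by (simp add: has_real_derivative_iff_has_vector_derivative)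
qed

lemma prim_cont: "continuous_on {0..1} g \<Longrightarrow> continuous_on {0..1} (prim g)"
  by (rule DERIV_continuous_on) (rule prim_deriv)

lemma prim_DERIV:
  assumes "continuous_on {0..1} g" "x \<in> {0<..<1}"
  shows "(prim g has_real_derivative - g x) (at x)"
  using prim_deriv[OF assms(1), of x] assms(2) by (simp add: at_within_Icc_at)

lemma prim_pw_deriv: "continuous_on {0..1} g \<Longrightarrow> pw_deriv (prim g) (\<lambda>x. - g x)"
  unfolding pw_deriv_def using prim_cont prim_DERIV by (auto intro!: exI[of _ "{}"])

lemma prim_iter_cont: "continuous_on {0..1} g \<Longrightarrow> continuous_on {0..1} ((prim ^^ n) g)"
  by (induction n) (auto intro: prim_cont)

text \<open>Cauchy's formula for repeated integrals. Integration by parts raises \<open>j\<close>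
  and lowers \<open>p\<close>; the power kills the boundary term at \<open>a\<close>, the primitive
  the one at \<open>1\<close>.\<close>

lemma prim_iter_power:
  assumes g: "continuous_on {0..1} g" and a: "a \<in> {0..1}"
  shows "integral {a..1} (\<lambda>x. (prim ^^ j) g x * (x - a) ^ p) = fact p * (prim ^^ (j + p + 1)) g a"
proof (induction p arbitrary: j)
  case 0
  then show ?case by (simp add: prim_def)
next
  case (Suc p)
  let ?G = "(prim ^^ Suc j) g"
  have c: "continuous_on {0..1} ((prim ^^ j) g)" "continuous_on {0..1} ?G"
    using prim_iter_cont[OF g] by blast+
  have sub: "continuous_on {a..1} ((prim ^^ j) g)" "continuous_on {a..1} ?G"
    using c a by (auto elim!: continuous_on_subset)
  have "((\<lambda>x. ?G x * (real (Suc p) * (x - a) ^ p) - (prim ^^ j) g x * (x - a) ^ Suc p)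
      has_integral ?G 1 * (1 - a) ^ Suc p - ?G a * (a - a) ^ Suc p) {a..1}"
  proof (rule fundamental_theorem_of_calculus)
    fix x assume x: "x \<in> {a..1}"
    have "(?G has_real_derivative - (prim ^^ j) g x) (at x within {0..1})"
      using prim_deriv[OF c(1), of x] x a by simp
    then have "(?G has_real_derivative - (prim ^^ j) g x) (at x within {a..1})"
      by (rule DERIV_subset) (use a in auto)
    note d1 = this
    have d2: "((\<lambda>x. (x - a) ^ Suc p) has_real_derivative real (Suc p) * (x - a) ^ p) (at x within {a..1})"
      by (rule derivative_eq_intros refl | simp)+
    have "((\<lambda>x. ?G x * (x - a) ^ Suc p) has_real_derivative
        ?G x * (real (Suc p) * (x - a) ^ p) - (prim ^^ j) g x * (x - a) ^ Suc p) (at x within {a..1})"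
      by (rule DERIV_cong[OF DERIV_mult[OF d1 d2]]) (simp add: mult.commute)
    then show "((\<lambda>x. ?G x * (x - a) ^ Suc p) has_vector_derivative
        ?G x * (real (Suc p) * (x - a) ^ p) - (prim ^^ j) g x * (x - a) ^ Suc p) (at x within {a..1})"
      by (simp add: has_real_derivative_iff_has_vector_derivative)
  qed (use a in auto)
  then have "integral {a..1} (\<lambda>x. ?G x * (real (Suc p) * (x - a) ^ p) - (prim ^^ j) g x * (x - a) ^ Suc p) = 0"
    by (simp add: integral_unique)
  moreover have "integral {a..1} (\<lambda>x. ?G x * (real (Suc p) * (x - a) ^ p) - (prim ^^ j) g x * (x - a) ^ Suc p)
     = integral {a..1} (\<lambda>x. ?G x * (real (Suc p) * (x - a) ^ p)) - integral {a..1} (\<lambda>x. (prim ^^ j) g x * (x - a) ^ Suc p)"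
    by (intro Henstock_Kurzweil_Integration.integral_diff integrable_continuous_interval continuous_intros sub)
  moreover have "integral {a..1} (\<lambda>x. ?G x * (real (Suc p) * (x - a) ^ p)) = real (Suc p) * integral {a..1} (\<lambda>x. ?G x * (x - a) ^ p)"
    by (subst Henstock_Kurzweil_Integration.integral_mult_right[symmetric]) (simp only: ac_simps)
  ultimately have "integral {a..1} (\<lambda>x. (prim ^^ j) g x * (x - a) ^ Suc p) = real (Suc p) * integral {a..1} (\<lambda>x. ?G x * (x - a) ^ p)"
    by simp
  also have "\<dots> = real (Suc p) * (fact p * (prim ^^ (Suc j + p + 1)) g a)" by (simp only: Suc.IH)
  finally show ?case by simp
qed

lemma pw_deriv_power_integral:
  assumes e: "pw_deriv e e'" "e 1 = 0" and a: "a \<in> {0..1}"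
  shows "integral {a..1} (\<lambda>x. e' x * (x - a) ^ p) = - fact p * (prim ^^ p) e a"
proof -
  have ec: "continuous_on {0..1} e" using pw_deriv_cont[OF e(1)] .
  have P: "pw_deriv (\<lambda>x. (x - a) ^ p) (\<lambda>x. real p * (x - a) ^ (p - 1))"
    unfolding pw_deriv_def
    by (intro conjI exI[of _ "{}"] bdd_meas_cont continuous_intros ballI)
      (auto intro!: derivative_eq_intros)
  let ?d = "\<lambda>x. e x * (real p * (x - a) ^ (p - 1)) + e' x * (x - a) ^ p"
  have I: "(?d has_integral e 1 * (1 - a) ^ p - e a * (a - a) ^ p) {a..1}"
    using pw_deriv_has_integral[OF pw_deriv_mult[OF e(1) P], of a 1] a by auto
  have b: "(\<lambda>x. e x * (real p * (x - a) ^ (p - 1))) \<in> bdd_meas" "(\<lambda>x. e' x * (x - a) ^ p) \<in> bdd_meas"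
    using pw_deriv_bdd[OF e(1)] pw_deriv_bdd[OF P] by auto
  have "integral {a..1} ?d = integral {a..1} (\<lambda>x. e x * (real p * (x - a) ^ (p - 1))) + integral {a..1} (\<lambda>x. e' x * (x - a) ^ p)"
    using b a by (intro Henstock_Kurzweil_Integration.integral_add bdd_meas_integrable_on) auto
  \<comment> \<open>For \<open>p = 0\<close> the factor \<open>0 ^ p\<close> is \<open>1\<close> and
    the integral on the right drops out; for \<open>p > 0\<close> the boundary term disappears and
    the integral remains.\<close>
  then have *: "integral {a..1} (\<lambda>x. e' x * (x - a) ^ p)
      = - e a * 0 ^ p - integral {a..1} (\<lambda>x. e x * (real p * (x - a) ^ (p - 1)))"
    using integral_unique[OF I] e(2) by simp
  show ?thesis
  proof (cases p)
    case 0
    then show ?thesis using * by simp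
  next
    case (Suc q)
    have "integral {a..1} (\<lambda>x. e x * (real p * (x - a) ^ (p - 1))) = real p * integral {a..1} (\<lambda>x. (prim ^^ 0) e x * (x - a) ^ q)"
      unfolding Suc by (subst Henstock_Kurzweil_Integration.integral_mult_right[symmetric]) (simp add: ac_simps)
    also have "\<dots> = real p * (fact q * (prim ^^ p) e a)"
      by (subst prim_iter_power[OF ec a]) (simp add: Suc)
    finally show ?thesis using * Suc by simp
  qed
qed

section \<open>Approximation in the energy norm\<close>

lemma poly_Ck: "poly p \<in> Ck k"
proof (rule CkI(1)[of "\<lambda>j. poly ((pderiv ^^ j) p)"])
  show "(poly ((pderiv ^^ j) p) has_vector_derivative poly ((pderiv ^^ Suc j) p) x) (at x within {0..1})" for j x
    using has_field_derivative_at_within[OF poly_DERIV[of "(pderiv ^^ j) p" x]]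
    by (simp add: has_real_derivative_iff_has_vector_derivative)
qed (auto intro!: continuous_intros)

lemma truncated_power_Ck:
  fixes a :: real
  assumes "1 \<le> q" shows "(\<lambda>x. (max 0 (x - a)) ^ q) \<in> Ck (q - 1)"
proof (rule CkI(1)[of "\<lambda>j x. fact q / fact (q - j) * (max 0 (x - a)) ^ (q - j)"])
  fix j x assume j: "j < q - 1"
  define n where "n = q - j - 2"
  have q: "q - j = Suc (Suc n)" "q - Suc j = Suc n" using j by (auto simp: n_def)
  have "((\<lambda>x. (max 0 (x - a)) ^ Suc (Suc n)) has_real_derivative real (Suc (Suc n)) * (max 0 (x - a)) ^ Suc n) (at x)"
    by (rule DERIV_cong[OF DERIV_chain2[OF max_power_deriv]]) (rule derivative_eq_intros refl | simp)+
  from DERIV_cmult[OF this, of "fact q / fact (Suc (Suc n))"]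
  have "((\<lambda>x. fact q / fact (Suc (Suc n)) * (max 0 (x - a)) ^ Suc (Suc n)) has_real_derivative
      fact q / fact (Suc n) * (max 0 (x - a)) ^ Suc n) (at x)"
    by (rule DERIV_cong) (simp add: fact_Suc[of "Suc n"] del: fact_Suc)
  then show "((\<lambda>x. fact q / fact (q - j) * (max 0 (x - a)) ^ (q - j)) has_vector_derivative
      fact q / fact (q - Suc j) * (max 0 (x - a)) ^ (q - Suc j)) (at x within {0..1})"
    unfolding q by (simp only: has_field_derivative_at_within flip: has_real_derivative_iff_has_vector_derivative)
qed (auto intro!: continuous_intros)

lemma truncated_power_pw_deriv:
  fixes a :: real
  assumes "1 \<le> q"
  shows "pw_deriv (\<lambda>x. (max 0 (x - a)) ^ q) (\<lambda>x. indicator {a..1} x * (real q * (x - a) ^ (q - 1)))"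
  unfolding pw_deriv_def
proof (intro conjI exI[of _ "{a}"] ballI)
  fix x assume x: "x \<in> {0<..<1} - {a}"
  show "((\<lambda>x. (max 0 (x - a)) ^ q) has_real_derivative indicator {a..1} x * (real q * (x - a) ^ (q - 1))) (at x)"
  proof (cases "x < a")
    case True
    have "\<forall>\<^sub>F y in nhds x. (max 0 (y - a)) ^ q = 0"
      using eventually_nhds_in_open[of "{..<a}" x] True assms by (auto elim!: eventually_mono)
    then show ?thesis using True by (subst DERIV_cong_ev[OF refl _ refl, of _ "\<lambda>y. 0"]) auto
  next
    case False
    have "\<forall>\<^sub>F y in nhds x. (max 0 (y - a)) ^ q = (y - a) ^ q"
      using eventually_nhds_in_open[of "{a<..}" x] False x by (auto elim!: eventually_mono)
    moreover have "((\<lambda>y. (y - a) ^ q) has_real_derivative real q * (x - a) ^ (q - 1)) (at x)"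
      by (auto intro!: derivative_eq_intros)
    ultimately show ?thesis using False x
      by (subst DERIV_cong_ev[OF refl _ refl, of _ "\<lambda>y. (y - a) ^ q"]) auto
  qed
next
  show "(\<lambda>x. indicator {a..1} x * (real q * (x - a) ^ (q - 1))) \<in> bdd_meas"
    by (intro bdd_meas_mult bdd_meas_indicator bdd_meas_cont continuous_intros) auto
qed (auto intro!: continuous_intros)

text \<open>The linear term makes \<open>\<phi>\<close> vanish at \<open>1\<close>, as membership in
  the spline space requires, and drops out of the pairing because \<open>e'\<close> has mean zero.
  What is left is \<open>e'\<close> against a truncated power, that is, an iterated primitive of
  \<open>e\<close> at \<open>a\<close>.\<close>

lemma orthogonal_truncated_power:
  assumes e: "pw_deriv e e'" "e 0 = 0" "e 1 = 0" and a: "a \<in> {0..1}" and q: "1 \<le> q"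
    and \<phi>: "pw_deriv \<phi> \<phi>'" "\<And>x. x \<in> {0..1} \<Longrightarrow> \<phi> x = (max 0 (x - a)) ^ q - (1 - a) ^ q * x"
    and orth: "l2_inner e' \<phi>' = 0"
  shows "(prim ^^ (q - 1)) e a = 0"
proof -
  let ?k = "\<lambda>x. indicator {a..1} x * (real q * (x - a) ^ (q - 1))"
  let ?g = "\<lambda>x. ?k x - (1 - a) ^ q * 1"
  have x: "pw_deriv (\<lambda>x. x) (\<lambda>x. 1)"
    unfolding pw_deriv_def by (auto intro!: exI[of _ "{}"] continuous_intros)
  have "pw_deriv (\<lambda>x. (max 0 (x - a)) ^ q - (1 - a) ^ q * x) ?g"
    by (intro pw_deriv_diff truncated_power_pw_deriv[OF q] pw_deriv_cmult x)
  then have g: "pw_deriv \<phi> ?g" by (rule pw_deriv_cong) (use \<phi>(2) in auto)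
  have eb: "e' \<in> bdd_meas" using pw_deriv_bdd[OF e(1)] by blast
  have kb: "?k \<in> bdd_meas" using pw_deriv_bdd[OF truncated_power_pw_deriv[OF q]] by blast
  have "0 = l2_inner e' ?g"
    unfolding orth[symmetric] using pw_deriv_unique[OF \<phi>(1) g] eb pw_deriv_bdd(2)[OF \<phi>(1)] pw_deriv_bdd(2)[OF g]
    by (intro l2_cong_AE) (auto intro: bdd_meas_measurable)
  also have "\<dots> = l2_inner e' ?k - (1 - a) ^ q * l2_inner e' (\<lambda>x. 1)"
    unfolding l2_cmult_right[symmetric] using eb kb by (intro l2_diff_right) auto
  also have "l2_inner e' (\<lambda>x. 1) = 0" using pw_deriv_integral[OF e(1)] e by (simp add: l2_inner_def)
  also have "l2_inner e' ?k = integral {a..1} (\<lambda>x. e' x * (real q * (x - a) ^ (q - 1)))"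
    unfolding l2_inner_def
  proof (subst integral_subinterval_UI)
    show "(\<lambda>x. e' x * (real q * (x - a) ^ (q - 1))) \<in> bdd_meas"
      by (intro bdd_meas_mult[OF eb] bdd_meas_cont continuous_intros)
  qed (use a in \<open>auto simp: ac_simps\<close>)
  also have "\<dots> = real q * integral {a..1} (\<lambda>x. e' x * (x - a) ^ (q - 1))"
    by (subst Henstock_Kurzweil_Integration.integral_mult_right[symmetric]) (simp add: ac_simps)
  also have "integral {a..1} (\<lambda>x. e' x * (x - a) ^ (q - 1)) = - fact (q - 1) * (prim ^^ (q - 1)) e a"
    by (rule pw_deriv_power_integral[OF e(1,3) a])
  finally show ?thesis using q by simp
qed

context fe_mesh
begin

text \<open>A truncated power of degree \<open>r - 1\<close> has \<open>r - 2\<close> continuous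
  derivatives, which covers every admissible \<open>\<mu>\<close>; hence one argument serves all
  smoothness classes.\<close>

lemma truncated_power_fe:
  assumes k: "k \<in> {1..N + 1}"
  shows "(\<lambda>x. (max 0 (x - z k)) ^ (r - 1) - (1 - z k) ^ (r - 1) * x) \<in> S" (is "?\<phi> \<in> S")
proof (rule fe_spaceI)
  have "(\<lambda>x. (max 0 (x - z k)) ^ (r - 1)) \<in> Ck \<mu>"
    by (rule Ck_mono[OF truncated_power_Ck]) (use r mu in linarith)+
  from Ck_lincomb[OF this poly_Ck[of "[:0, (1 - z k) ^ (r - 1):]"], of 1 "-1"]
  show "?\<phi> \<in> Ck \<mu>" by (simp add: mult.commute)
  have zk: "0 \<le> z k" "z k \<le> 1" using z_range[OF k] by auto
  then show "?\<phi> 0 = 0" "?\<phi> 1 = 0" using r by auto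
  fix i assume i: "i \<in> {1..N}"
  let ?l = "smult ((1 - z k) ^ (r - 1)) [:0, 1:] :: real poly"
  have dl: "degree ?l \<le> r - 1" using r by (intro order_trans[OF degree_smult_le]) auto
  show "\<exists>p::real poly. degree p \<le> r - 1 \<and> (\<forall>x\<in>{z i..z (i + 1)}. ?\<phi> x = poly p x)"
  proof (cases "k \<le> i")
    case True
    then have "z k \<le> z i" using z_mono[of k i] i k by auto
    moreover have "degree ([:- z k, 1:] ^ (r - 1)) \<le> r - 1"
      using degree_power_le[of "[:- z k, 1:]" "r - 1"] by simp
    ultimately show ?thesis using dl
      by (intro exI[of _ "[:- z k, 1:] ^ (r - 1) - ?l"]) (auto intro!: degree_diff_le simp: poly_power max_absorb2)
  next
    case False
    then have "z (i + 1) \<le> z k" using z_mono[of "i + 1" k] i k by auto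
    then show ?thesis using dl r
      by (intro exI[of _ "- ?l"]) (auto simp: max_absorb1)
  qed
qed

lemma poly_fe:
  assumes "degree p \<le> r - 1" "poly p 0 = 0" "poly p 1 = 0" shows "poly p \<in> S"
  by (rule fe_spaceI) (use assms poly_Ck in auto)

lemma fe_energy_projection:
  assumes v: "v \<in> Ck r" "v 0 = 0" "v 1 = 0" and M: "\<And>x. x \<in> {0..1} \<Longrightarrow> \<bar>(dx ^^ r) v x\<bar> \<le> M"
  obtains w where "w \<in> S" "l2_norm (\<lambda>x. dx v x - deriv w x) \<le> M * (3 ^ r * h) ^ (r - 1)"
    "l2_norm (\<lambda>x. v x - w x) \<le> M * (3 ^ r * h) ^ r"
proof -
  have v1: "pw_deriv v (dx v)" using Ck_pw_deriv[OF v(1), of 0] r by simp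
  have v2: "pw_deriv (dx v) (dx (dx v))" using Ck_pw_deriv[OF v(1), of 1] r by simp
  note vb = pw_deriv_bdd[OF v1] pw_deriv_bdd[OF v2]
  obtain w where w: "w \<in> S" "\<And>\<phi>. \<phi> \<in> S \<Longrightarrow> l2_inner (deriv w) (deriv \<phi>) = l2_inner (deriv \<phi>) (dx v)"
    using fe_Riesz[OF ip_deriv l2_deriv_lin[OF vb(2)] l2_deriv_zero[OF _ _ vb(2)]] by blast
  define e where "e x = v x - w x" for x
  define e' where "e' x = dx v x - deriv w x" for x
  have e: "pw_deriv e e'" unfolding e_def e'_def by (intro pw_deriv_diff v1 fe_pw w)
  have e0: "e 0 = 0" "e 1 = 0" using v fe_spaceD[OF w(1)] by (auto simp: e_def)
  have ec: "continuous_on {0..1} e" using pw_deriv_cont[OF e] .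
  have eb: "e \<in> bdd_meas" "e' \<in> bdd_meas" using pw_deriv_bdd[OF e] by auto
  have orth: "l2_inner e' (deriv \<phi>) = 0" if "\<phi> \<in> S" for \<phi>
    unfolding e'_def using that w(1) vb
    by (simp add: l2_diff_left w(2) l2_commute[of "dx v"])
  have P1: "(prim ^^ j) e 1 = 0" for j by (cases j) (use e0 in auto)
  \<comment> \<open>For \<open>a = 0\<close> the truncated power is a global one, and
    \<open>x ^ Suc j - x\<close> is a polynomial in \<open>S\<close>.\<close>
  have P0: "(prim ^^ j) e 0 = 0" if j: "j \<le> r - 2" for j
  proof -
    let ?p = "monom 1 (Suc j) - [:0, 1:] :: real poly"
    have "degree ?p \<le> r - 1" using j r by (intro degree_diff_le) (auto intro: order_trans[OF degree_monom_le])
    then have "poly ?p \<in> S" by (intro poly_fe) (auto simp: poly_monom)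
    then have "(prim ^^ (Suc j - 1)) e 0 = 0"
      by (intro orthogonal_truncated_power[OF e e0 _ _ fe_pw _ orth, of _ _ "poly ?p"])
        (auto simp: poly_monom max_absorb2)
    then show ?thesis by simp
  qed
  \<comment> \<open>For \<open>r = 2\<close> this is the classical fact that the energy projection
    onto piecewise linear functions interpolates at the nodes.\<close>
  have Pz: "(prim ^^ (r - 2)) e (z k) = 0" if k: "k \<in> {1..N + 1}" for k
  proof -
    have "(prim ^^ (r - 1 - 1)) e (z k) = 0"
      using r by (intro orthogonal_truncated_power[OF e e0 z_range[OF k] _ fe_pw[OF truncated_power_fe[OF k]]
            _ orth[OF truncated_power_fe[OF k]]]) auto
    then show ?thesis using r by (simp add: numeral_2_eq_2)
  qed
  \<comment> \<open>Descends from the primitive of order \<open>r - 2\<close>, which vanishes at the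
    nodes, to \<open>e\<close>; each Rolle step triples the window.\<close>
  have zw: "zero_windows ((prim ^^ (r - 2 - j)) e) (3 ^ j * h)" if "j \<le> r - 2" for j
    using that
  proof (induction j)
    case 0
    show ?case unfolding zero_windows_def
    proof
      fix x :: real assume "x \<in> {0..1}"
      then obtain i where i: "i \<in> {1..N}" "x \<in> {z i..z (i + 1)}" using cell_ex by blast
      then show "\<exists>\<xi>\<in>{0..1}. x \<le> \<xi> \<and> \<xi> \<le> x + 3 ^ 0 * h \<and> (prim ^^ (r - 2 - 0)) e \<xi> = 0"
        using Pz[of "i + 1"] z_range[of "i + 1"] len_le[of i] by (intro bexI[of _ "z (i + 1)"]) auto
    qed
  next
    case (Suc j)
    define n where "n = r - 2 - Suc j"
    have n: "r - 2 - j = Suc n" using Suc.prems by (simp add: n_def)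
    have c: "continuous_on {0..1} ((prim ^^ n) e)" by (rule prim_iter_cont[OF ec])
    have "zero_windows (\<lambda>x. - (prim ^^ n) e x) (3 * (3 ^ j * h))"
    proof (rule zero_windows_Rolle)
      show "zero_windows ((prim ^^ Suc n) e) (3 ^ j * h)" using Suc n by auto
      show "0 < 3 ^ j * h" using h_pos by simp
      show "continuous_on {0..1} ((prim ^^ Suc n) e)" by (rule prim_iter_cont[OF ec])
      show "((prim ^^ Suc n) e has_real_derivative - (prim ^^ n) e x) (at x)" if "x \<in> {0<..<1}" for x
        using prim_DERIV[OF c that] by simp
    qed (use P1 in simp)
    then show ?case unfolding n_def[symmetric] zero_windows_def by (simp add: mult.assoc)
  qed
  \<comment> \<open>One window length that is large enough for all levels at once.\<close>
  define l where "l = 3 ^ r * h"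
  have l: "l > 0" using h_pos by (simp add: l_def)
  have zl: "zero_windows ((prim ^^ j) e) l" if j: "j \<le> r - 2" for j
  proof -
    have "r - 2 - (r - 2 - j) = j" using j by (rule diff_diff_cancel)
    from zw[of "r - 2 - j", unfolded this] have "zero_windows ((prim ^^ j) e) (3 ^ (r - 2 - j) * h)" by simp
    moreover have "3 ^ (r - 2 - j) * h \<le> l" unfolding l_def using h_pos
      by (intro mult_right_mono power_increasing) auto
    ultimately show ?thesis unfolding zero_windows_def by fastforce
  qed
  have e_le: "l2_norm e \<le> l * l2_norm e'"
    using zero_windows_L2[OF e _ l] zl[of 0] by simp
  have P_le: "l2_norm ((prim ^^ j) e) \<le> l ^ j * l2_norm e" if "j \<le> r - 2" for j
    using that
  proof (induction j)
    case (Suc j)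
    have "l2_norm ((prim ^^ Suc j) e) \<le> l * l2_norm (\<lambda>x. - (prim ^^ j) e x)"
      using zero_windows_L2[OF _ zl[OF Suc.prems] l] prim_pw_deriv[OF prim_iter_cont[OF ec, of j]] by simp
    also have "l2_norm (\<lambda>x. - (prim ^^ j) e x) = l2_norm ((prim ^^ j) e)"
      using l2_norm_cmult[of "-1" "(prim ^^ j) e"] by simp
    also have "l * \<dots> \<le> l * (l ^ j * l2_norm e)" using Suc l by (intro mult_left_mono) auto
    finally show ?case by simp
  qed simp
  \<comment> \<open>Moves up to \<open>r - 2\<close> derivatives onto \<open>v\<close>; no boundary
    terms arise since the primitives vanish at both endpoints.\<close>
  have parts: "l2_inner e (dx (dx v)) = l2_inner ((prim ^^ j) e) ((dx ^^ (2 + j)) v)" if "j \<le> r - 2" for j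
    using that
  proof (induction j)
    case 0
    then show ?case by (simp add: numeral_2_eq_2)
  next
    case (Suc j)
    have "l2_inner ((prim ^^ Suc j) e) ((dx ^^ Suc (2 + j)) v) = - l2_inner (\<lambda>x. - (prim ^^ j) e x) ((dx ^^ (2 + j)) v)"
    proof (rule pw_deriv_parts)
      show "pw_deriv ((prim ^^ Suc j) e) (\<lambda>x. - (prim ^^ j) e x)"
        using prim_pw_deriv[OF prim_iter_cont[OF ec, of j]] by simp
      show "pw_deriv ((dx ^^ (2 + j)) v) ((dx ^^ Suc (2 + j)) v)"
        using Suc.prems r by (intro Ck_pw_deriv[OF v(1)]) auto
    qed (use P0[OF Suc.prems] P1 in simp)
    then show ?case using Suc by simp
  qed
  have vr: "(dx ^^ r) v \<in> bdd_meas" by (intro bdd_meas_cont Ck_cont[OF v(1)]) auto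
  have M0: "M \<ge> 0" using M[of 0] by simp
  have "l2_norm e' * l2_norm e' = l2_inner e' e'" by (simp add: l2_norm_sq[symmetric] power2_eq_square)
  also have "\<dots> = l2_inner e' (dx v) - l2_inner e' (deriv w)"
    using eb vb w(1) by (subst (2) e'_def[abs_def]) (simp add: l2_diff_right)
  also have "\<dots> = l2_inner e' (dx v)" using orth[OF w(1)] by simp
  also have "\<dots> = - l2_inner e (dx (dx v))"
    using pw_deriv_parts[OF e v2] e0 by simp
  also have "\<dots> = - l2_inner ((prim ^^ (r - 2)) e) ((dx ^^ r) v)"
    using parts[of "r - 2", unfolded le_add_diff_inverse[OF r]] by simp
  also have "\<dots> \<le> l2_norm ((prim ^^ (r - 2)) e) * l2_norm ((dx ^^ r) v)"
    using l2_Cauchy_Schwarz[of "(prim ^^ (r - 2)) e" "(dx ^^ r) v"] vr bdd_meas_cont[OF prim_iter_cont[OF ec]]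
    by fastforce
  also have "\<dots> \<le> (l ^ (r - 1) * l2_norm e') * M"
  proof (rule mult_mono)
    have "l2_norm ((prim ^^ (r - 2)) e) \<le> l ^ (r - 2) * l2_norm e" by (rule P_le) simp
    also have "\<dots> \<le> l ^ (r - 2) * (l * l2_norm e')" using e_le l by (intro mult_left_mono) auto
    also have "\<dots> = l ^ Suc (r - 2) * l2_norm e'" by simp
    also have "Suc (r - 2) = r - 1" using r by simp
    finally show "l2_norm ((prim ^^ (r - 2)) e) \<le> l ^ (r - 1) * l2_norm e'" .
    have "AE x in UI. \<bar>(dx ^^ r) v x\<bar> \<le> \<bar>M\<bar>" using M M0 by (intro AE_I2) auto
    then show "l2_norm ((dx ^^ r) v) \<le> M"
      using l2_norm_mono_AE[of "(dx ^^ r) v" "\<lambda>x. M"] vr M0 by (simp add: l2_norm_const)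
  qed (use l in auto)
  finally have "l2_norm e' * l2_norm e' \<le> (M * l ^ (r - 1)) * l2_norm e'"
    by (simp only: ac_simps)
  then have e': "l2_norm e' \<le> M * l ^ (r - 1)"
  proof (cases "l2_norm e' = 0")
    case False
    then have "l2_norm e' > 0" by (simp add: less_le)
    then show ?thesis using \<open>l2_norm e' * l2_norm e' \<le> _\<close> by simp
  qed (use M0 l in simp)
  have "l2_norm e \<le> l * (M * l ^ (r - 1))"
    by (rule order_trans[OF e_le mult_left_mono[OF e']]) (use l in simp)
  also have "\<dots> = M * l ^ r" using r by (cases r) auto
  finally show thesis using that[OF w(1)] e' unfolding e_def e'_def l_def by blast
qed

end

section \<open>Ordinary differential equations\<close>

instance bcontfun :: (metric_space, banach) banach ..

text \<open>The Picard operator is written for \<open>exp (- l t) y t\<close> with \<open>l > L\<close>, which makes it a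
  contraction on the whole interval; time is clamped to \<open>[0,T]\<close> so that it acts on bounded functions on \<open>UNIV\<close>.\<close>

lemma Lipschitz_ode_exists:
  fixes F :: "'b::banach \<Rightarrow> 'b"
  assumes L: "0 \<le> L" "\<And>x y. norm (F x - F y) \<le> L * norm (x - y)" and T: "0 < T"
  obtains y where "y 0 = y0" "\<And>t. t \<in> {0..T} \<Longrightarrow> (y has_vector_derivative F (y t)) (at t within {0..T})"
proof -
  \<comment> \<open>Then \<open>L / l \<le> 1 / 2\<close>, the contraction factor, and
    \<open>l > 0\<close> even when \<open>L = 0\<close>.\<close>
  define l where "l = 2 * L + 1"
  have l: "l > 0" using L(1) by (simp add: l_def)
  have Fc: "continuous_on UNIV F"
    by (rule lipschitz_on_continuous_on[of L]) (use L in \<open>auto simp: lipschitz_on_def dist_norm\<close>)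
  define c where "c = (\<lambda>t::real. max 0 (min T t))"
  have c: "c t \<in> {0..T}" for t using T by (auto simp: c_def)
  have cc: "continuous_on UNIV c" unfolding c_def by (intro continuous_intros)
  have cid: "c t = t" if "t \<in> {0..T}" for t using that by (auto simp: c_def)
  define I where "I d t = integral {0..t} (\<lambda>s. F (exp (l * s) *\<^sub>R apply_bcontfun d s))"
    for d :: "real \<Rightarrow>\<^sub>C 'b" and t
  have ic: "continuous_on A (\<lambda>s. F (exp (l * s) *\<^sub>R apply_bcontfun d s))" for d :: "real \<Rightarrow>\<^sub>C 'b" and A
    by (rule continuous_on_compose2[OF Fc]) (intro continuous_intros continuous_on_apply_bcontfun, simp)
  have ii: "(\<lambda>s. F (exp (l * s) *\<^sub>R apply_bcontfun d s)) integrable_on {a..b}" for d :: "real \<Rightarrow>\<^sub>C 'b" and a b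
    by (rule integrable_continuous_interval[OF ic])
  have Ic: "continuous_on {0..T} (I d)" for d :: "real \<Rightarrow>\<^sub>C 'b" unfolding I_def
    by (rule indefinite_integral_continuous_1[OF ii])
  define \<Phi> where "\<Phi> d = Bcontfun (\<lambda>t. exp (- l * c t) *\<^sub>R (y0 + I d (c t)))"
    for d :: "real \<Rightarrow>\<^sub>C 'b"
  have bc: "(\<lambda>t. exp (- l * c t) *\<^sub>R (y0 + I d (c t))) \<in> bcontfun" for d :: "real \<Rightarrow>\<^sub>C 'b"
  proof -
    let ?g = "\<lambda>t. exp (- l * t) *\<^sub>R (y0 + I d t)"
    have g: "continuous_on {0..T} ?g" by (intro continuous_intros Ic)
    have "bounded (?g ` {0..T})" by (intro compact_imp_bounded compact_continuous_image g) auto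
    then have "bounded (range (\<lambda>t. ?g (c t)))" by (rule bounded_subset) (use c in auto)
    moreover have "continuous_on UNIV (\<lambda>t. ?g (c t))"
      by (rule continuous_on_compose2[OF g cc]) (use c in auto)
    ultimately show ?thesis by (simp add: bcontfun_def)
  qed
  have ap: "apply_bcontfun (\<Phi> d) t = exp (- l * c t) *\<^sub>R (y0 + I d (c t))" for d :: "real \<Rightarrow>\<^sub>C 'b" and t
    by (simp only: \<Phi>_def Bcontfun_inverse[OF bc])
  have "\<exists>!d. \<Phi> d = d"
  proof (rule banach_fix_type[of "1/2"])
    show "\<forall>d d'. dist (\<Phi> d) (\<Phi> d') \<le> 1 / 2 * dist d d'"
    proof (intro allI dist_bound)
      fix d d' :: "real \<Rightarrow>\<^sub>C 'b" and t :: real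
      define s where "s = c t"
      define D where "D = dist d d'"
      have s: "0 \<le> s" using c[of t] by (simp add: s_def)
      have e: "((\<lambda>x. L * D * exp (l * x)) has_integral (L * D * (exp (l * s) / l) - L * D * (exp (l * 0) / l))) {0..s}"
        using s l by (intro fundamental_theorem_of_calculus)
          (auto intro!: derivative_eq_intros simp flip: has_real_derivative_iff_has_vector_derivative)
      have "norm (I d s - I d' s) = norm (integral {0..s} (\<lambda>x. F (exp (l * x) *\<^sub>R apply_bcontfun d x) - F (exp (l * x) *\<^sub>R apply_bcontfun d' x)))"
        unfolding I_def by (simp add: Henstock_Kurzweil_Integration.integral_diff ii)
      also have "\<dots> \<le> integral {0..s} (\<lambda>x. L * D * exp (l * x))"
      proof (rule integral_norm_bound_integral)
        fix x
        have "norm (F (exp (l * x) *\<^sub>R apply_bcontfun d x) - F (exp (l * x) *\<^sub>R apply_bcontfun d' x))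
            \<le> L * norm (exp (l * x) *\<^sub>R apply_bcontfun d x - exp (l * x) *\<^sub>R apply_bcontfun d' x)" by (rule L)
        also have "\<dots> = L * (exp (l * x) * dist (apply_bcontfun d x) (apply_bcontfun d' x))"
          by (simp add: dist_norm flip: scaleR_diff_right)
        also have "\<dots> \<le> L * (exp (l * x) * D)" unfolding D_def
          using L(1) dist_bounded[of d x d'] by (intro mult_left_mono) auto
        finally show "norm (F (exp (l * x) *\<^sub>R apply_bcontfun d x) - F (exp (l * x) *\<^sub>R apply_bcontfun d' x)) \<le> L * D * exp (l * x)"
          by (simp add: ac_simps)
      qed (use e ii in \<open>auto intro!: Henstock_Kurzweil_Integration.integrable_diff\<close>)
      also have "\<dots> = L * D * (exp (l * s) / l) - L * D * (exp (l * 0) / l)" using e by (rule integral_unique)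
      also have "\<dots> \<le> L * D / l * exp (l * s)" using L(1) l by (simp add: D_def)
      also have "\<dots> \<le> 1 / 2 * D * exp (l * s)"
      proof (rule mult_right_mono)
        have "L * D \<le> 1 / 2 * l * D" by (rule mult_right_mono) (auto simp: l_def D_def)
        then show "L * D / l \<le> 1 / 2 * D" using l by (simp add: field_simps)
      qed simp
      finally have n: "norm (I d s - I d' s) \<le> 1 / 2 * D * exp (l * s)" .
      have "dist (apply_bcontfun (\<Phi> d) t) (apply_bcontfun (\<Phi> d') t) = exp (- l * s) * norm (I d s - I d' s)"
        unfolding ap dist_norm s_def by (simp flip: scaleR_diff_right)
      also have "\<dots> \<le> exp (- l * s) * (1 / 2 * D * exp (l * s))" using n by (intro mult_left_mono) auto
      also have "\<dots> = 1 / 2 * D" by (simp add: exp_minus)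
      finally show "dist (apply_bcontfun (\<Phi> d) t) (apply_bcontfun (\<Phi> d') t) \<le> 1 / 2 * dist d d'" by (simp add: D_def)
    qed
  qed auto
  then obtain d where d: "\<Phi> d = d" by blast
  define y where "y t = exp (l * t) *\<^sub>R apply_bcontfun d t" for t
  have y: "y t = y0 + integral {0..t} (\<lambda>s. F (y s))" if "t \<in> {0..T}" for t
  proof -
    have "apply_bcontfun d t = exp (- l * t) *\<^sub>R (y0 + I d t)" using ap[of d t] that by (simp add: d cid)
    then have "y t = (exp (l * t) * exp (- l * t)) *\<^sub>R (y0 + I d t)" by (simp add: y_def)
    also have "exp (l * t) * exp (- l * t) = 1" by (simp add: exp_minus)
    finally show ?thesis by (simp add: I_def y_def)
  qed
  show thesis
  proof (rule that[of y])
    show "y 0 = y0" using y[of 0] T by simp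
    fix t assume t: "t \<in> {0..T}"
    have "((\<lambda>t. y0 + integral {0..t} (\<lambda>s. F (y s))) has_vector_derivative 0 + F (y t)) (at t within {0..T})"
      using ic t unfolding y_def
      by (intro has_vector_derivative_add has_vector_derivative_const integral_has_vector_derivative) auto
    then show "(y has_vector_derivative F (y t)) (at t within {0..T})"
      using has_vector_derivative_transform[OF t y] by simp
  qed
qed

section \<open>Quadratic systems with truncated coordinates\<close>

definition clip :: "real \<Rightarrow> real \<Rightarrow> real" where
  "clip R y = max (- R) (min R y)"

lemma clip_id: "\<bar>y\<bar> \<le> R \<Longrightarrow> clip R y = y"
  by (auto simp: clip_def)

lemma clip_bound: "0 \<le> R \<Longrightarrow> \<bar>clip R y\<bar> \<le> R"
  by (auto simp: clip_def)

lemma clip_Lipschitz: "\<bar>clip R y - clip R y'\<bar> \<le> \<bar>y - y'\<bar>"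
  by (auto simp: clip_def max_def min_def)

lemma clip_mult_Lipschitz:
  assumes "0 \<le> R" "\<bar>x - x'\<bar> \<le> D" "\<bar>y - y'\<bar> \<le> D"
  shows "\<bar>clip R x * clip R y - clip R x' * clip R y'\<bar> \<le> 2 * R * D"
proof -
  have "clip R x * clip R y - clip R x' * clip R y'
      = (clip R x - clip R x') * clip R y + clip R x' * (clip R y - clip R y')" by (simp add: algebra_simps)
  also have "\<bar>\<dots>\<bar> \<le> \<bar>clip R x - clip R x'\<bar> * \<bar>clip R y\<bar> + \<bar>clip R x'\<bar> * \<bar>clip R y - clip R y'\<bar>"
    by (metis abs_mult abs_triangle_ineq)
  also have "\<dots> \<le> D * R + R * D"
    using clip_bound[OF assms(1)] clip_Lipschitz[of R x x'] clip_Lipschitz[of R y y'] assms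
    by (intro add_mono mult_mono) auto
  finally show ?thesis by (simp add: algebra_simps)
qed

text \<open>Truncation makes the quadratic right-hand side globally Lipschitz, which excludes
  blow-up. The dimension \<open>n\<close> is a value, not a type; coordinates are stored as the
  values of a bounded continuous function at the integers below \<open>n\<close>, which gives one
  Banach space for all \<open>n\<close>.\<close>

lemma quadratic_ode_exists:
  fixes a :: "nat \<Rightarrow> nat \<Rightarrow> nat \<Rightarrow> real"
  assumes T: "0 < T" and R: "0 \<le> R"
  obtains c where "\<And>i. i < n \<Longrightarrow> c 0 i = c0 i"
    "\<And>i t. i < n \<Longrightarrow> t \<in> {0..T} \<Longrightarrow> ((\<lambda>s. c s i) has_real_derivative
       (\<Sum>j<n. \<Sum>k<n. a i j k * (clip R (c t j) * clip R (c t k)))) (at t within {0..T})"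
proof -
  define G where "G x i = (\<Sum>j<n. \<Sum>k<n. a i j k * (clip R (x j) * clip R (x k)))" for x i
  \<comment> \<open>Hat functions at the integers: \<open>fin\<close> embeds a coordinate vector by
    interpolation and \<open>co\<close> reads it back.\<close>
  define hat where "hat i x = max 0 (1 - \<bar>x - real i\<bar>)" for i :: nat and x :: real
  have hat: "0 \<le> hat i x" "hat i x \<le> 1" "hat i (real j) = (if i = j then 1 else 0)" for i j x
    by (auto simp: hat_def)
  define fin where "fin g = Bcontfun (\<lambda>x. \<Sum>i<n. g i * hat i x)" for g :: "nat \<Rightarrow> real"
  have fin: "apply_bcontfun (fin g) x = (\<Sum>i<n. g i * hat i x)" for g x
  proof -
    have "(\<lambda>x. \<Sum>i<n. g i * hat i x) \<in> bcontfun"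
    proof (rule bcontfun_normI)
      show "continuous_on UNIV (\<lambda>x. \<Sum>i<n. g i * hat i x)" unfolding hat_def by (intro continuous_intros)
      show "norm (\<Sum>i<n. g i * hat i x) \<le> (\<Sum>i<n. \<bar>g i\<bar>)" for x
        using hat by (intro sum_norm_le) (auto simp: abs_mult mult_left_le)
    qed
    then show ?thesis by (simp only: fin_def Bcontfun_inverse)
  qed
  have fin_at: "apply_bcontfun (fin g) (real i) = g i" if "i < n" for g i
  proof -
    have "apply_bcontfun (fin g) (real i) = (\<Sum>j<n. if j = i then g j else 0)"
      unfolding fin by (intro sum.cong) (auto simp: hat(3))
    then show ?thesis using that by simp
  qed
  define co where "co x i = apply_bcontfun x (real i)" for x :: "real \<Rightarrow>\<^sub>C real" and i :: nat
  define F where "F x = fin (G (co x))" for x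
  define A where "A = (\<Sum>i<n. \<Sum>j<n. \<Sum>k<n. \<bar>a i j k\<bar>)"
  have A0: "A \<ge> 0" unfolding A_def by (intro sum_nonneg) auto
  have Lip: "norm (F x - F y) \<le> A * (2 * R) * norm (x - y)" for x y
  proof (rule norm_bound)
    fix q :: real
    define D where "D = norm (x - y)"
    have D: "\<bar>co x j - co y j\<bar> \<le> D" for j
      using norm_bounded[of "x - y" "real j"] by (simp add: D_def co_def)
    have G: "\<bar>G (co x) i - G (co y) i\<bar> \<le> (\<Sum>j<n. \<Sum>k<n. \<bar>a i j k\<bar> * (2 * R * D))" for i
    proof -
      have "\<bar>G (co x) i - G (co y) i\<bar> = \<bar>\<Sum>j<n. \<Sum>k<n. a i j k *
          (clip R (co x j) * clip R (co x k) - clip R (co y j) * clip R (co y k))\<bar>"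
        by (simp add: G_def right_diff_distrib sum_subtractf)
      also have "\<dots> \<le> (\<Sum>j<n. \<Sum>k<n. \<bar>a i j k\<bar> * (2 * R * D))"
        using clip_mult_Lipschitz[OF R D D]
        by (intro order_trans[OF sum_abs] sum_mono) (auto simp: abs_mult intro!: mult_left_mono)
      finally show ?thesis .
    qed
    have "norm (apply_bcontfun (F x - F y) q) = \<bar>\<Sum>i<n. (G (co x) i - G (co y) i) * hat i q\<bar>"
      by (simp add: F_def fin left_diff_distrib sum_subtractf)
    also have "\<dots> \<le> (\<Sum>i<n. \<bar>G (co x) i - G (co y) i\<bar> * 1)"
      using hat by (intro order_trans[OF sum_abs] sum_mono) (auto simp: abs_mult intro!: mult_left_le)
    also have "\<dots> \<le> (\<Sum>i<n. \<Sum>j<n. \<Sum>k<n. \<bar>a i j k\<bar> * (2 * R * D))"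
      using G by (intro sum_mono) simp
    also have "\<dots> = A * (2 * R) * norm (x - y)"
      unfolding A_def D_def by (simp add: sum_distrib_right mult.assoc)
    finally show "norm (apply_bcontfun (F x - F y) q) \<le> A * (2 * R) * norm (x - y)" .
  qed
  obtain y where y: "y 0 = fin c0"
    "\<And>t. t \<in> {0..T} \<Longrightarrow> (y has_vector_derivative F (y t)) (at t within {0..T})"
    using Lipschitz_ode_exists[of "A * (2 * R)" F T "fin c0"] A0 R Lip T by auto
  show thesis
  proof (rule that[of "\<lambda>t. co (y t)"])
    show "co (y 0) i = c0 i" if "i < n" for i using that by (simp add: y co_def fin_at)
    fix i t assume i: "i < n" and t: "t \<in> {0..T}"
    \<comment> \<open>Evaluation at an integer is bounded and linear, so it passes the vector-valued
      derivative on to each coordinate.\<close>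
    have "bounded_linear (\<lambda>x :: real \<Rightarrow>\<^sub>C real. co x i)" unfolding co_def
      by (rule bounded_linear_intro[of _ 1]) (use norm_bounded[where 'b=real, unfolded real_norm_def] in simp_all)
    from bounded_linear.has_vector_derivative[OF this y(2)[OF t]]
    have "((\<lambda>s. co (y s) i) has_vector_derivative G (co (y t)) i) (at t within {0..T})"
      using i by (simp add: F_def co_def[of "fin (G (co (y t)))"] fin_at)
    then show "((\<lambda>s. co (y s) i) has_real_derivative
       (\<Sum>j<n. \<Sum>k<n. a i j k * (clip R (co (y t) j) * clip R (co (y t) k)))) (at t within {0..T})"
      by (simp add: G_def has_real_derivative_iff_has_vector_derivative)
  qed
qed

section \<open>Gronwall and continuation arguments\<close>

text \<open>\<open>exp (- A * s) * f s - B * s\<close> is nonincreasing because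
  \<open>exp (- A * s) \<le> 1\<close>. The form \<open>B * t\<close> avoids a division by
  \<open>A\<close> and so allows \<open>A = 0\<close>.\<close>

lemma Gronwall:
  fixes f :: "real \<Rightarrow> real"
  assumes t: "0 \<le> t" and AB: "0 \<le> A" "0 \<le> B"
    and d: "\<And>s. s \<in> {0..t} \<Longrightarrow> (f has_real_derivative f' s) (at s within {0..t})"
    and le: "\<And>s. s \<in> {0..t} \<Longrightarrow> f' s \<le> A * f s + B"
  shows "f t \<le> (f 0 + B * t) * exp (A * t)"
proof -
  define k where "k s = exp (- A * s) * f s - B * s" for s
  have "k t \<le> k 0"
  proof (rule DERIV_nonpos_imp_decreasing_open[OF t])
    fix s assume s: "0 < s" "s < t"
    then have "(f has_real_derivative f' s) (at s)" using d[of s] by (simp add: at_within_Icc_at)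
    then have "(k has_real_derivative exp (- A * s) * (f' s - A * f s) - B) (at s)"
      unfolding k_def by (auto intro!: derivative_eq_intros simp: algebra_simps)
    moreover have "exp (- A * s) * (f' s - A * f s) - B \<le> 0"
    proof -
      have "exp (- A * s) * (f' s - A * f s) \<le> exp (- A * s) * B"
        using le[of s] s by (intro mult_left_mono) auto
      also have "\<dots> \<le> 1 * B" using AB s by (intro mult_right_mono) auto
      finally show ?thesis by simp
    qed
    ultimately show "\<exists>y. DERIV k s :> y \<and> y \<le> 0" by blast
  next
    have "continuous_on {0..t} f" by (rule DERIV_continuous_on[OF d])
    then show "continuous_on {0..t} k" unfolding k_def by (intro continuous_intros)
  qed
  then have le: "exp (A * t) * (exp (- A * t) * f t) \<le> exp (A * t) * (f 0 + B * t)"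
    by (intro mult_left_mono) (auto simp: k_def)
  have eq: "exp (A * t) * (exp (- A * t) * f t) = f t"
    by (simp add: mult.assoc[symmetric] exp_add[symmetric])
  show ?thesis using le unfolding eq by (simp only: mult.commute)
qed

text \<open>At a first time with \<open>f \<ge> b\<close>, the premise of \<open>step\<close> holds
  on the whole initial interval, and its strict conclusion is a contradiction. This makes an
  estimate that presupposes its own bound unconditional.\<close>

lemma continuous_bootstrap:
  fixes f :: "real \<Rightarrow> real"
  assumes f: "continuous_on {0..T} f" and 0: "f 0 < b"
    and step: "\<And>t. t \<in> {0..T} \<Longrightarrow> (\<And>s. s \<in> {0..t} \<Longrightarrow> f s \<le> b) \<Longrightarrow> f t < b" and t: "t \<in> {0..T}"
  shows "f t < b"
proof (rule ccontr)
  assume "\<not> f t < b"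
  define E where "E = {s \<in> {0..T}. b \<le> f s}"
  have "E = {0..T} \<inter> f -` {b..}" by (auto simp: E_def)
  then have "closed E" using continuous_closed_preimage[OF f] by simp
  moreover have "bounded E" by (rule bounded_subset[of "{0..T}"]) (auto simp: E_def)
  ultimately have "compact E" by (simp add: compact_eq_bounded_closed)
  moreover have "E \<noteq> {}" using t \<open>\<not> f t < b\<close> by (auto simp: E_def)
  ultimately obtain s where s: "s \<in> E" "\<And>s'. s' \<in> E \<Longrightarrow> s \<le> s'"
    using compact_attains_inf[of E] by auto
  have sT: "s \<in> {0..T}" and fs: "b \<le> f s" using s by (auto simp: E_def)
  have lt: "f s' < b" if "0 \<le> s'" "s' < s" for s'
  proof (rule ccontr)
    assume "\<not> f s' < b"
    then have "s' \<in> E" using that sT by (auto simp: E_def)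
    then show False using s(2)[of s'] that by simp
  qed
  have "s > 0" using 0 fs sT by (cases "s = 0") auto
  \<comment> \<open>By the intermediate value theorem, a value above \<open>b\<close> at
    \<open>s\<close> would be preceded by the value \<open>b\<close>, before the first such
    time.\<close>
  have "f s \<le> b"
  proof (rule ccontr)
    assume "\<not> f s \<le> b"
    moreover have "continuous_on {0..s} f" using sT by (intro continuous_on_subset[OF f]) auto
    ultimately obtain x where x: "0 \<le> x" "x \<le> s" "f x = b"
      using IVT'[of f 0 b s] 0 \<open>s > 0\<close> by auto
    then show False using lt[of x] \<open>\<not> f s \<le> b\<close> by (cases "x = s") auto
  qed
  then have "f s' \<le> b" if "s' \<in> {0..s}" for s' using lt[of s'] that by (cases "s' = s") auto
  then show False using step[OF sT] fs by force
qed

section \<open>Error estimates at a fixed time\<close>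

text \<open>The locale parameter \<open>c\<close> absorbs the constants of the inverse estimates and of quasiuniformity.\<close>

locale qu_mesh = fe_mesh +
  fixes c :: real
  assumes c1: "1 \<le> c" and h1: "h \<le> 1"
    and inv_L2: "\<phi> \<in> S \<Longrightarrow> l2_norm (deriv \<phi>) \<le> c * l2_norm \<phi> / h"
    and inv_sup: "\<phi> \<in> S \<Longrightarrow> g \<in> bdd_meas \<Longrightarrow> (\<And>x. x \<in> {0..1} \<Longrightarrow> \<bar>g x\<bar> \<le> M) \<Longrightarrow>
      AE x in UI. \<bar>deriv \<phi> x\<bar> \<le> c * (l2_norm (\<lambda>x. deriv \<phi> x - g x) / sqrt h + M)"

text \<open>Trades the minimal for the maximal mesh length in the inverse estimates, at the price of
  a power of \<open>\<gamma>\<close>.\<close>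

lemma qu_mesh_exists:
  assumes "2 \<le> r" "1 \<le> \<gamma>"
  obtains c where "1 \<le> c"
    "\<And>\<mu> N z. fe_mesh r \<mu> N z \<Longrightarrow> max_length (N, z) \<le> 1 \<Longrightarrow>
       max_length (N, z) \<le> \<gamma> * min_length (N, z) \<Longrightarrow> qu_mesh r \<mu> N z c"
proof (rule fe_inverse[of r])
  fix C :: real assume C: "C \<ge> 0"
    and C1: "\<And>\<mu> N z \<phi>. fe_mesh r \<mu> N z \<Longrightarrow> \<phi> \<in> fe_space r \<mu> (N, z) \<Longrightarrow>
        l2_norm (deriv \<phi>) \<le> C * l2_norm \<phi> / min_length (N, z)"
    and C2: "\<And>\<mu> N z \<phi> g M. fe_mesh r \<mu> N z \<Longrightarrow> \<phi> \<in> fe_space r \<mu> (N, z) \<Longrightarrow> g \<in> bdd_meas \<Longrightarrow>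
        (\<And>x. x \<in> {0..1} \<Longrightarrow> \<bar>g x\<bar> \<le> M) \<Longrightarrow>
        AE x in UI. \<bar>deriv \<phi> x\<bar> \<le> C * (l2_norm (\<lambda>x. deriv \<phi> x - g x) / sqrt (min_length (N, z)) + M)"
  \<comment> \<open>The summand 1 forces \<open>1 \<le> c\<close>; the factor
    \<open>\<gamma> \<ge> 1\<close> also covers the term with \<open>M\<close>, which carries no
    mesh length.\<close>
  define c where "c = (C + 1) * \<gamma>"
  have c: "1 \<le> c" "C * \<gamma> \<le> c" "C \<le> c"
  proof -
    show "C * \<gamma> \<le> c" using assms(2) by (simp add: c_def algebra_simps)
    have "(C + 1) * 1 \<le> c" unfolding c_def using C assms(2) by (intro mult_left_mono) auto
    then show "1 \<le> c" "C \<le> c" using C by auto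
  qed
  show thesis
  proof (rule that[OF c(1)])
    fix \<mu> N z assume m: "fe_mesh r \<mu> N z" and h1: "max_length (N, z) \<le> 1"
      and q: "max_length (N, z) \<le> \<gamma> * min_length (N, z)"
    interpret fe_mesh r \<mu> N z by (rule m)
    define k where "k = min_length (N, z)"
    have k: "0 < k" unfolding k_def by (rule min_len_pos)
    have q: "h \<le> \<gamma> * k" using q by (simp add: k_def)
    have i1: "X / k \<le> \<gamma> * X / h" if "0 \<le> X" for X
      using mult_left_mono[OF q that] k h_pos by (simp add: field_simps)
    have i2: "X / sqrt k \<le> \<gamma> * X / sqrt h" if "0 \<le> X" for X
    proof -
      have "sqrt h \<le> sqrt (\<gamma> * k)" using q by simp
      also have "\<dots> = sqrt \<gamma> * sqrt k" by (rule real_sqrt_mult)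
      also have "\<dots> \<le> \<gamma> * sqrt k"
      proof (rule mult_right_mono)
        have "sqrt \<gamma> \<le> sqrt (\<gamma>\<^sup>2)" using self_le_power[OF assms(2), of 2] by (intro real_sqrt_le_mono) simp
        then show "sqrt \<gamma> \<le> \<gamma>" using assms(2) by simp
      qed (use k in simp)
      finally have "X * sqrt h \<le> X * (\<gamma> * sqrt k)" using that by (rule mult_left_mono)
      then show ?thesis using k h_pos by (simp add: field_simps)
    qed
    show "qu_mesh r \<mu> N z c"
    proof unfold_locales
      show "1 \<le> c" by (rule c)
      show "h \<le> 1" by (rule h1)
      fix \<phi> assume \<phi>: "\<phi> \<in> S"
      have "l2_norm (deriv \<phi>) \<le> C * l2_norm \<phi> / k" using C1[OF m \<phi>] by (simp add: k_def)
      also have "\<dots> \<le> \<gamma> * (C * l2_norm \<phi>) / h" using C by (intro i1) simp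
      also have "\<dots> = (C * \<gamma>) * (l2_norm \<phi> / h)" by simp
      also have "\<dots> \<le> c * (l2_norm \<phi> / h)" using c(2) h_pos by (intro mult_right_mono) auto
      finally show "l2_norm (deriv \<phi>) \<le> c * l2_norm \<phi> / h" by simp
      fix g M assume g: "g \<in> bdd_meas" and M: "\<And>x. x \<in> {0..1} \<Longrightarrow> \<bar>g x\<bar> \<le> (M::real)"
      define E where "E = l2_norm (\<lambda>x. deriv \<phi> x - g x)"
      have E: "E \<ge> 0" by (simp add: E_def)
      have M0: "M \<ge> 0" using M[of 0] by simp
      have "C * (E / sqrt k + M) \<le> C * (\<gamma> * E / sqrt h + M)"
        using C i2[OF E] by (intro mult_left_mono add_right_mono)
      also have "\<dots> = (C * \<gamma>) * (E / sqrt h) + C * M" by (simp add: algebra_simps)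
      also have "\<dots> \<le> c * (E / sqrt h) + c * M"
        using c E M0 h_pos by (intro add_mono mult_right_mono) auto
      finally have le: "C * (E / sqrt k + M) \<le> c * (E / sqrt h + M)" by (simp add: algebra_simps)
      have "AE x in UI. \<bar>deriv \<phi> x\<bar> \<le> C * (E / sqrt k + M)"
        using C2[OF m \<phi> g M] by (simp add: E_def k_def)
      then show "AE x in UI. \<bar>deriv \<phi> x\<bar> \<le> c * (l2_norm (\<lambda>x. deriv \<phi> x - g x) / sqrt h + M)"
        unfolding E_def[symmetric] by eventually_elim (use le in linarith)
    qed
  qed
qed

text \<open>Orders \<open>0\<close> and \<open>1\<close> bound coefficients in the nonlinear terms,
  order \<open>r\<close> enters the approximation estimate.\<close>

definition smooth_bound :: "nat \<Rightarrow> real \<Rightarrow> (real \<Rightarrow> real) \<Rightarrow> bool" where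
  "smooth_bound r M v \<longleftrightarrow> v \<in> Ck r \<and> v 0 = 0 \<and> v 1 = 0 \<and>
     (\<forall>x\<in>{0..1}. \<bar>v x\<bar> \<le> M \<and> \<bar>dx v x\<bar> \<le> M \<and> \<bar>(dx ^^ r) v x\<bar> \<le> M)"

text \<open>The right-hand side of the evolution equation tested with \<open>\<psi>\<close>, written
  with \<open>deriv\<close> in place of \<open>wderiv\<close> so that it can be computed
  with.\<close>

definition transport :: "(real \<Rightarrow> real) \<Rightarrow> (real \<Rightarrow> real) \<Rightarrow> (real \<Rightarrow> real) \<Rightarrow> real" where
  "transport u m \<psi> = - l2_inner (\<lambda>x. u x * deriv m x) \<psi> - 2 * l2_inner (\<lambda>x. deriv u x * m x) \<psi>"

context qu_mesh
begin

text \<open>\<open>ca\<close> comes from the approximation estimate. \<open>ce\<close> adds the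
  inverse inequality applied to the distance, with constant \<open>2 * ca\<close>, between
  approximation and projection; \<open>cd\<close> turns the resulting error into a maximum
  bound.\<close>

definition ca :: real where "ca = (3 ^ r) ^ r"
definition ce :: real where "ce = ca * (1 + 2 * c)"
definition cd :: real where "cd = c * (ce + 1)"

lemma const_bounds: "1 \<le> ca" "ca \<le> ce" "1 \<le> cd" "0 < c"
proof -
  show "1 \<le> ca" unfolding ca_def by (intro one_le_power) simp
  then have a: "1 \<le> ca" .
  have "ca * 1 \<le> ce" unfolding ce_def using a c1 by (intro mult_left_mono) auto
  then show "ca \<le> ce" by simp
  then have "1 * 1 \<le> c * (ce + 1)" using a c1 by (intro mult_mono) auto
  then show "1 \<le> cd" by (simp add: cd_def)
qed (use c1 in simp)

lemma h_power: "h ^ r \<le> h ^ (r - 1)" "h ^ (r - 1) \<le> h" "h ^ (r - 1) \<le> sqrt h" "h ^ r = h * h ^ (r - 1)"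
proof -
  show "h ^ r \<le> h ^ (r - 1)" using h1 h_pos by (intro power_decreasing) auto
  have "h ^ (r - 1) \<le> h ^ 1" using h1 h_pos r by (intro power_decreasing) auto
  then show l: "h ^ (r - 1) \<le> h" by simp
  have "h\<^sup>2 \<le> h" using h1 h_pos by (simp add: power2_eq_square mult_left_le)
  then have "h \<le> sqrt h" using h_pos by (intro real_le_rsqrt) simp
  then show "h ^ (r - 1) \<le> sqrt h" using l by linarith
  show "h ^ r = h * h ^ (r - 1)" using r by (cases r) auto
qed

lemma smooth_pw: "smooth_bound r M v \<Longrightarrow> pw_deriv v (dx v)"
  using Ck_pw_deriv[of v r 0] r by (simp add: smooth_bound_def)

lemma smooth_bound_nonneg: "smooth_bound r M v \<Longrightarrow> 0 \<le> M"
  unfolding smooth_bound_def using abs_ge_zero order_trans by (metis atLeastAtMost_iff order_refl zero_le_one)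

lemma smooth_approx:
  assumes v: "smooth_bound r M v"
  obtains w where "w \<in> S" "l2_norm (\<lambda>x. dx v x - deriv w x) \<le> ca * M * h ^ (r - 1)"
    "l2_norm (\<lambda>x. v x - w x) \<le> ca * M * h ^ r"
proof (rule fe_energy_projection[of v M])
  have M: "0 \<le> M" using smooth_bound_nonneg[OF v] .
  have "(3 ^ r) ^ (r - 1) \<le> ca" unfolding ca_def by (intro power_increasing) auto
  then have le: "M * (3 ^ r) ^ (r - 1) * h ^ (r - 1) \<le> M * ca * h ^ (r - 1)"
    using M h_pos by (intro mult_right_mono mult_left_mono) auto
  fix w assume w: "w \<in> S" "l2_norm (\<lambda>x. dx v x - deriv w x) \<le> M * (3 ^ r * h) ^ (r - 1)"
    "l2_norm (\<lambda>x. v x - w x) \<le> M * (3 ^ r * h) ^ r"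
  show thesis
  proof (rule that[OF w(1)])
    show "l2_norm (\<lambda>x. dx v x - deriv w x) \<le> ca * M * h ^ (r - 1)"
      using w(2) le unfolding power_mult_distrib by (simp add: ac_simps)
    show "l2_norm (\<lambda>x. v x - w x) \<le> ca * M * h ^ r"
      using w(3) unfolding power_mult_distrib ca_def by (simp add: ac_simps)
  qed
qed (use v in \<open>auto simp: smooth_bound_def\<close>)

text \<open>The projection is a best \<open>L2\<close> approximation. Its derivative is compared
  with that of the energy approximation \<open>w\<close>: the two functions differ by
  \<open>O(h ^ r)\<close> in \<open>L2\<close>, so the inverse inequality leaves
  \<open>h ^ (r - 1)\<close>. The maximum bounds follow by comparison with
  \<open>dx v\<close>.\<close>

lemma L2_projection_estimates:
  assumes v: "smooth_bound r M v" and p: "p \<in> S" "\<And>\<phi>. \<phi> \<in> S \<Longrightarrow> l2_inner p \<phi> = l2_inner v \<phi>"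
  shows "l2_norm (\<lambda>x. v x - p x) \<le> ce * M * h ^ (r - 1)"
    and "l2_norm (\<lambda>x. dx v x - deriv p x) \<le> ce * M * h ^ (r - 1)"
    and "AE x in UI. \<bar>deriv p x\<bar> \<le> cd * M" and "\<And>x. x \<in> {0..1} \<Longrightarrow> \<bar>p x\<bar> \<le> cd * M"
proof -
  have M: "0 \<le> M" using smooth_bound_nonneg[OF v] .
  obtain w where w: "w \<in> S" "l2_norm (\<lambda>x. dx v x - deriv w x) \<le> ca * M * h ^ (r - 1)"
    "l2_norm (\<lambda>x. v x - w x) \<le> ca * M * h ^ r" using smooth_approx[OF v] .
  have vb: "v \<in> bdd_meas" "dx v \<in> bdd_meas" using pw_deriv_bdd[OF smooth_pw[OF v]] by auto
  note pb = fe_bdd[OF p(1)] and wb = fe_bdd[OF w(1)]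
  have H0: "0 \<le> h ^ (r - 1)" using h_pos by simp
  have vp: "l2_norm (\<lambda>x. v x - p x) \<le> l2_norm (\<lambda>x. v x - w x)"
  proof -
    have o: "l2_inner (\<lambda>x. v x - p x) p = 0" "l2_inner (\<lambda>x. v x - p x) w = 0"
      using p w(1) vb pb wb by (simp_all add: l2_diff_left)
    have "l2_norm (\<lambda>x. v x - p x) * l2_norm (\<lambda>x. v x - p x) = l2_inner (\<lambda>x. v x - p x) (\<lambda>x. v x - p x)"
      by (simp add: l2_norm_sq[symmetric] power2_eq_square)
    also have "\<dots> = l2_inner (\<lambda>x. v x - p x) (\<lambda>x. v x - w x)"
      using o vb pb wb by (simp add: l2_diff_right)
    also have "\<dots> \<le> l2_norm (\<lambda>x. v x - p x) * l2_norm (\<lambda>x. v x - w x)"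
      using l2_Cauchy_Schwarz[of "\<lambda>x. v x - p x" "\<lambda>x. v x - w x"] vb pb wb by auto
    finally show ?thesis
      by (metis l2_norm_nonneg mult_le_cancel_left_pos order_le_less)
  qed
  have "ca * M * h ^ r \<le> ca * M * h ^ (r - 1)" "ca * M * h ^ (r - 1) \<le> ce * M * h ^ (r - 1)"
    using h_power(1) const_bounds M H0 by (auto intro!: mult_left_mono mult_right_mono)
  then show "l2_norm (\<lambda>x. v x - p x) \<le> ce * M * h ^ (r - 1)" using vp w(3) by linarith
  have "l2_norm (\<lambda>x. w x - p x) \<le> l2_norm (\<lambda>x. w x - v x) + l2_norm (\<lambda>x. v x - p x)"
    using vb pb wb by (intro l2_norm_triangle_diff) auto
  also have "l2_norm (\<lambda>x. w x - v x) = l2_norm (\<lambda>x. v x - w x)" by (rule l2_norm_minus)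
  finally have wp: "l2_norm (\<lambda>x. w x - p x) \<le> 2 * ca * M * h ^ r" using vp w(3) by linarith
  have "l2_norm (\<lambda>x. deriv w x - deriv p x) \<le> c * l2_norm (\<lambda>x. w x - p x) / h"
    using inv_L2[OF fe_diff[OF w(1) p(1)]] l2_norm_deriv_diff[OF w(1) p(1)] by simp
  also have "\<dots> \<le> c * (2 * ca * M * h ^ r) / h"
    using wp const_bounds h_pos by (intro divide_right_mono mult_left_mono) auto
  also have "\<dots> = 2 * c * ca * M * h ^ (r - 1)" using h_pos by (simp add: h_power(4))
  finally have "l2_norm (\<lambda>x. deriv w x - deriv p x) \<le> 2 * c * ca * M * h ^ (r - 1)" .
  moreover have "l2_norm (\<lambda>x. dx v x - deriv p x) \<le> l2_norm (\<lambda>x. dx v x - deriv w x) + l2_norm (\<lambda>x. deriv w x - deriv p x)"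
    using vb pb wb by (intro l2_norm_triangle_diff) auto
  moreover have "ce * M * h ^ (r - 1) = ca * M * h ^ (r - 1) + 2 * c * ca * M * h ^ (r - 1)"
    by (simp add: ce_def algebra_simps)
  ultimately show d: "l2_norm (\<lambda>x. dx v x - deriv p x) \<le> ce * M * h ^ (r - 1)" using w(2) by linarith
  have "c * (l2_norm (\<lambda>x. deriv p x - dx v x) / sqrt h + M) \<le> c * (ce * M + M)"
  proof (intro mult_left_mono add_right_mono)
    have "l2_norm (\<lambda>x. deriv p x - dx v x) \<le> ce * M * h ^ (r - 1)" using d by (subst l2_norm_minus)
    \<comment> \<open>\<open>h ^ (r - 1) \<le> sqrt h\<close>, from \<open>r \<ge> 2\<close> and
      \<open>h \<le> 1\<close>, absorbs the loss \<open>1 / sqrt h\<close>.\<close>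
    also have "\<dots> \<le> ce * M * sqrt h" using h_power(3) const_bounds M by (intro mult_left_mono) auto
    finally show "l2_norm (\<lambda>x. deriv p x - dx v x) / sqrt h \<le> ce * M" using h_pos by (simp add: field_simps)
  qed (use const_bounds in simp)
  also have "\<dots> = cd * M" by (simp add: cd_def algebra_simps)
  finally have le: "c * (l2_norm (\<lambda>x. deriv p x - dx v x) / sqrt h + M) \<le> cd * M" .
  have "AE x in UI. \<bar>deriv p x\<bar> \<le> c * (l2_norm (\<lambda>x. deriv p x - dx v x) / sqrt h + M)"
    using v by (intro inv_sup[OF p(1) vb(2)]) (auto simp: smooth_bound_def)
  then show AE: "AE x in UI. \<bar>deriv p x\<bar> \<le> cd * M" by eventually_elim (use le in linarith)
  fix x :: real assume x: "x \<in> {0..1}"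
  have "\<bar>p x\<bar> \<le> l2_norm (deriv p)" by (rule pw_deriv_sup_le[OF fe_pw[OF p(1)] fe_spaceD(3)[OF p(1)] x])
  also have "\<dots> \<le> l2_norm (\<lambda>x. cd * M)"
    using AE pb const_bounds M by (intro l2_norm_mono_AE) (auto elim!: eventually_mono)
  also have "\<dots> = cd * M" using const_bounds M by (simp add: l2_norm_const)
  finally show "\<bar>p x\<bar> \<le> cd * M" .
qed

text \<open>The continuous and the discrete problem have different data: testing their difference
  with \<open>\<xi> = uh - w\<close> leaves \<open>m - mh\<close> as a perturbation, which enters
  with factor 1 because the Poincare constant is 1. Of the factor 3, two parts stem from
  \<open>\<xi>\<close> and one from \<open>w\<close>.\<close>

lemma elliptic_estimates:
  assumes u: "smooth_bound r M u" and m: "m \<in> bdd_meas" and mh: "mh \<in> S" and uh: "uh \<in> S"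
    and A: "\<And>\<phi>. \<phi> \<in> S \<Longrightarrow> l2_inner u \<phi> + l2_inner (dx u) (deriv \<phi>) = l2_inner m \<phi>"
    and Ah: "\<And>\<phi>. \<phi> \<in> S \<Longrightarrow> l2_inner mh \<phi> = bilin_A uh \<phi>"
  shows "l2_norm (\<lambda>x. u x - uh x) \<le> l2_norm (\<lambda>x. m x - mh x) + 3 * ca * M * h ^ (r - 1)"
    and "l2_norm (\<lambda>x. dx u x - deriv uh x) \<le> l2_norm (\<lambda>x. m x - mh x) + 3 * ca * M * h ^ (r - 1)"
proof -
  have M: "0 \<le> M" using smooth_bound_nonneg[OF u] .
  obtain w where w: "w \<in> S" "l2_norm (\<lambda>x. dx u x - deriv w x) \<le> ca * M * h ^ (r - 1)"
    "l2_norm (\<lambda>x. u x - w x) \<le> ca * M * h ^ r" using smooth_approx[OF u] .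
  have ub: "u \<in> bdd_meas" "dx u \<in> bdd_meas" using pw_deriv_bdd[OF smooth_pw[OF u]] by auto
  note mhb = fe_bdd[OF mh] and uhb = fe_bdd[OF uh] and wb = fe_bdd[OF w(1)]
  have "ca * M * h ^ r \<le> ca * M * h ^ (r - 1)" using h_power(1) const_bounds M by (intro mult_left_mono) auto
  then have w3: "l2_norm (\<lambda>x. u x - w x) \<le> ca * M * h ^ (r - 1)" using w(3) by linarith
  define \<xi> where "\<xi> = (\<lambda>x. uh x - w x)"
  have \<xi>: "\<xi> \<in> S" unfolding \<xi>_def by (rule fe_diff[OF uh w(1)])
  note \<xi>b = fe_bdd[OF \<xi>]
  define E where "E = l2_norm (\<lambda>x. m x - mh x)"
  let ?d = "\<lambda>x. deriv uh x - deriv w x"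
  have eqd: "l2_inner ?d (deriv \<xi>) = l2_inner (deriv \<xi>) (deriv \<xi>)"
    unfolding \<xi>_def using deriv_diff_AE[OF uh w(1)] uhb wb \<xi>b(2)
    by (intro l2_cong_AE) (auto elim!: eventually_mono intro!: bdd_meas_measurable simp: \<xi>_def)
  have pc: "l2_norm \<xi> \<le> l2_norm (deriv \<xi>)"
  proof -
    have "l2_norm \<xi> \<le> l2_norm (\<lambda>x. l2_norm (deriv \<xi>))"
      using pw_deriv_sup_le[OF fe_pw[OF \<xi>] fe_spaceD(3)[OF \<xi>]] \<xi>b
      by (intro l2_norm_mono_AE) (auto intro!: AE_I2)
    then show ?thesis by (simp add: l2_norm_const)
  qed
  have "(l2_norm (deriv \<xi>))\<^sup>2 = l2_inner ?d (deriv \<xi>)" by (simp add: l2_norm_sq eqd)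
  also have "\<dots> \<le> l2_inner \<xi> \<xi> + l2_inner ?d (deriv \<xi>)" using l2_self_nonneg by simp
  also have "\<dots> = (l2_inner uh \<xi> + l2_inner (deriv uh) (deriv \<xi>)) - (l2_inner w \<xi> + l2_inner (deriv w) (deriv \<xi>))"
    using uhb wb \<xi>b by (simp add: l2_diff_left \<xi>_def[symmetric])
      (simp add: \<xi>_def l2_diff_left)
  also have "\<dots> = (l2_inner mh \<xi> - l2_inner m \<xi>) + (l2_inner u \<xi> - l2_inner w \<xi>) + (l2_inner (dx u) (deriv \<xi>) - l2_inner (deriv w) (deriv \<xi>))"
    using Ah[OF \<xi>] A[OF \<xi>] bilin_A_fe[OF uh \<xi>] by simp
  also have "\<dots> = l2_inner (\<lambda>x. mh x - m x) \<xi> + l2_inner (\<lambda>x. u x - w x) \<xi> + l2_inner (\<lambda>x. dx u x - deriv w x) (deriv \<xi>)"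
    using m mhb ub wb \<xi>b by (simp add: l2_diff_left)
  also have "\<dots> \<le> E * l2_norm \<xi> + ca * M * h ^ (r - 1) * l2_norm \<xi> + ca * M * h ^ (r - 1) * l2_norm (deriv \<xi>)"
  proof (intro add_mono)
    have "l2_inner (\<lambda>x. mh x - m x) \<xi> \<le> l2_norm (\<lambda>x. mh x - m x) * l2_norm \<xi>"
      using l2_Cauchy_Schwarz[of "\<lambda>x. mh x - m x" \<xi>] m mhb \<xi>b by auto
    then show "l2_inner (\<lambda>x. mh x - m x) \<xi> \<le> E * l2_norm \<xi>" by (simp add: E_def l2_norm_minus[of mh])
    have "l2_inner (\<lambda>x. u x - w x) \<xi> \<le> l2_norm (\<lambda>x. u x - w x) * l2_norm \<xi>"
      using l2_Cauchy_Schwarz[of "\<lambda>x. u x - w x" \<xi>] ub wb \<xi>b by auto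
    also have "\<dots> \<le> ca * M * h ^ (r - 1) * l2_norm \<xi>" using w3 by (intro mult_right_mono) auto
    finally show "l2_inner (\<lambda>x. u x - w x) \<xi> \<le> ca * M * h ^ (r - 1) * l2_norm \<xi>" .
    have "l2_inner (\<lambda>x. dx u x - deriv w x) (deriv \<xi>) \<le> l2_norm (\<lambda>x. dx u x - deriv w x) * l2_norm (deriv \<xi>)"
      using l2_Cauchy_Schwarz[of "\<lambda>x. dx u x - deriv w x" "deriv \<xi>"] ub wb \<xi>b by auto
    also have "\<dots> \<le> ca * M * h ^ (r - 1) * l2_norm (deriv \<xi>)" using w(2) by (intro mult_right_mono) auto
    finally show "l2_inner (\<lambda>x. dx u x - deriv w x) (deriv \<xi>) \<le> ca * M * h ^ (r - 1) * l2_norm (deriv \<xi>)" .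
  qed
  also have "\<dots> \<le> E * l2_norm (deriv \<xi>) + ca * M * h ^ (r - 1) * l2_norm (deriv \<xi>) + ca * M * h ^ (r - 1) * l2_norm (deriv \<xi>)"
    using pc const_bounds M h_pos by (intro add_mono mult_left_mono) (auto simp: E_def)
  finally have "l2_norm (deriv \<xi>) * l2_norm (deriv \<xi>) \<le> (E + 2 * ca * M * h ^ (r - 1)) * l2_norm (deriv \<xi>)"
    by (simp add: power2_eq_square algebra_simps)
  then have D: "l2_norm (deriv \<xi>) \<le> E + 2 * ca * M * h ^ (r - 1)"
  proof (cases "l2_norm (deriv \<xi>) = 0")
    case False
    then have "l2_norm (deriv \<xi>) > 0" by (simp add: less_le)
    then show ?thesis using \<open>l2_norm (deriv \<xi>) * l2_norm (deriv \<xi>) \<le> _\<close> by simp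
  qed (use M const_bounds h_pos in \<open>simp add: E_def\<close>)
  have "l2_norm (\<lambda>x. u x - uh x) \<le> l2_norm (\<lambda>x. u x - w x) + l2_norm (\<lambda>x. w x - uh x)"
    using ub uhb wb by (intro l2_norm_triangle_diff) auto
  also have "l2_norm (\<lambda>x. w x - uh x) = l2_norm \<xi>" unfolding \<xi>_def by (rule l2_norm_minus)
  finally show "l2_norm (\<lambda>x. u x - uh x) \<le> l2_norm (\<lambda>x. m x - mh x) + 3 * ca * M * h ^ (r - 1)"
    using w3 pc D unfolding E_def by linarith
  have "l2_norm (\<lambda>x. dx u x - deriv uh x) \<le> l2_norm (\<lambda>x. dx u x - deriv w x) + l2_norm (\<lambda>x. deriv w x - deriv uh x)"
    using ub uhb wb by (intro l2_norm_triangle_diff) auto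
  also have "l2_norm (\<lambda>x. deriv w x - deriv uh x) = l2_norm (deriv \<xi>)"
    unfolding \<xi>_def l2_norm_deriv_diff[OF uh w(1)] by (rule l2_norm_minus)
  finally show "l2_norm (\<lambda>x. dx u x - deriv uh x) \<le> l2_norm (\<lambda>x. m x - mh x) + 3 * ca * M * h ^ (r - 1)"
    using w(2) D unfolding E_def by linarith
qed

section \<open>The energy estimate for the transport term\<close>

lemma l2_inner_mult_le:
  assumes "AE x in UI. \<bar>f x\<bar> \<le> B" "0 \<le> B" "f \<in> bdd_meas" "g \<in> bdd_meas" "\<theta> \<in> bdd_meas" "l2_norm g \<le> G"
  shows "\<bar>l2_inner (\<lambda>x. f x * g x) \<theta>\<bar> \<le> B * G * l2_norm \<theta>"
proof -
  have "\<bar>l2_inner (\<lambda>x. f x * g x) \<theta>\<bar> \<le> l2_norm (\<lambda>x. f x * g x) * l2_norm \<theta>"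
    using assms by (intro l2_Cauchy_Schwarz) auto
  also have "\<dots> \<le> B * l2_norm g * l2_norm \<theta>"
    using assms by (intro mult_right_mono l2_norm_mult_bound) auto
  also have "\<dots> \<le> B * G * l2_norm \<theta>" using assms by (intro mult_right_mono mult_left_mono) auto
  finally show ?thesis .
qed

text \<open>\<open>cg\<close> is the error constant for \<open>u\<close>, \<open>cq\<close> bounds
  \<open>deriv uh\<close> in the maximum norm, and \<open>cb\<close> and \<open>cA\<close> become
  the coefficients of \<open>h ^ (2 * (r - 1))\<close> and of the squared norm of
  \<open>\<theta>\<close>.\<close>

definition cg :: "real \<Rightarrow> real" where "cg M = (ce + 3 * ca) * M"
definition cq :: "real \<Rightarrow> real" where "cq M = c * (1 + cg M + M)"
definition cb :: "real \<Rightarrow> real" where "cb M = 3 * (cd * M) * cg M + 3 * M * (ce * M)"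
definition cA :: "real \<Rightarrow> real" where "cA M = 3 / 2 * cq M + 3 * (cd * M) + cb M"

text \<open>After splitting, \<open>deriv \<theta>\<close> occurs only in the skew term; in every
  other difference one factor is bounded in the maximum norm and the other is an error of size
  \<open>l2_norm \<theta> + O(h ^ (r - 1))\<close>. The hypothesis \<open>small\<close> serves to
  bound \<open>deriv uh\<close>.\<close>

lemma transport_energy:
  assumes u: "smooth_bound r M u" and m: "smooth_bound r M m" and mh: "mh \<in> S" and uh: "uh \<in> S"
    and A: "\<And>\<phi>. \<phi> \<in> S \<Longrightarrow> l2_inner u \<phi> + l2_inner (dx u) (deriv \<phi>) = l2_inner m \<phi>"
    and Ah: "\<And>\<phi>. \<phi> \<in> S \<Longrightarrow> l2_inner mh \<phi> = bilin_A uh \<phi>"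
    and p: "p \<in> S" "\<And>\<phi>. \<phi> \<in> S \<Longrightarrow> l2_inner p \<phi> = l2_inner m \<phi>"
    and \<theta>_def: "\<theta> = (\<lambda>x. mh x - p x)" and small: "l2_norm \<theta> \<le> sqrt h"
  shows "transport uh mh \<theta> - l2_inner (\<lambda>x. - u x * dx m x - 2 * dx u x * m x) \<theta>
      \<le> cA M * (l2_norm \<theta>)\<^sup>2 + cb M * (h ^ (r - 1))\<^sup>2" (is ?energy)
    and "l2_norm (\<lambda>x. u x - uh x) \<le> l2_norm \<theta> + cg M * h ^ (r - 1)" (is ?u)
    and "l2_norm (\<lambda>x. dx u x - deriv uh x) \<le> l2_norm \<theta> + cg M * h ^ (r - 1)" (is ?du)
    and "l2_norm (\<lambda>x. m x - mh x) \<le> l2_norm \<theta> + ce * M * h ^ (r - 1)" (is ?m)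
proof -
  have M: "0 \<le> M" using smooth_bound_nonneg[OF u] .
  define H where "H = h ^ (r - 1)"
  define \<tau> where "\<tau> = l2_norm \<theta>"
  have H: "0 \<le> H" "H \<le> sqrt h" using h_pos h_power(3) by (auto simp: H_def)
  have \<tau>: "0 \<le> \<tau>" by (simp add: \<tau>_def)
  have ub: "u \<in> bdd_meas" "dx u \<in> bdd_meas" using pw_deriv_bdd[OF smooth_pw[OF u]] by auto
  have mb: "m \<in> bdd_meas" "dx m \<in> bdd_meas" using pw_deriv_bdd[OF smooth_pw[OF m]] by auto
  have \<theta>: "\<theta> \<in> S" unfolding \<theta>_def by (rule fe_diff[OF mh p(1)])
  note mhb = fe_bdd[OF mh] and uhb = fe_bdd[OF uh] and pb = fe_bdd[OF p(1)] and \<theta>b = fe_bdd[OF \<theta>]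
  note pe = L2_projection_estimates[OF m p]
  have C: "1 \<le> ca" "1 \<le> ce" "1 \<le> cd" "0 < c" using const_bounds by auto
  have "l2_norm (\<lambda>x. m x - mh x) \<le> l2_norm (\<lambda>x. m x - p x) + l2_norm (\<lambda>x. p x - mh x)"
    using mb mhb pb by (intro l2_norm_triangle_diff) auto
  also have "l2_norm (\<lambda>x. p x - mh x) = \<tau>" unfolding \<tau>_def \<theta>_def by (rule l2_norm_minus)
  finally have me: "l2_norm (\<lambda>x. m x - mh x) \<le> \<tau> + ce * M * H" using pe(1) unfolding H_def by linarith
  then show ?m by (simp add: \<tau>_def H_def)
  note ee = elliptic_estimates[OF u mb(1) mh uh A Ah, folded H_def]
  have cgH: "cg M * H = ce * M * H + 3 * ca * M * H" by (simp add: cg_def algebra_simps)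
  have ue: "l2_norm (\<lambda>x. u x - uh x) \<le> \<tau> + cg M * H" using me ee(1) unfolding cgH by linarith
  have due: "l2_norm (\<lambda>x. dx u x - deriv uh x) \<le> \<tau> + cg M * H" using me ee(2) unfolding cgH by linarith
  show ?u ?du using ue due by (simp_all add: \<tau>_def H_def)
  have G0: "0 \<le> cg M" using C M by (simp add: cg_def)
  define P where "P = cd * M"
  define E where "E = ce * M"
  have P0: "0 \<le> P" "0 \<le> E" using C M by (auto simp: P_def E_def)
  \<comment> \<open>Compares \<open>deriv uh\<close> with \<open>dx u\<close>: both
    \<open>l2_norm \<theta>\<close> and \<open>h ^ (r - 1)\<close> are at most
    \<open>sqrt h\<close>, which the inverse estimate divides out.\<close>
  have uhx: "AE x in UI. \<bar>deriv uh x\<bar> \<le> cq M"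
  proof -
    have "AE x in UI. \<bar>deriv uh x\<bar> \<le> c * (l2_norm (\<lambda>x. deriv uh x - dx u x) / sqrt h + M)"
      using u by (intro inv_sup[OF uh ub(2)]) (auto simp: smooth_bound_def)
    moreover have "c * (l2_norm (\<lambda>x. deriv uh x - dx u x) / sqrt h + M) \<le> cq M"
      unfolding cq_def
    proof (intro mult_left_mono add_right_mono)
      have "l2_norm (\<lambda>x. deriv uh x - dx u x) \<le> \<tau> + cg M * H" using due by (subst l2_norm_minus)
      also have "\<dots> \<le> sqrt h + cg M * sqrt h"
        using small H G0 by (intro add_mono mult_left_mono) (auto simp: \<tau>_def)
      finally show "l2_norm (\<lambda>x. deriv uh x - dx u x) / sqrt h \<le> 1 + cg M"
        using h_pos by (simp add: field_simps)
    qed (use C in simp)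
    ultimately show ?thesis by (auto elim!: eventually_mono)
  qed
  have Q0: "0 \<le> cq M" using C G0 M by (simp add: cq_def)
  have d\<theta>: "AE x in UI. deriv \<theta> x = deriv mh x - deriv p x"
    unfolding \<theta>_def by (rule deriv_diff_AE[OF mh p(1)])
  \<comment> \<open>The derivative of \<open>uh * \<theta>\<^sup>2\<close> has integral zero because
    \<open>uh\<close> vanishes at the endpoints.\<close>
  have skew: "l2_inner (\<lambda>x. uh x * deriv \<theta> x) \<theta> = - 1 / 2 * l2_inner (\<lambda>x. deriv uh x * \<theta> x) \<theta>"
  proof -
    have "pw_deriv (\<lambda>x. uh x * (\<theta> x * \<theta> x)) (\<lambda>x. uh x * (\<theta> x * deriv \<theta> x + deriv \<theta> x * \<theta> x) + deriv uh x * (\<theta> x * \<theta> x))"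
      by (intro pw_deriv_mult fe_pw uh \<theta>)
    from pw_deriv_integral[OF this]
    have "(LINT x|UI. uh x * (\<theta> x * deriv \<theta> x + deriv \<theta> x * \<theta> x) + deriv uh x * (\<theta> x * \<theta> x)) = 0"
      using fe_spaceD(3,4)[OF uh] by simp
    also have "(\<lambda>x. uh x * (\<theta> x * deriv \<theta> x + deriv \<theta> x * \<theta> x) + deriv uh x * (\<theta> x * \<theta> x))
        = (\<lambda>x. 2 * (uh x * deriv \<theta> x * \<theta> x) + deriv uh x * \<theta> x * \<theta> x)" by (auto simp: algebra_simps)
    finally have "2 * (LINT x|UI. uh x * deriv \<theta> x * \<theta> x) + (LINT x|UI. deriv uh x * \<theta> x * \<theta> x) = 0"
      using uhb \<theta>b by simp
    then show ?thesis unfolding l2_inner_def by simp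
  qed
  let ?A = "\<lambda>f. l2_inner f \<theta>"
  \<comment> \<open>One replacement at a time: \<open>deriv mh\<close> by
    \<open>deriv \<theta> + deriv p\<close>, then \<open>uh\<close> by \<open>u\<close>, then
    \<open>deriv p\<close> by \<open>dx m\<close>.\<close>
  have e1: "?A (\<lambda>x. uh x * deriv mh x) = ?A (\<lambda>x. uh x * deriv \<theta> x) + ?A (\<lambda>x. deriv p x * (uh x - u x))
      + ?A (\<lambda>x. u x * (deriv p x - dx m x)) + ?A (\<lambda>x. u x * dx m x)"
  proof -
    have "?A (\<lambda>x. uh x * deriv mh x) = ?A (\<lambda>x. uh x * deriv \<theta> x + deriv p x * (uh x - u x)
        + u x * (deriv p x - dx m x) + u x * dx m x)"
    proof (rule l2_cong_AE)
      show "AE x in UI. uh x * deriv mh x = uh x * deriv \<theta> x + deriv p x * (uh x - u x)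
        + u x * (deriv p x - dx m x) + u x * dx m x"
        using d\<theta>
      proof eventually_elim
        case (elim x)
        then have "deriv mh x = deriv \<theta> x + deriv p x" by simp
        then show ?case by (simp only:) (simp add: algebra_simps)
      qed
    qed (use uhb mhb \<theta>b pb ub mb in \<open>auto intro!: bdd_meas_measurable\<close>)
    then show ?thesis using uhb mhb \<theta>b pb ub mb by (simp add: l2_add_left)
  qed
  have e2: "?A (\<lambda>x. deriv uh x * mh x) = ?A (\<lambda>x. deriv uh x * \<theta> x) + ?A (\<lambda>x. p x * (deriv uh x - dx u x))
      + ?A (\<lambda>x. dx u x * (p x - m x)) + ?A (\<lambda>x. dx u x * m x)"
  proof -
    have "?A (\<lambda>x. deriv uh x * mh x) = ?A (\<lambda>x. deriv uh x * \<theta> x + p x * (deriv uh x - dx u x)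
        + dx u x * (p x - m x) + dx u x * m x)"
      by (intro l2_cong) (auto simp: \<theta>_def algebra_simps)
    then show ?thesis using uhb mhb \<theta>b pb ub mb by (simp add: l2_add_left)
  qed
  have e3: "?A (\<lambda>x. - u x * dx m x - 2 * dx u x * m x) = - ?A (\<lambda>x. u x * dx m x) - 2 * ?A (\<lambda>x. dx u x * m x)"
  proof -
    have "?A (\<lambda>x. - u x * dx m x - 2 * dx u x * m x) = ?A (\<lambda>x. (-1) * (u x * dx m x) - 2 * (dx u x * m x))"
      by (intro l2_cong) (auto simp: algebra_simps)
    also have "\<dots> = ?A (\<lambda>x. (-1) * (u x * dx m x)) - ?A (\<lambda>x. 2 * (dx u x * m x))"
      using ub mb \<theta>b by (intro l2_diff_left bdd_meas_cmult bdd_meas_mult)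
    finally show ?thesis by (simp only: l2_cmult_left)
  qed
  have AEu: "AE x in UI. \<bar>u x\<bar> \<le> M" "AE x in UI. \<bar>dx u x\<bar> \<le> M"
    using u by (auto simp: smooth_bound_def intro!: AE_I2)
  have AEp: "AE x in UI. \<bar>p x\<bar> \<le> P" using pe(4) by (auto simp: P_def intro!: AE_I2)
  have t1: "\<bar>?A (\<lambda>x. deriv uh x * \<theta> x)\<bar> \<le> cq M * \<tau> * \<tau>"
    unfolding \<tau>_def using uhx Q0 uhb \<theta>b by (intro l2_inner_mult_le) auto
  have t2: "\<bar>?A (\<lambda>x. deriv p x * (uh x - u x))\<bar> \<le> P * (\<tau> + cg M * H) * \<tau>"
    unfolding \<tau>_def P_def using pe(3) P0 pb uhb ub \<theta>b ue l2_norm_minus[of u uh]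
    by (intro l2_inner_mult_le) (auto simp: P_def \<tau>_def)
  have t3: "\<bar>?A (\<lambda>x. u x * (deriv p x - dx m x))\<bar> \<le> M * (E * H) * \<tau>"
    unfolding \<tau>_def E_def H_def using AEu M pb mb ub \<theta>b pe(2) l2_norm_minus[of "dx m" "deriv p"]
    by (intro l2_inner_mult_le) auto
  have t4: "\<bar>?A (\<lambda>x. p x * (deriv uh x - dx u x))\<bar> \<le> P * (\<tau> + cg M * H) * \<tau>"
    unfolding \<tau>_def using AEp P0 pb uhb ub \<theta>b due l2_norm_minus[of "dx u" "deriv uh"]
    by (intro l2_inner_mult_le) (auto simp: \<tau>_def)
  have t5: "\<bar>?A (\<lambda>x. dx u x * (p x - m x))\<bar> \<le> M * (E * H) * \<tau>"
    unfolding \<tau>_def E_def H_def using AEu M pb mb ub \<theta>b pe(1) l2_norm_minus[of m p]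
    by (intro l2_inner_mult_le) auto
  \<comment> \<open>The factor \<open>3 / 2\<close> is \<open>2\<close> from the second term less
    \<open>1 / 2\<close> from the skew term.\<close>
  have "transport uh mh \<theta> - ?A (\<lambda>x. - u x * dx m x - 2 * dx u x * m x)
      = - 3 / 2 * ?A (\<lambda>x. deriv uh x * \<theta> x) - ?A (\<lambda>x. deriv p x * (uh x - u x))
        - ?A (\<lambda>x. u x * (deriv p x - dx m x)) - 2 * ?A (\<lambda>x. p x * (deriv uh x - dx u x))
        - 2 * ?A (\<lambda>x. dx u x * (p x - m x))"
    unfolding transport_def e1 e2 e3 skew by simp
  also have "\<dots> \<le> 3 / 2 * (cq M * \<tau> * \<tau>) + P * (\<tau> + cg M * H) * \<tau> + M * (E * H) * \<tau>
      + 2 * (P * (\<tau> + cg M * H) * \<tau>) + 2 * (M * (E * H) * \<tau>)"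
    using t1 t2 t3 t4 t5 by linarith
  also have "\<dots> = (3 / 2 * cq M + 3 * P) * \<tau>\<^sup>2 + cb M * (H * \<tau>)"
    by (simp add: cb_def P_def E_def power2_eq_square algebra_simps)
  also have "\<dots> \<le> (3 / 2 * cq M + 3 * P) * \<tau>\<^sup>2 + cb M * (\<tau>\<^sup>2 + H\<^sup>2)"
  proof (intro add_left_mono mult_left_mono)
    have "0 \<le> (\<tau> - H)\<^sup>2 + (\<tau>\<^sup>2 + H\<^sup>2)" by simp
    then show "H * \<tau> \<le> \<tau>\<^sup>2 + H\<^sup>2" by (simp add: power2_eq_square algebra_simps)
    show "0 \<le> cb M" using C M G0 by (simp add: cb_def)
  qed
  also have "\<dots> = cA M * \<tau>\<^sup>2 + cb M * H\<^sup>2" by (simp add: cA_def P_def algebra_simps)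
  finally show ?energy by (simp add: \<tau>_def H_def)
qed

end

section \<open>The semidiscrete problem as a quadratic system\<close>

lemma lin_on_comb: "lin_on S L \<Longrightarrow> lin_on S L' \<Longrightarrow> lin_on S (\<lambda>f. a * L f + b * L' f)"
  unfolding lin_on_def by (simp add: algebra_simps)

text \<open>Both solutions are bounded on the compact interval, so their squared distance satisfies
  a linear differential inequality with zero initial value. Without truncation, this rules out
  competing solutions of any size.\<close>

lemma quadratic_ode_unique:
  fixes a :: "nat \<Rightarrow> nat \<Rightarrow> nat \<Rightarrow> real" and x y :: "real \<Rightarrow> nat \<Rightarrow> real"
  assumes "\<And>i. i < n \<Longrightarrow> x 0 i = y 0 i"
    and x: "\<And>i t. i < n \<Longrightarrow> t \<in> {0..T} \<Longrightarrow>
      ((\<lambda>s. x s i) has_real_derivative (\<Sum>j<n. \<Sum>k<n. a i j k * (x t j * x t k))) (at t within {0..T})"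
    and y: "\<And>i t. i < n \<Longrightarrow> t \<in> {0..T} \<Longrightarrow>
      ((\<lambda>s. y s i) has_real_derivative (\<Sum>j<n. \<Sum>k<n. a i j k * (y t j * y t k))) (at t within {0..T})"
    and t: "t \<in> {0..T}" and i: "i < n"
  shows "x t i = y t i"
proof -
  have "\<exists>R. \<forall>s\<in>{0..T}. \<bar>x s j\<bar> \<le> R \<and> \<bar>y s j\<bar> \<le> R" if "j < n" for j
  proof -
    have "continuous_on {0..T} (\<lambda>s. x s j)" by (rule DERIV_continuous_on[OF x[OF that]])
    moreover have "continuous_on {0..T} (\<lambda>s. y s j)" by (rule DERIV_continuous_on[OF y[OF that]])
    ultimately have "bounded ((\<lambda>s. x s j) ` {0..T})" "bounded ((\<lambda>s. y s j) ` {0..T})"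
      by (auto intro!: compact_imp_bounded compact_continuous_image)
    then obtain R1 R2 where "\<forall>s\<in>{0..T}. \<bar>x s j\<bar> \<le> R1" "\<forall>s\<in>{0..T}. \<bar>y s j\<bar> \<le> R2"
      unfolding bounded_iff by auto
    then show ?thesis by (intro exI[of _ "max R1 R2"]) (simp add: le_max_iff_disj)
  qed
  then obtain Rj where Rj: "\<And>j s. j < n \<Longrightarrow> s \<in> {0..T} \<Longrightarrow> \<bar>x s j\<bar> \<le> Rj j \<and> \<bar>y s j\<bar> \<le> Rj j" by metis
  define R where "R = (\<Sum>j<n. \<bar>Rj j\<bar>)"
  have R: "\<bar>x s j\<bar> \<le> R" "\<bar>y s j\<bar> \<le> R" if "j < n" "s \<in> {0..T}" for j s
  proof -
    have "\<bar>Rj j\<bar> \<le> R" unfolding R_def using that by (intro member_le_sum) auto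
    then show "\<bar>x s j\<bar> \<le> R" "\<bar>y s j\<bar> \<le> R" using Rj[OF that] by auto
  qed
  define \<delta> where "\<delta> s j = x s j - y s j" for s j
  define f where "f s = (\<Sum>i<n. (\<delta> s i)\<^sup>2)" for s
  have \<delta>f: "\<bar>\<delta> s i\<bar> * \<bar>\<delta> s j\<bar> \<le> f s" if "i < n" "j < n" for s i j
  proof -
    have "(\<delta> s i)\<^sup>2 \<le> f s" "(\<delta> s j)\<^sup>2 \<le> f s" unfolding f_def using that by (auto intro!: member_le_sum)
    moreover have "0 \<le> (\<bar>\<delta> s i\<bar> - \<bar>\<delta> s j\<bar>)\<^sup>2" by simp
    then have "2 * (\<bar>\<delta> s i\<bar> * \<bar>\<delta> s j\<bar>) \<le> (\<delta> s i)\<^sup>2 + (\<delta> s j)\<^sup>2" by (simp add: power2_diff)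
    ultimately show ?thesis by linarith
  qed
  define F where "F s i = (\<Sum>j<n. \<Sum>k<n. a i j k * (x s j * x s k - y s j * y s k))" for s i
  have Fd: "((\<lambda>s. \<delta> s i) has_real_derivative F s i) (at s within {0..T})" if "i < n" "s \<in> {0..T}" for s i
    unfolding \<delta>_def F_def using DERIV_diff[OF x[OF that] y[OF that]]
    by (simp add: right_diff_distrib sum_subtractf)
  have fd: "(f has_real_derivative (\<Sum>i<n. 2 * \<delta> s i * F s i)) (at s within {0..T})" if "s \<in> {0..T}" for s
    unfolding f_def using Fd[OF _ that]
    by (intro DERIV_sum) (auto intro!: derivative_eq_intros)
  define B where "B = (\<Sum>i<n. \<Sum>j<n. \<Sum>k<n. 2 * \<bar>a i j k\<bar> * (2 * R))"
  have R0: "0 \<le> R" by (simp add: R_def sum_nonneg)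
  have B0: "0 \<le> B" unfolding B_def using R0 by (intro sum_nonneg) auto
  have le: "(\<Sum>i<n. 2 * \<delta> s i * F s i) \<le> B * f s + 0" if s: "s \<in> {0..T}" for s
  proof -
    have "2 * \<delta> s i * F s i \<le> (\<Sum>j<n. \<Sum>k<n. 2 * \<bar>a i j k\<bar> * (2 * R)) * f s" if i: "i < n" for i
    proof -
      have "2 * \<delta> s i * F s i = (\<Sum>j<n. \<Sum>k<n. 2 * \<delta> s i * (a i j k * (x s j * x s k - y s j * y s k)))"
        by (simp add: F_def sum_distrib_left)
      also have "\<dots> \<le> (\<Sum>j<n. \<Sum>k<n. 2 * \<bar>a i j k\<bar> * (2 * R) * f s)"
      proof (intro sum_mono)
        fix j k assume "j \<in> {..<n}" "k \<in> {..<n}"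
        then have jk: "j < n" "k < n" by auto
        have "x s j * x s k - y s j * y s k = \<delta> s j * x s k + y s j * \<delta> s k"
          by (simp add: \<delta>_def algebra_simps)
        then have "\<bar>\<delta> s i\<bar> * \<bar>x s j * x s k - y s j * y s k\<bar> \<le> \<bar>\<delta> s i\<bar> * (\<bar>\<delta> s j\<bar> * \<bar>x s k\<bar> + \<bar>y s j\<bar> * \<bar>\<delta> s k\<bar>)"
          by (intro mult_left_mono) (metis abs_mult abs_triangle_ineq, simp)
        also have "\<dots> \<le> \<bar>\<delta> s i\<bar> * (\<bar>\<delta> s j\<bar> * R + R * \<bar>\<delta> s k\<bar>)"
          using R jk s by (intro mult_left_mono add_mono mult_mono) (auto intro: R0)
        also have "\<dots> = R * (\<bar>\<delta> s i\<bar> * \<bar>\<delta> s j\<bar>) + R * (\<bar>\<delta> s i\<bar> * \<bar>\<delta> s k\<bar>)" by (simp add: algebra_simps)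
        also have "\<dots> \<le> R * f s + R * f s" using \<delta>f i jk R0 by (intro add_mono mult_left_mono) auto
        finally have q: "\<bar>\<delta> s i\<bar> * \<bar>x s j * x s k - y s j * y s k\<bar> \<le> 2 * R * f s" by simp
        have "2 * \<delta> s i * (a i j k * (x s j * x s k - y s j * y s k))
            \<le> \<bar>2 * \<delta> s i * (a i j k * (x s j * x s k - y s j * y s k))\<bar>" by (rule abs_ge_self)
        also have "\<dots> = 2 * \<bar>a i j k\<bar> * (\<bar>\<delta> s i\<bar> * \<bar>x s j * x s k - y s j * y s k\<bar>)"
          by (simp add: abs_mult)
        also have "\<dots> \<le> 2 * \<bar>a i j k\<bar> * (2 * R * f s)" using q by (intro mult_left_mono) auto
        finally show "2 * \<delta> s i * (a i j k * (x s j * x s k - y s j * y s k)) \<le> 2 * \<bar>a i j k\<bar> * (2 * R) * f s"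
          by (simp add: mult.assoc)
      qed
      finally show ?thesis by (simp add: sum_distrib_right)
    qed
    then have "(\<Sum>i<n. 2 * \<delta> s i * F s i) \<le> (\<Sum>i<n. (\<Sum>j<n. \<Sum>k<n. 2 * \<bar>a i j k\<bar> * (2 * R)) * f s)"
      by (intro sum_mono) auto
    then show ?thesis by (simp add: B_def sum_distrib_right)
  qed
  have "f t \<le> (f 0 + 0 * t) * exp (B * t)"
  proof (rule Gronwall[OF _ B0])
    fix s assume s: "s \<in> {0..t}"
    then have sT: "s \<in> {0..T}" using t by auto
    show "(f has_real_derivative (\<Sum>i<n. 2 * \<delta> s i * F s i)) (at s within {0..t})"
      by (rule DERIV_subset[OF fd[OF sT]]) (use t in auto)
    show "(\<Sum>i<n. 2 * \<delta> s i * F s i) \<le> B * f s + 0" by (rule le[OF sT])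
  qed (use t in auto)
  then have "f t \<le> 0" using assms(1) by (simp add: f_def \<delta>_def)
  moreover have "(\<delta> t i)\<^sup>2 \<le> f t" unfolding f_def using i by (intro member_le_sum) auto
  ultimately have "(\<delta> t i)\<^sup>2 \<le> 0" by linarith
  then show ?thesis by (simp add: \<delta>_def)
qed

context fe_mesh
begin

text \<open>Each form isolates one argument, so that linearity in it reduces to that of
  \<open>l2_inner\<close>, with or without a derivative.\<close>

lemma transport_eqs:
  "transport u m \<psi> = (-1) * l2_inner u (\<lambda>x. deriv m x * \<psi> x) + (-2) * l2_inner (deriv u) (\<lambda>x. m x * \<psi> x)"
  "transport u m \<psi> = (-1) * l2_inner (deriv m) (\<lambda>x. u x * \<psi> x) + (-2) * l2_inner m (\<lambda>x. deriv u x * \<psi> x)"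
  "transport u m \<psi> = (-1) * l2_inner \<psi> (\<lambda>x. u x * deriv m x) + (-2) * l2_inner \<psi> (\<lambda>x. deriv u x * m x)"
  unfolding transport_def l2_inner_def by (simp_all add: ac_simps)

lemma transport_lin:
  assumes "u \<in> S" "m \<in> S" "\<psi> \<in> S"
  shows "lin_on S (\<lambda>u. transport u m \<psi>)" "lin_on S (\<lambda>m. transport u m \<psi>)" "lin_on S (\<lambda>\<psi>. transport u m \<psi>)"
proof -
  show "lin_on S (\<lambda>u. transport u m \<psi>)" unfolding transport_eqs(1)
    using assms by (intro lin_on_comb l2_lin l2_deriv_lin) auto
  show "lin_on S (\<lambda>m. transport u m \<psi>)" unfolding transport_eqs(2)
    using assms by (intro lin_on_comb l2_lin l2_deriv_lin) auto
  show "lin_on S (\<lambda>\<psi>. transport u m \<psi>)" unfolding transport_eqs(3)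
    using assms by (intro lin_on_comb l2_lin) auto
qed

lemma fe_deriv_cong_AE:
  assumes "f \<in> S" "g \<in> S" "\<And>x. x \<in> {0..1} \<Longrightarrow> f x = g x"
  shows "AE x in UI. deriv f x = deriv g x"
  by (rule pw_deriv_unique[OF pw_deriv_cong[OF fe_pw[OF assms(1)] assms(3)] fe_pw[OF assms(2)]])

lemma transport_cong:
  assumes S: "u \<in> S" "u' \<in> S" "m \<in> S" "m' \<in> S" "\<psi> \<in> S"
    and u: "\<And>x. x \<in> {0..1} \<Longrightarrow> u x = u' x" and m: "\<And>x. x \<in> {0..1} \<Longrightarrow> m x = m' x"
  shows "transport u m \<psi> = transport u' m' \<psi>"
proof -
  have AE: "AE x in UI. u x = u' x" "AE x in UI. m x = m' x" using u m by (auto intro!: AE_I2)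
  have "l2_inner (\<lambda>x. u x * deriv m x) \<psi> = l2_inner (\<lambda>x. u' x * deriv m' x) \<psi>"
    using fe_deriv_cong_AE[OF S(3,4) m] AE(1) S
    by (intro l2_cong_AE) (auto elim!: eventually_elim2 intro!: bdd_meas_measurable)
  moreover have "l2_inner (\<lambda>x. deriv u x * m x) \<psi> = l2_inner (\<lambda>x. deriv u' x * m' x) \<psi>"
    using fe_deriv_cong_AE[OF S(1,2) u] AE(2) S
    by (intro l2_cong_AE) (auto elim!: eventually_elim2 intro!: bdd_meas_measurable)
  ultimately show ?thesis by (simp add: transport_def)
qed

lemma transport_wderiv:
  assumes "u \<in> S" "m \<in> S" "\<psi> \<in> S"
  shows "transport u m \<psi> = - l2_inner (\<lambda>x. u x * wderiv m x) \<psi> - 2 * l2_inner (\<lambda>x. wderiv u x * m x) \<psi>"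
proof -
  have "l2_inner (\<lambda>x. wderiv m x * u x) \<psi> = l2_inner (\<lambda>x. deriv m x * u x) \<psi>"
    "l2_inner (\<lambda>x. wderiv u x * m x) \<psi> = l2_inner (\<lambda>x. deriv u x * m x) \<psi>"
    using assms by (auto intro!: l2_wderiv_left fe_pw bdd_meas_measurable)
  then show ?thesis by (simp add: transport_def mult.commute)
qed

end

text \<open>\<open>g i\<close> solves the discrete elliptic problem with datum \<open>e i\<close>.
  By linearity the coordinates of \<open>m_h\<close> determine \<open>u_h\<close>, and the
  semidiscrete problem becomes a quadratic system in these coordinates alone.\<close>

locale galerkin = fe_mesh +
  fixes n :: nat and e g :: "nat \<Rightarrow> real \<Rightarrow> real"
  assumes onb: "onb S l2_inner n e" and g: "i < n \<Longrightarrow> g i \<in> S"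
    and Ag: "i < n \<Longrightarrow> \<phi> \<in> S \<Longrightarrow> bilin_A (g i) \<phi> = l2_inner (e i) \<phi>"
begin

definition mf :: "(nat \<Rightarrow> real) \<Rightarrow> real \<Rightarrow> real" where "mf y = (\<lambda>x. \<Sum>i<n. y i * e i x)"
definition uf :: "(nat \<Rightarrow> real) \<Rightarrow> real \<Rightarrow> real" where "uf y = (\<lambda>x. \<Sum>i<n. y i * g i x)"
definition coef :: "nat \<Rightarrow> nat \<Rightarrow> nat \<Rightarrow> real" where "coef i j k = transport (g j) (e k) (e i)"

lemma e: "i < n \<Longrightarrow> e i \<in> S" "i < n \<Longrightarrow> j < n \<Longrightarrow> l2_inner (e i) (e j) = (if i = j then 1 else 0)"
  using onb by (auto simp: onb_def)

lemma mf_S: "mf y \<in> S" and uf_S: "uf y \<in> S"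
  unfolding mf_def uf_def by (auto intro!: lin_set_sum[OF fe_lin] e g)

lemma mf_expand: "f \<in> S \<Longrightarrow> x \<in> {0..1} \<Longrightarrow> f x = mf (\<lambda>i. l2_inner f (e i)) x"
  using onb unfolding onb_def mf_def by blast

lemma lin_mf: "lin_on S L \<Longrightarrow> L (mf y) = (\<Sum>i<n. y i * L (e i))"
  unfolding mf_def by (intro lin_on_sum[OF fe_lin] e)

lemma lin_uf: "lin_on S L \<Longrightarrow> L (uf y) = (\<Sum>i<n. y i * L (g i))"
  unfolding uf_def by (intro lin_on_sum[OF fe_lin] g)

lemma l2_mf: "f \<in> bdd_meas \<Longrightarrow> l2_inner (mf y) f = (\<Sum>i<n. y i * l2_inner (e i) f)"
  by (rule lin_mf[OF l2_lin])

lemma l2_mf_e: "i < n \<Longrightarrow> l2_inner (mf y) (e i) = y i"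
proof -
  assume i: "i < n"
  have "l2_inner (mf y) (e i) = (\<Sum>j<n. if j = i then y j else 0)"
    unfolding l2_mf[OF fe_bdd(1)[OF e(1)[OF i]]] using i by (intro sum.cong) (auto simp: e)
  then show ?thesis using i by simp
qed

lemma l2_mf_mf: "l2_inner (mf y) (mf y) = (\<Sum>i<n. (y i)\<^sup>2)"
  unfolding l2_mf[OF fe_bdd(1)[OF mf_S]]
  by (intro sum.cong) (auto simp: l2_commute[of "e _"] l2_mf_e power2_eq_square)

lemma mf_uf: "\<phi> \<in> S \<Longrightarrow> l2_inner (mf y) \<phi> = bilin_A (uf y) \<phi>"
proof -
  assume \<phi>: "\<phi> \<in> S"
  have "lin_on S (\<lambda>f. bilin_A f \<phi>)" using ip_A \<phi> by (simp add: ip_on_def)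
  from lin_uf[OF this] have "bilin_A (uf y) \<phi> = (\<Sum>i<n. y i * bilin_A (g i) \<phi>)" .
  then show ?thesis using \<phi> by (simp add: l2_mf Ag)
qed

lemma l2_projection_mf:
  assumes v: "v \<in> bdd_meas" and y: "\<And>i. i < n \<Longrightarrow> y i = l2_inner v (e i)" and \<phi>: "\<phi> \<in> S"
  shows "l2_inner (mf y) \<phi> = l2_inner v \<phi>"
proof -
  have "l2_inner \<phi> v = (\<Sum>i<n. l2_inner \<phi> (e i) * l2_inner (e i) v)"
    by (rule onb_expand[OF fe_lin ip_l2 onb l2_lin[OF v] l2_zero \<phi>])
  also have "\<dots> = (\<Sum>i<n. y i * l2_inner (e i) \<phi>)"
    using y by (intro sum.cong) (auto simp: l2_commute mult.commute)
  also have "\<dots> = l2_inner (mf y) \<phi>" using \<phi> by (simp add: l2_mf)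
  finally show ?thesis by (simp add: l2_commute)
qed

lemma transport_coef:
  assumes "i < n"
  shows "transport (uf y) (mf y) (e i) = (\<Sum>j<n. \<Sum>k<n. coef i j k * (y j * y k))"
proof -
  have "transport (uf y) (mf y) (e i) = (\<Sum>j<n. y j * transport (g j) (mf y) (e i))"
    by (rule lin_uf[OF transport_lin(1)]) (use assms e mf_S in auto)
  also have "\<dots> = (\<Sum>j<n. y j * (\<Sum>k<n. y k * transport (g j) (e k) (e i)))"
    using assms e g by (intro sum.cong refl arg_cong2[of _ _ _ _ "(*)"] lin_mf[OF transport_lin(2)]) auto
  finally show ?thesis by (simp add: coef_def sum_distrib_left ac_simps)
qed

lemma transport_expand:
  assumes "u \<in> S" "m \<in> S" "\<psi> \<in> S"
  shows "transport u m \<psi> = (\<Sum>i<n. l2_inner \<psi> (e i) * transport u m (e i))"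
proof (rule onb_expand[OF fe_lin ip_l2 onb transport_lin(3)[OF assms] _ assms(3)])
  fix f assume f: "f \<in> S" "\<And>x. x \<in> {0..1} \<Longrightarrow> f x = 0"
  show "transport u m f = 0" unfolding transport_eqs(3) using l2_zero[OF f(2)] by simp
qed

lemma uf_unique:
  assumes f: "f \<in> S" and u: "u \<in> S" "\<And>\<phi>. \<phi> \<in> S \<Longrightarrow> l2_inner f \<phi> = bilin_A u \<phi>" and x: "x \<in> {0..1}"
  shows "u x = uf (\<lambda>i. l2_inner f (e i)) x"
proof -
  let ?u = "uf (\<lambda>i. l2_inner f (e i))"
  let ?d = "\<lambda>x. 1 * u x + (-1) * ?u x"
  have dS: "?d \<in> S" by (rule fe_lincomb[OF u(1) uf_S])
  have "lin_on S (\<lambda>f. bilin_A f ?d)" using ip_A dS by (simp add: ip_on_def)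
  from lin_onD[OF this u(1) uf_S, of 1 "-1"]
  have "bilin_A ?d ?d = bilin_A u ?d - bilin_A ?u ?d" by simp
  also have "\<dots> = l2_inner f ?d - l2_inner (mf (\<lambda>i. l2_inner f (e i))) ?d"
    unfolding u(2)[OF dS, symmetric] mf_uf[OF dS] ..
  also have "\<dots> = 0" using l2_projection_mf[OF fe_bdd(1)[OF f] refl dS] by simp
  finally have "?d x = 0" using ip_A dS x unfolding ip_on_def by blast
  then show ?thesis by simp
qed

lemma dt_eqI:
  assumes "0 < T" "t \<in> {0..T}" "((\<lambda>s. v s x) has_real_derivative d) (at t within {0..T})"
  shows "dt T v t x = d"
  unfolding dt_def using vector_derivative_within_cbox[of 0 T t "\<lambda>s. v s x" d] assms
  by (simp add: has_real_derivative_iff_has_vector_derivative)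

lemma mf_has_derivative:
  assumes "\<And>i. i < n \<Longrightarrow> ((\<lambda>s. y s i) has_real_derivative d i) (at t within A)"
  shows "((\<lambda>s. mf (y s) x) has_real_derivative mf d x) (at t within A)"
  unfolding mf_def using assms by (intro DERIV_sum DERIV_cmult_right) auto

lemma ode_solution:
  assumes T: "0 < T"
    and y: "\<And>i t. i < n \<Longrightarrow> t \<in> {0..T} \<Longrightarrow>
      ((\<lambda>s. y s i) has_real_derivative (\<Sum>j<n. \<Sum>k<n. coef i j k * (y t j * y t k))) (at t within {0..T})"
    and v: "v \<in> bdd_meas" "\<And>x. x \<in> {0..1} \<Longrightarrow> u0 x - dx (dx u0) x = v x"
    and y0: "\<And>i. i < n \<Longrightarrow> y 0 i = l2_inner v (e i)"
    and A0: "\<And>\<phi>. \<phi> \<in> S \<Longrightarrow> bilin_A u0 \<phi> = l2_inner v \<phi>"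
  shows "semidiscrete_solution S T u0 (\<lambda>t. mf (y t)) (\<lambda>t. uf (y t))"
  unfolding semidiscrete_solution_def
proof (intro conjI ballI)
  fix t assume t: "t \<in> {0..T}"
  define d where "d i = (\<Sum>j<n. \<Sum>k<n. coef i j k * (y t j * y t k))" for i
  have D: "((\<lambda>s. mf (y s) x) has_real_derivative mf d x) (at t within {0..T})" for x
    using y[OF _ t] unfolding d_def by (rule mf_has_derivative)
  show "(\<lambda>s. mf (y s) x) differentiable (at t within {0..T})" for x
    using D[of x] by (auto simp: has_field_derivative_def intro: differentiableI)
  fix \<psi> assume \<psi>: "\<psi> \<in> S"
  have "l2_inner (dt T (\<lambda>t. mf (y t)) t) \<psi> = l2_inner (mf d) \<psi>"
    using dt_eqI[OF T t D] by (intro l2_cong) auto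
  also have "\<dots> = (\<Sum>i<n. l2_inner \<psi> (e i) * d i)"
    using \<psi> by (subst l2_mf) (auto simp: l2_commute[of \<psi>] mult.commute)
  also have "\<dots> = (\<Sum>i<n. l2_inner \<psi> (e i) * transport (uf (y t)) (mf (y t)) (e i))"
    by (intro sum.cong) (auto simp: transport_coef d_def)
  also have "\<dots> = transport (uf (y t)) (mf (y t)) \<psi>"
    by (rule transport_expand[OF uf_S mf_S \<psi>, symmetric])
  also have "\<dots> = - l2_inner (\<lambda>x. uf (y t) x * wderiv (mf (y t)) x) \<psi> - 2 * l2_inner (\<lambda>x. wderiv (uf (y t)) x * mf (y t) x) \<psi>"
    by (rule transport_wderiv[OF uf_S mf_S \<psi>])
  finally show "l2_inner (dt T (\<lambda>t. mf (y t)) t) \<psi> = - l2_inner (\<lambda>x. uf (y t) x * wderiv (mf (y t)) x) \<psi>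
      - 2 * l2_inner (\<lambda>x. wderiv (uf (y t)) x * mf (y t) x) \<psi>" .
next
  have p: "l2_inner (mf (y 0)) \<phi> = l2_inner v \<phi>" if "\<phi> \<in> S" for \<phi>
    by (rule l2_projection_mf[OF v(1) y0 that])
  have "l2_inner (\<lambda>x. u0 x - dx (dx u0) x) \<phi> = l2_inner v \<phi>" for \<phi>
    using v(2) by (intro l2_cong) auto
  then show "is_L2_projection S (\<lambda>x. u0 x - dx (dx u0) x) (mf (y 0))"
    using p mf_S by (simp add: is_L2_projection_def)
  \<comment> \<open>By \<open>A0\<close>, the elliptic projection of \<open>u0\<close> is the
    discrete solution with datum \<open>mf (y 0)\<close>, so the two initial conditions are
    compatible.\<close>
  show "is_elliptic_projection S u0 (uf (y 0))"
    using p A0 uf_S mf_uf by (simp add: is_elliptic_projection_def)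
qed (use mf_S uf_S mf_uf in auto)

text \<open>The converse of \<open>ode_solution\<close>, needed for uniqueness: every semidiscrete
  solution is governed by the same system.\<close>

lemma solution_ode:
  assumes T: "0 < T" and sol: "semidiscrete_solution S T u0 mh uh"
    and v: "\<And>x. x \<in> {0..1} \<Longrightarrow> u0 x - dx (dx u0) x = v x"
  defines "y \<equiv> (\<lambda>t i. l2_inner (mh t) (e i))"
  shows "\<And>i t. i < n \<Longrightarrow> t \<in> {0..T} \<Longrightarrow>
      ((\<lambda>s. y s i) has_real_derivative (\<Sum>j<n. \<Sum>k<n. coef i j k * (y t j * y t k))) (at t within {0..T})"
    and "\<And>i. i < n \<Longrightarrow> y 0 i = l2_inner v (e i)"
    and "\<And>t x. t \<in> {0..T} \<Longrightarrow> x \<in> {0..1} \<Longrightarrow> mh t x = mf (y t) x"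
    and "\<And>t x. t \<in> {0..T} \<Longrightarrow> x \<in> {0..1} \<Longrightarrow> uh t x = uf (y t) x"
proof -
  have S: "mh t \<in> S" "uh t \<in> S" if "t \<in> {0..T}" for t
    using sol that by (auto simp: semidiscrete_solution_def)
  show M: "mh t x = mf (y t) x" if "t \<in> {0..T}" "x \<in> {0..1}" for t x
    unfolding y_def using mf_expand[OF S(1)] that by blast
  show U: "uh t x = uf (y t) x" if "t \<in> {0..T}" "x \<in> {0..1}" for t x
    unfolding y_def using S[OF that(1)] sol that
    by (intro uf_unique) (auto simp: semidiscrete_solution_def)
  show "y 0 i = l2_inner v (e i)" if "i < n" for i
  proof -
    have "y 0 i = l2_inner (\<lambda>x. u0 x - dx (dx u0) x) (e i)"
      using sol e that by (simp add: y_def semidiscrete_solution_def is_L2_projection_def)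
    also have "\<dots> = l2_inner v (e i)" using v by (intro l2_cong) auto
    finally show ?thesis .
  qed
  fix i t assume i: "i < n" and t: "t \<in> {0..T}"
  \<comment> \<open>The inner product with \<open>e i\<close> is a finite combination of point
    values, so pointwise differentiability in time carries over to it.\<close>
  have "\<exists>d. ((\<lambda>s. y s i) has_real_derivative d) (at t within {0..T})" if i: "i < n" for i
  proof (rule fe_functional[OF l2_lin[OF fe_bdd(1)[OF e(1)[OF i]]] l2_zero])
    fix X \<beta> assume X: "finite X" "X \<subseteq> {0..1}" "\<And>f. f \<in> S \<Longrightarrow> l2_inner f (e i) = (\<Sum>x\<in>X. \<beta> x * f x)"
    have "((\<lambda>s. mh s x) has_real_derivative dt T mh t x) (at t within {0..T})" if "x \<in> X" for x
      using sol t X(2) that unfolding semidiscrete_solution_def dt_def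
      by (auto simp: has_real_derivative_iff_has_vector_derivative vector_derivative_works[symmetric])
    then have "((\<lambda>s. \<Sum>x\<in>X. \<beta> x * mh s x) has_real_derivative (\<Sum>x\<in>X. \<beta> x * dt T mh t x)) (at t within {0..T})"
      by (intro DERIV_sum DERIV_cmult)
    then have "((\<lambda>s. y s i) has_real_derivative (\<Sum>x\<in>X. \<beta> x * dt T mh t x)) (at t within {0..T})"
      by (rule has_field_derivative_transform_within[of _ _ _ _ 1]) (use t X(3) S in \<open>auto simp: y_def\<close>)
    then show ?thesis by blast
  qed
  then obtain d where d: "\<And>i. i < n \<Longrightarrow> ((\<lambda>s. y s i) has_real_derivative d i) (at t within {0..T})" by metis
  \<comment> \<open>The derivatives \<open>d i\<close> exist but are unknown so far; testing the
    time derivative with \<open>e i\<close> identifies them.\<close>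
  have "dt T mh t x = mf d x" if x: "x \<in> {0..1}" for x
  proof (rule dt_eqI[OF T t])
    show "((\<lambda>s. mh s x) has_real_derivative mf d x) (at t within {0..T})"
      by (rule has_field_derivative_transform_within[OF mf_has_derivative[OF d], of _ 1])
        (use t M x in auto)
  qed
  then have "d i = l2_inner (dt T mh t) (e i)"
    using l2_cong[of "dt T mh t" "mf d" "e i" "e i"] l2_mf_e[OF i, of d] by simp
  also have "\<dots> = transport (uh t) (mh t) (e i)"
    using sol t e(1)[OF i] transport_wderiv[OF S(2)[OF t] S(1)[OF t] e(1)[OF i]]
    by (simp add: semidiscrete_solution_def)
  also have "\<dots> = transport (uf (y t)) (mf (y t)) (e i)"
    by (rule transport_cong) (use S t e(1)[OF i] uf_S mf_S M U in auto)
  also have "\<dots> = (\<Sum>j<n. \<Sum>k<n. coef i j k * (y t j * y t k))" by (rule transport_coef[OF i])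
  finally show "((\<lambda>s. y s i) has_real_derivative (\<Sum>j<n. \<Sum>k<n. coef i j k * (y t j * y t k))) (at t within {0..T})"
    using d[OF i] by simp
qed

end

lemma (in fe_mesh) galerkin_exists: obtains n e g where "galerkin r \<mu> N z n e g"
proof -
  obtain n e where e: "onb S l2_inner n e" using fe_onb[OF ip_l2] by blast
  have eS: "e i \<in> S" if "i < n" for i using e that by (simp add: onb_def)
  have "\<exists>w\<in>S. \<forall>\<phi>\<in>S. bilin_A w \<phi> = l2_inner (e i) \<phi>" if i: "i < n" for i
  proof (rule fe_Riesz[OF ip_A l2_lin[OF fe_bdd(1)[OF eS[OF i]]] l2_zero])
    fix w assume "w \<in> S" "\<And>f. f \<in> S \<Longrightarrow> bilin_A w f = l2_inner f (e i)"
    then show ?thesis by (auto simp: l2_commute)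
  qed
  then obtain g where "\<And>i. i < n \<Longrightarrow> g i \<in> S \<and> (\<forall>\<phi>\<in>S. bilin_A (g i) \<phi> = l2_inner (e i) \<phi>)" by metis
  then have "galerkin r \<mu> N z n e g" by unfold_locales (use e in auto)
  then show thesis by (rule that)
qed

section \<open>The error estimate\<close>

lemma continuous_on_slice:
  assumes "continuous_on (A \<times> B) (\<lambda>(t, x). F t x)" "t \<in> A"
  shows "continuous_on B (F t)"
proof -
  have "continuous_on B (\<lambda>x. (t, x))" by (intro continuous_intros)
  from continuous_on_compose2[OF assms(1) this] show ?thesis using assms(2) by auto
qed

context qu_mesh
begin

text \<open>\<open>cW\<close> is the Gronwall factor for the squared norm of
  \<open>\<theta>\<close>. In \<open>cE\<close>, \<open>\<theta>\<close> enters three times, through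
  \<open>m\<close>, \<open>u\<close> and \<open>u_x\<close>; \<open>ce\<close> belongs to the
  projection of \<open>m\<close>, \<open>cg\<close> to \<open>u\<close> and
  \<open>u_x\<close>.\<close>

definition cW :: "real \<Rightarrow> real \<Rightarrow> real" where "cW M T = 2 * cb M * T * exp (2 * cA M * T)"
definition cE :: "real \<Rightarrow> real \<Rightarrow> real" where "cE M T = ce * M + 3 * sqrt (cW M T) + 2 * cg M"

lemma energy_consts:
  assumes "0 \<le> M" shows "0 \<le> cg M" "0 \<le> cb M" "0 \<le> cA M"
proof -
  have C: "0 \<le> ca" "0 \<le> ce" "0 \<le> cd" "0 \<le> c" using const_bounds by auto
  show g: "0 \<le> cg M" using C assms by (simp add: cg_def)
  then show b: "0 \<le> cb M" using C assms by (simp add: cb_def)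
  show "0 \<le> cA M" using C assms g b by (simp add: cA_def cq_def)
qed

lemma semidiscrete_error:
  fixes T M :: real
  assumes T: "0 < T"
    and u: "\<And>t. t \<in> {0..T} \<Longrightarrow> smooth_bound r M (u t)"
    and m: "\<And>t. t \<in> {0..T} \<Longrightarrow> smooth_bound r M (m t)"
    and A: "\<And>t \<phi>. t \<in> {0..T} \<Longrightarrow> \<phi> \<in> S \<Longrightarrow>
      l2_inner (u t) \<phi> + l2_inner (dx (u t)) (deriv \<phi>) = l2_inner (m t) \<phi>"
    and mt: "\<And>t x. t \<in> {0..T} \<Longrightarrow> x \<in> {0..1} \<Longrightarrow>
      ((\<lambda>s. m s x) has_vector_derivative mt t x) (at t within {0..T})"
    and mtc: "continuous_on ({0..T} \<times> {0..1}) (\<lambda>(t, x). mt t x)"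
    and pde: "\<And>t x. t \<in> {0..T} \<Longrightarrow> x \<in> {0..1} \<Longrightarrow>
      mt t x = - u t x * dx (m t) x - 2 * dx (u t) x * m t x"
    and u0: "\<And>x. x \<in> {0..1} \<Longrightarrow> u0 x - dx (dx u0) x = m 0 x"
    and A0: "\<And>\<phi>. \<phi> \<in> S \<Longrightarrow> bilin_A u0 \<phi> = l2_inner (m 0) \<phi>"
    and hW: "cW M T * h < 1"
  shows "\<exists>mh uh. semidiscrete_solution S T u0 mh uh \<and>
     (\<forall>mh' uh'. semidiscrete_solution S T u0 mh' uh' \<longrightarrow>
        (\<forall>t\<in>{0..T}. \<forall>x\<in>{0..1}. mh' t x = mh t x \<and> uh' t x = uh t x)) \<and>
     (\<forall>t\<in>{0..T}. l2_norm (\<lambda>x. m t x - mh t x) + h1_norm (\<lambda>x. u t x - uh t x) \<le> cE M T * h ^ (r - 1))"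
proof -
  obtain n e g where gal: "galerkin r \<mu> N z n e g" by (rule galerkin_exists)
  interpret galerkin r \<mu> N z n e g by (rule gal)
  have T0: "0 \<in> {0..T}" using T by simp
  have M: "0 \<le> M" using smooth_bound_nonneg[OF u[OF T0]] .
  note K = energy_consts[OF M]
  define H where "H = h ^ (r - 1)"
  have H: "0 \<le> H" "H \<le> h" using h_pos h_power(2) by (auto simp: H_def)
  have mc: "continuous_on {0..1} (m t)" if "t \<in> {0..T}" for t
    using pw_deriv_cont[OF smooth_pw[OF m[OF that]]] .
  have mb: "m t \<in> bdd_meas" if "t \<in> {0..T}" for t using mc[OF that] by simp
  have mtx: "continuous_on {0..1} (mt t)" if "t \<in> {0..T}" for t
    by (rule continuous_on_slice[OF mtc that])
  have W0: "0 \<le> cW M T" using K T by (simp add: cW_def)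
  \<comment> \<open>Coordinates of the \<open>L2\<close> projection of \<open>m t\<close>; their
    time derivative is found by differentiating under the integral sign.\<close>
  define b where "b t i = l2_inner (m t) (e i)" for t i
  have bd: "((\<lambda>s. b s i) has_real_derivative l2_inner (mt t) (e i)) (at t within {0..T})"
    if i: "i < n" and t: "t \<in> {0..T}" for i t
  proof -
    have ec: "continuous_on {0..1} (e i)" using fe_spaceD(2)[OF e(1)[OF i]] .
    have "((\<lambda>s. integral (cbox 0 1) (\<lambda>x. m s x * e i x)) has_vector_derivative
        integral (cbox 0 1) (\<lambda>x. mt t x * e i x)) (at t within {0..T})"
    proof (rule leibniz_rule_vector_derivative)
      show "((\<lambda>s. m s x * e i x) has_vector_derivative mt s x * e i x) (at s within {0..T})"
        if "s \<in> {0..T}" "x \<in> cbox 0 1" for s x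
        using mt[of s x] that by (intro has_vector_derivative_mult_left) auto
      show "(\<lambda>x. m s x * e i x) integrable_on cbox 0 1" if "s \<in> {0..T}" for s
        using mc[OF that] ec by (auto intro!: integrable_continuous_interval continuous_intros)
      have "continuous_on ({0..T} \<times> {0..1}) (\<lambda>p. (case p of (t, x) \<Rightarrow> mt t x) * e i (snd p))"
        by (intro continuous_on_mult mtc continuous_on_compose2[OF ec] continuous_intros) auto
      then show "continuous_on ({0..T} \<times> cbox 0 1) (\<lambda>(s, x). mt s x * e i x)"
        by (simp add: case_prod_unfold)
    qed (use t in auto)
    then have "((\<lambda>s. integral {0..1} (\<lambda>x. m s x * e i x)) has_real_derivative
        integral {0..1} (\<lambda>x. mt t x * e i x)) (at t within {0..T})"
      by (simp add: has_real_derivative_iff_has_vector_derivative)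
    moreover have "integral {0..1} (\<lambda>x. mt t x * e i x) = l2_inner (mt t) (e i)"
      using mtx[OF t] e(1)[OF i] unfolding l2_inner_def by (intro integral_UI[symmetric]) auto
    moreover have "integral {0..1} (\<lambda>x. m s x * e i x) = b s i" if "s \<in> {0..T}" for s
      using mb[OF that] e(1)[OF i] unfolding b_def l2_inner_def by (intro integral_UI[symmetric]) auto
    ultimately show ?thesis
      using has_field_derivative_transform_within[of "\<lambda>s. integral {0..1} (\<lambda>x. m s x * e i x)" _ t "{0..T}" 1 "\<lambda>s. b s i"] t
      by auto
  qed
  \<comment> \<open>While \<open>f t \<le> h \<le> 1\<close>, the coordinates of
    \<open>\<theta>\<close> are at most 1 in modulus and those of \<open>m t\<close> at most
    \<open>M\<close>, so truncation at \<open>1 + M\<close> changes nothing.\<close>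
  define R where "R = 1 + M"
  have R0: "0 \<le> R" using M by (simp add: R_def)
  obtain y where y0: "\<And>i. i < n \<Longrightarrow> y 0 i = b 0 i"
    and yd: "\<And>i t. i < n \<Longrightarrow> t \<in> {0..T} \<Longrightarrow> ((\<lambda>s. y s i) has_real_derivative
       (\<Sum>j<n. \<Sum>k<n. coef i j k * (clip R (y t j) * clip R (y t k)))) (at t within {0..T})"
    using quadratic_ode_exists[OF T R0] by blast
  define q where "q t i = (\<Sum>j<n. \<Sum>k<n. coef i j k * (clip R (y t j) * clip R (y t k)))" for t i
  define \<theta> where "\<theta> t i = y t i - b t i" for t i
  define f where "f t = (\<Sum>i<n. (\<theta> t i)\<^sup>2)" for t
  define f' where "f' t = (\<Sum>i<n. 2 * \<theta> t i * (q t i - l2_inner (mt t) (e i)))" for t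
  have fd: "(f has_real_derivative f' t) (at t within {0..T})" if t: "t \<in> {0..T}" for t
  proof -
    have "((\<lambda>s. \<theta> s i) has_real_derivative q t i - l2_inner (mt t) (e i)) (at t within {0..T})" if "i < n" for i
      unfolding \<theta>_def q_def by (intro DERIV_diff yd bd that t)
    then show ?thesis unfolding f_def f'_def
      by (intro DERIV_sum) (auto intro!: derivative_eq_intros)
  qed
  have f0: "f 0 = 0" using y0 by (simp add: f_def \<theta>_def)
  define \<Theta> where "\<Theta> t = (\<lambda>x. mf (y t) x - mf (b t) x)" for t
  have \<Theta>: "\<Theta> t = mf (\<theta> t)" for t
    by (rule ext) (simp add: \<Theta>_def mf_def \<theta>_def left_diff_distrib sum_subtractf)
  have f\<Theta>: "(l2_norm (\<Theta> t))\<^sup>2 = f t" for t by (simp add: \<Theta> l2_norm_sq l2_mf_mf f_def)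
  have proj: "l2_inner (mf (b t)) \<phi> = l2_inner (m t) \<phi>" if "t \<in> {0..T}" "\<phi> \<in> S" for t \<phi>
    by (rule l2_projection_mf[OF mb[OF that(1)] _ that(2)]) (simp add: b_def)
  have norm_\<Theta>: "l2_norm (\<Theta> t) \<le> sqrt h" if "f t \<le> h" for t
    using that by (intro real_le_rsqrt) (simp add: f\<Theta>)
  have active: "clip R (y t i) = y t i" if t: "t \<in> {0..T}" and ft: "f t \<le> h" and i: "i < n" for t i
  proof (rule clip_id)
    have "(\<theta> t i)\<^sup>2 \<le> f t" unfolding f_def using i by (intro member_le_sum) auto
    then have "(\<theta> t i)\<^sup>2 \<le> 1" using ft h1 by linarith
    then have 1: "\<bar>\<theta> t i\<bar> \<le> 1" by (simp add: abs_square_le_1)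
    have "\<bar>b t i\<bar> \<le> l2_norm (m t) * l2_norm (e i)"
      unfolding b_def using mb[OF t] e(1)[OF i] by (intro l2_Cauchy_Schwarz) auto
    also have "l2_norm (e i) = 1" using e(2)[OF i i] by (simp add: l2_norm_def)
    also have "l2_norm (m t) \<le> l2_norm (\<lambda>x. M)"
      using m[OF t] mb[OF t] M by (intro l2_norm_mono_AE) (auto simp: smooth_bound_def intro!: AE_I2)
    finally have "\<bar>b t i\<bar> \<le> M" using M by (simp add: l2_norm_const)
    then show "\<bar>y t i\<bar> \<le> R" using 1 by (simp add: \<theta>_def R_def)
  qed
  have q: "q t i = transport (uf (y t)) (mf (y t)) (e i)"
    if t: "t \<in> {0..T}" and ft: "f t \<le> h" and i: "i < n" for t i
    unfolding q_def transport_coef[OF i] by (intro sum.cong refl) (simp add: active[OF t ft])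
  have f'_le: "f' t \<le> 2 * cA M * f t + 2 * cb M * H\<^sup>2" if t: "t \<in> {0..T}" and ft: "f t \<le> h" for t
  proof -
    have \<Theta>S: "\<Theta> t \<in> S" unfolding \<Theta> by (rule mf_S)
    have \<Theta>e: "l2_inner (\<Theta> t) (e i) = \<theta> t i" if "i < n" for i unfolding \<Theta> by (rule l2_mf_e[OF that])
    have "l2_inner (mt t) (\<Theta> t) = (\<Sum>i<n. \<theta> t i * l2_inner (mt t) (e i))"
      unfolding \<Theta> using mtx[OF t] by (subst l2_commute, subst l2_mf) (auto simp: l2_commute)
    moreover have "transport (uf (y t)) (mf (y t)) (\<Theta> t) = (\<Sum>i<n. \<theta> t i * q t i)"
      unfolding transport_expand[OF uf_S mf_S \<Theta>S] using \<Theta>e q[OF t ft] by (intro sum.cong) auto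
    ultimately have "f' t = 2 * (transport (uf (y t)) (mf (y t)) (\<Theta> t) - l2_inner (mt t) (\<Theta> t))"
      unfolding f'_def by (simp add: sum_distrib_left right_diff_distrib sum_subtractf mult.assoc)
    also have "l2_inner (mt t) (\<Theta> t) = l2_inner (\<lambda>x. - u t x * dx (m t) x - 2 * dx (u t) x * m t x) (\<Theta> t)"
      using pde[OF t] by (intro l2_cong) auto
    also have "2 * (transport (uf (y t)) (mf (y t)) (\<Theta> t) - \<dots>) \<le> 2 * (cA M * (l2_norm (\<Theta> t))\<^sup>2 + cb M * (h ^ (r - 1))\<^sup>2)"
      using transport_energy(1)[OF u[OF t] m[OF t] mf_S uf_S A[OF t] mf_uf mf_S proj[OF t] \<Theta>_def norm_\<Theta>[OF ft]] by simp
    finally show ?thesis by (simp add: f\<Theta> H_def algebra_simps)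
  qed
  \<comment> \<open>Conditional on \<open>f\<close> having stayed below \<open>h\<close> up to time
    \<open>t\<close>.\<close>
  have f_le: "f t \<le> cW M T * H\<^sup>2" if t: "t \<in> {0..T}" and ft: "\<And>s. s \<in> {0..t} \<Longrightarrow> f s \<le> h" for t
  proof -
    have "f t \<le> (f 0 + 2 * cb M * H\<^sup>2 * t) * exp (2 * cA M * t)"
    proof (rule Gronwall)
      fix s assume s: "s \<in> {0..t}"
      then have sT: "s \<in> {0..T}" using t by auto
      show "(f has_real_derivative f' s) (at s within {0..t})"
        by (rule DERIV_subset[OF fd[OF sT]]) (use t in auto)
      show "f' s \<le> 2 * cA M * f s + 2 * cb M * H\<^sup>2" by (rule f'_le[OF sT ft[OF s]])
    qed (use K t in auto)
    also have "\<dots> \<le> (2 * cb M * H\<^sup>2 * T) * exp (2 * cA M * T)"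
      unfolding f0 using K t by (intro mult_mono) (auto intro!: mult_left_mono)
    finally show ?thesis by (simp add: cW_def ac_simps)
  qed
  \<comment> \<open>By \<open>H \<le> h\<close> and \<open>hW\<close>, the improved bound lies
    strictly below the threshold, as the bootstrap demands.\<close>
  have f_h: "cW M T * H\<^sup>2 < h"
  proof -
    have "cW M T * H\<^sup>2 \<le> cW M T * h\<^sup>2" using H W0 by (intro mult_left_mono power_mono) auto
    also have "\<dots> = (cW M T * h) * h" by (simp add: power2_eq_square)
    also have "\<dots> < 1 * h" using hW h_pos by (intro mult_strict_right_mono) auto
    finally show ?thesis by simp
  qed
  have fh: "f t < h" if "t \<in> {0..T}" for t
  proof (rule continuous_bootstrap[OF _ _ _ that])
    show "continuous_on {0..T} f" by (rule DERIV_continuous_on[OF fd])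
    show "f 0 < h" using f0 h_pos by simp
    show "f t < h" if "t \<in> {0..T}" "\<And>s. s \<in> {0..t} \<Longrightarrow> f s \<le> h" for t
      using f_le[OF that] f_h by linarith
  qed
  have fW: "f t \<le> cW M T * H\<^sup>2" if "t \<in> {0..T}" for t
    using that by (intro f_le) (auto intro!: less_imp_le fh)
  \<comment> \<open>With \<open>f < h\<close> throughout, no coordinate is ever clipped, and
    \<open>y\<close> solves the original system.\<close>
  have ode: "((\<lambda>s. y s i) has_real_derivative (\<Sum>j<n. \<Sum>k<n. coef i j k * (y t j * y t k))) (at t within {0..T})"
    if "i < n" "t \<in> {0..T}" for i t
    using yd[OF that] active[OF that(2) less_imp_le[OF fh[OF that(2)]]] by simp
  have sol: "semidiscrete_solution S T u0 (\<lambda>t. mf (y t)) (\<lambda>t. uf (y t))"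
    using y0 by (intro ode_solution[OF T ode mb[OF T0] u0 _ A0]) (auto simp: b_def)
  have uniq: "mh' t x = mf (y t) x \<and> uh' t x = uf (y t) x"
    if s: "semidiscrete_solution S T u0 mh' uh'" and t: "t \<in> {0..T}" and x: "x \<in> {0..1}" for mh' uh' t x
  proof -
    note so = solution_ode[OF T s u0]
    have "l2_inner (mh' t) (e i) = y t i" if "i < n" for i
      by (rule quadratic_ode_unique[OF _ so(1) ode t that]) (use so(2) y0 in \<open>auto simp: b_def\<close>)
    then have "mf (\<lambda>i. l2_inner (mh' t) (e i)) = mf (y t)" "uf (\<lambda>i. l2_inner (mh' t) (e i)) = uf (y t)"
      by (auto simp: mf_def uf_def)
    then show ?thesis using so(3)[OF _ t x] so(4)[OF _ t x] by simp
  qed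
  have err: "l2_norm (\<lambda>x. m t x - mf (y t) x) + h1_norm (\<lambda>x. u t x - uf (y t) x) \<le> cE M T * H"
    if t: "t \<in> {0..T}" for t
  proof -
    have "l2_norm (\<Theta> t) = sqrt (f t)" by (simp add: f\<Theta>[symmetric])
    also have "\<dots> \<le> sqrt (cW M T * H\<^sup>2)" using fW[OF t] by simp
    also have "\<dots> = sqrt (cW M T) * H" using H by (simp add: real_sqrt_mult)
    finally have th: "l2_norm (\<Theta> t) \<le> sqrt (cW M T) * H" .
    note en = transport_energy(2-4)[OF u[OF t] m[OF t] mf_S uf_S A[OF t] mf_uf mf_S proj[OF t] \<Theta>_def
        norm_\<Theta>[OF less_imp_le[OF fh[OF t]]], folded H_def]
    have "h1_norm (\<lambda>x. u t x - uf (y t) x) = sqrt ((l2_norm (\<lambda>x. u t x - uf (y t) x))\<^sup>2 + (l2_norm (\<lambda>x. dx (u t) x - deriv (uf (y t)) x))\<^sup>2)"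
      by (rule h1_norm_pw[OF pw_deriv_diff[OF smooth_pw[OF u[OF t]] fe_pw[OF uf_S]]])
    also have "\<dots> \<le> l2_norm (\<lambda>x. u t x - uf (y t) x) + l2_norm (\<lambda>x. dx (u t) x - deriv (uf (y t)) x)"
      by (rule sqrt_sum_squares_le_sum) auto
    finally have "l2_norm (\<lambda>x. m t x - mf (y t) x) + h1_norm (\<lambda>x. u t x - uf (y t) x)
        \<le> 3 * (sqrt (cW M T) * H) + ce * M * H + 2 * (cg M * H)"
      using en th by linarith
    also have "\<dots> = cE M T * H" by (simp add: cE_def algebra_simps)
    finally show ?thesis .
  qed
  show ?thesis using sol uniq err unfolding H_def
    by (intro exI[of _ "\<lambda>t. mf (y t)"] exI[of _ "\<lambda>t. uf (y t)"]) blast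
qed

end

section \<open>From smoothness in space and time to uniform bounds\<close>

lemma smooth_upto_dx: "smooth_upto T (j + k) v \<Longrightarrow> smooth_upto T k (\<lambda>t. (dx ^^ j) (v t))"
proof (induction j arbitrary: v)
  case (Suc j)
  then have "smooth_upto T k (\<lambda>t. (dx ^^ j) (dx (v t)))" by (intro Suc.IH) simp
  then show ?case by (simp add: funpow_swap1)
qed simp

lemma smooth_upto_Suc: "smooth_upto T (Suc k) v \<Longrightarrow> smooth_upto T k v"
proof (induction k arbitrary: v)
  case (Suc k)
  show ?case
    using Suc.prems[unfolded smooth_upto.simps(2)[of T "Suc k"]] Suc.IH
    unfolding smooth_upto.simps(2)[of T k] by blast
qed simp

lemma smooth_upto_continuous: "smooth_upto T k v \<Longrightarrow> continuous_on ({0..T} \<times> {0..1}) (\<lambda>(t, x). v t x)"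
  by (cases k) auto

lemma smooth_upto_bound:
  assumes "smooth_upto T k v" "j \<le> k"
  obtains M where "\<And>t x. t \<in> {0..T} \<Longrightarrow> x \<in> {0..1} \<Longrightarrow> \<bar>(dx ^^ j) (v t) x\<bar> \<le> M"
proof -
  have "smooth_upto T (k - j) (\<lambda>t. (dx ^^ j) (v t))" using assms by (intro smooth_upto_dx) simp
  then have "continuous_on ({0..T} \<times> {0..1}) (\<lambda>(t, x). (dx ^^ j) (v t) x)" by (rule smooth_upto_continuous)
  then have "bounded ((\<lambda>(t, x). (dx ^^ j) (v t) x) ` ({0..T} \<times> {0..1}))"
    by (intro compact_imp_bounded compact_continuous_image compact_Times) auto
  then obtain M where "\<forall>y\<in>(\<lambda>(t, x). (dx ^^ j) (v t) x) ` ({0..T} \<times> {0..1}). norm y \<le> M"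
    unfolding bounded_iff by blast
  then show thesis by (intro that[of M]) force
qed

lemma smooth_upto_Ck:
  assumes v: "smooth_upto T k v" and t: "t \<in> {0..T}"
  shows "v t \<in> Ck k"
  unfolding Ck_def
proof (intro CollectI conjI allI impI)
  fix j assume j: "j \<le> k"
  have "smooth_upto T (k - j) (\<lambda>t. (dx ^^ j) (v t))" using v j by (intro smooth_upto_dx) simp
  then have "continuous_on ({0..T} \<times> {0..1}) (\<lambda>(t, x). (dx ^^ j) (v t) x)" by (rule smooth_upto_continuous)
  then show "continuous_on {0..1} ((dx ^^ j) (v t))"
    by (rule continuous_on_slice) (rule t)
next
  fix j assume j: "j < k"
  have "smooth_upto T (Suc (k - j - 1)) (\<lambda>t. (dx ^^ j) (v t))" using v j by (intro smooth_upto_dx) simp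
  then show "(dx ^^ j) (v t) differentiable_on {0..1}" using t by (auto simp: differentiable_on_def)
qed

lemma smooth_upto_smooth_bound:
  assumes r: "2 \<le> r" and v: "smooth_upto T r v" and bc: "\<And>t. t \<in> {0..T} \<Longrightarrow> v t 0 = 0 \<and> v t 1 = 0"
  obtains M where "\<And>M' t. M \<le> M' \<Longrightarrow> t \<in> {0..T} \<Longrightarrow> smooth_bound r M' (v t)"
proof -
  obtain M0 where M0: "\<And>t x. t \<in> {0..T} \<Longrightarrow> x \<in> {0..1} \<Longrightarrow> \<bar>(dx ^^ 0) (v t) x\<bar> \<le> M0"
    by (rule smooth_upto_bound[OF v, of 0]) auto
  obtain M1 where M1: "\<And>t x. t \<in> {0..T} \<Longrightarrow> x \<in> {0..1} \<Longrightarrow> \<bar>(dx ^^ 1) (v t) x\<bar> \<le> M1"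
    by (rule smooth_upto_bound[OF v, of 1]) (use r in auto)
  obtain M2 where M2: "\<And>t x. t \<in> {0..T} \<Longrightarrow> x \<in> {0..1} \<Longrightarrow> \<bar>(dx ^^ r) (v t) x\<bar> \<le> M2"
    by (rule smooth_upto_bound[OF v, of r]) auto
  show thesis
  proof (rule that[of "max M0 (max M1 M2)"])
    fix M' t assume M': "max M0 (max M1 M2) \<le> M'" and t: "t \<in> {0..T}"
    have "\<bar>v t x\<bar> \<le> M' \<and> \<bar>dx (v t) x\<bar> \<le> M' \<and> \<bar>(dx ^^ r) (v t) x\<bar> \<le> M'" if "x \<in> {0..1}" for x
      using M0[OF t that] M1[OF t that] M2[OF t that] M' by auto
    then show "smooth_bound r M' (v t)"
      unfolding smooth_bound_def using smooth_upto_Ck[OF v t] bc[OF t] by blast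
  qed
qed

theorem proposition5p1:
  fixes r :: nat
  assumes "r \<ge> 2"
  shows "\<exists>K :: nat. \<forall>(T :: real) (u0 :: real \<Rightarrow> real) (m0 :: real \<Rightarrow> real)
      (m :: real \<Rightarrow> real \<Rightarrow> real) (u :: real \<Rightarrow> real \<Rightarrow> real) (\<mu> :: nat) (\<T> :: mesh set).
    T > 0 \<longrightarrow>
    (\<forall>x\<in>{0..1}. m0 x = u0 x - dx (dx u0) x) \<longrightarrow>
    CH_unique_solution r T u0 m0 m u \<longrightarrow>
    smooth_upto T K m \<longrightarrow> smooth_upto T K u \<longrightarrow>
    \<mu> \<le> r - 2 \<longrightarrow>
    quasiuniform_family \<T> \<longrightarrow>
    (\<exists>h0 > 0. \<exists>C. \<forall>P\<in>\<T>. max_length P \<le> h0 \<longrightarrow>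
      (\<exists>mh uh.
         semidiscrete_solution (fe_space r \<mu> P) T u0 mh uh \<and>
         (\<forall>mh' uh'. semidiscrete_solution (fe_space r \<mu> P) T u0 mh' uh' \<longrightarrow>
            (\<forall>t\<in>{0..T}. \<forall>x\<in>{0..1}. mh' t x = mh t x \<and> uh' t x = uh t x)) \<and>
         (\<forall>t\<in>{0..T}.
            l2_norm (\<lambda>x. m t x - mh t x) + h1_norm (\<lambda>x. u t x - uh t x)
              \<le> C * max_length P ^ (r - 1))))"
proof (intro exI[of _ "Suc r"] allI impI)
  fix T :: real and u0 m0 :: "real \<Rightarrow> real" and m u :: "real \<Rightarrow> real \<Rightarrow> real" and \<mu> :: nat and \<T> :: "mesh set"
  assume T: "T > 0" and m0: "\<forall>x\<in>{0..1}. m0 x = u0 x - dx (dx u0) x"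
    and CHu: "CH_unique_solution r T u0 m0 m u"
    and sm: "smooth_upto T (Suc r) m" and su: "smooth_upto T (Suc r) u"
    and mu: "\<mu> \<le> r - 2" and \<T>: "quasiuniform_family \<T>"
  have CH: "CH_solution r T u0 m0 m u" using CHu by (simp add: CH_unique_solution_def)
  have bc: "m t 0 = 0 \<and> m t 1 = 0" "u t 0 = 0 \<and> u t 1 = 0" if "t \<in> {0..T}" for t
    using CH that unfolding CH_solution_def by blast+
  have eqs: "(\<lambda>s. m s x) differentiable (at t within {0..T})" "m t x = u t x - dx (dx (u t)) x"
    "dt T m t x + u t x * dx (m t) x + 2 * dx (u t) x * m t x = 0" if "t \<in> {0..T}" "x \<in> {0..1}" for t x
    using CH that unfolding CH_solution_def by blast+
  have init: "u 0 x = u0 x" "m 0 x = m0 x" if "x \<in> {0..1}" for x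
    using CH that unfolding CH_solution_def by blast+
  have T0: "0 \<in> {0..T}" using T by simp
  \<comment> \<open>Of the \<open>Suc r\<close> orders of smoothness, \<open>r\<close> provide the
    uniform bounds; one unfolding of the full hypothesis later yields continuity of
    \<open>dt T m\<close>.\<close>
  obtain Mm where Mm: "\<And>M' t. Mm \<le> M' \<Longrightarrow> t \<in> {0..T} \<Longrightarrow> smooth_bound r M' (m t)"
    using smooth_upto_smooth_bound[OF assms smooth_upto_Suc[OF sm]] bc(1) by metis
  obtain Mu where Mu: "\<And>M' t. Mu \<le> M' \<Longrightarrow> t \<in> {0..T} \<Longrightarrow> smooth_bound r M' (u t)"
    using smooth_upto_smooth_bound[OF assms smooth_upto_Suc[OF su]] bc(2) by metis
  define M where "M = max Mm Mu"
  have mM: "smooth_bound r M (m t)" and uM: "smooth_bound r M (u t)" if "t \<in> {0..T}" for t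
    using Mm Mu that by (auto simp: M_def)
  have u1: "pw_deriv (u t) (dx (u t))" and u2: "pw_deriv (dx (u t)) (dx (dx (u t)))" if "t \<in> {0..T}" for t
  proof -
    have "u t \<in> Ck r" using uM[OF that] by (simp add: smooth_bound_def)
    from Ck_pw_deriv[OF this, of 0] Ck_pw_deriv[OF this, of 1] assms
    show "pw_deriv (u t) (dx (u t))" "pw_deriv (dx (u t)) (dx (dx (u t)))" by auto
  qed
  obtain \<gamma>0 where mesh: "\<And>P. P \<in> \<T> \<Longrightarrow> is_mesh P"
    and \<gamma>0: "\<And>P. P \<in> \<T> \<Longrightarrow> max_length P / min_length P \<le> \<gamma>0"
    using \<T> unfolding quasiuniform_family_def by blast
  define \<gamma> where "\<gamma> = max 1 \<gamma>0"
  have \<gamma>1: "1 \<le> \<gamma>" by (simp add: \<gamma>_def)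
  obtain c where c: "1 \<le> c"
    "\<And>\<mu> N z. fe_mesh r \<mu> N z \<Longrightarrow> max_length (N, z) \<le> 1 \<Longrightarrow>
       max_length (N, z) \<le> \<gamma> * min_length (N, z) \<Longrightarrow> qu_mesh r \<mu> N z c"
    by (rule qu_mesh_exists[OF assms \<gamma>1]) blast
  \<comment> \<open>No mesh occurs among the arguments, so the constant is fixed before a member of
    the family is chosen.\<close>
  define W where "W = qu_mesh.cW r c M T"
  \<comment> \<open>\<open>max 0\<close> keeps the denominator positive whatever the sign of
    \<open>W\<close>; the summand 2 yields both \<open>h0 \<le> 1\<close> and
    \<open>W * h0 < 1\<close>.\<close>
  define h0 where "h0 = 1 / (max 0 W + 2)"
  show "\<exists>h0 > 0. \<exists>C. \<forall>P\<in>\<T>. max_length P \<le> h0 \<longrightarrow>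
      (\<exists>mh uh.
         semidiscrete_solution (fe_space r \<mu> P) T u0 mh uh \<and>
         (\<forall>mh' uh'. semidiscrete_solution (fe_space r \<mu> P) T u0 mh' uh' \<longrightarrow>
            (\<forall>t\<in>{0..T}. \<forall>x\<in>{0..1}. mh' t x = mh t x \<and> uh' t x = uh t x)) \<and>
         (\<forall>t\<in>{0..T}.
            l2_norm (\<lambda>x. m t x - mh t x) + h1_norm (\<lambda>x. u t x - uh t x)
              \<le> C * max_length P ^ (r - 1)))"
  proof (rule exI[of _ h0], intro conjI exI[of _ "qu_mesh.cE r c M T"] ballI impI)
    show "0 < h0" by (simp add: h0_def add_nonneg_pos)
    fix P assume P: "P \<in> \<T>" and Ph: "max_length P \<le> h0"
    obtain N z where Nz: "P = (N, z)" by (cases P)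
    have fm: "fe_mesh r \<mu> N z" using mesh[OF P] assms mu by unfold_locales (auto simp: Nz)
    interpret F: fe_mesh r \<mu> N z by (rule fm)
    have h01: "h0 \<le> 1" by (simp add: h0_def)
    have "F.h \<le> \<gamma>0 * min_length (N, z)"
      using \<gamma>0[OF P] F.min_len_pos by (simp add: Nz pos_divide_le_eq)
    also have "\<dots> \<le> \<gamma> * min_length (N, z)" using F.min_len_pos by (intro mult_right_mono) (auto simp: \<gamma>_def)
    finally have "qu_mesh r \<mu> N z c" using c(2)[OF fm] Ph h01 by (simp add: Nz)
    then interpret Q: qu_mesh r \<mu> N z c .
    show "\<exists>mh uh.
         semidiscrete_solution (fe_space r \<mu> P) T u0 mh uh \<and>
         (\<forall>mh' uh'. semidiscrete_solution (fe_space r \<mu> P) T u0 mh' uh' \<longrightarrow>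
            (\<forall>t\<in>{0..T}. \<forall>x\<in>{0..1}. mh' t x = mh t x \<and> uh' t x = uh t x)) \<and>
         (\<forall>t\<in>{0..T}.
            l2_norm (\<lambda>x. m t x - mh t x) + h1_norm (\<lambda>x. u t x - uh t x)
              \<le> Q.cE M T * max_length P ^ (r - 1))"
      unfolding Nz
    proof (rule Q.semidiscrete_error[OF T uM mM])
      \<comment> \<open>Weak form of \<open>m = u - u_xx\<close>: integration by parts against a
        function vanishing at both endpoints.\<close>
      have A: "l2_inner (u t) \<phi> + l2_inner (dx (u t)) (deriv \<phi>) = l2_inner (m t) \<phi>"
        if t: "t \<in> {0..T}" and \<phi>: "\<phi> \<in> fe_space r \<mu> (N, z)" for t \<phi>
      proof -
        have "l2_inner (dx (u t)) (deriv \<phi>) = - l2_inner (dx (dx (u t))) \<phi>"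
          using F.fe_spaceD(3,4)[OF \<phi>] by (intro pw_deriv_parts u2[OF t] F.fe_pw[OF \<phi>]) simp
        moreover have "l2_inner (m t) \<phi> = l2_inner (\<lambda>x. u t x - dx (dx (u t)) x) \<phi>"
          using eqs(2)[OF t] by (intro l2_cong) auto
        ultimately show ?thesis
          using pw_deriv_bdd[OF u1[OF t]] pw_deriv_bdd[OF u2[OF t]] \<phi> by (simp add: l2_diff_left)
      qed
      then show "\<And>t \<phi>. t \<in> {0..T} \<Longrightarrow> \<phi> \<in> fe_space r \<mu> (N, z) \<Longrightarrow>
        l2_inner (u t) \<phi> + l2_inner (dx (u t)) (deriv \<phi>) = l2_inner (m t) \<phi>" .
      show "((\<lambda>s. m s x) has_vector_derivative dt T m t x) (at t within {0..T})"
        if "t \<in> {0..T}" "x \<in> {0..1}" for t x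
        using eqs(1)[OF that] by (simp add: dt_def vector_derivative_works[symmetric])
      show "continuous_on ({0..T} \<times> {0..1}) (\<lambda>(t, x). dt T m t x)"
        by (rule smooth_upto_continuous[of _ r]) (use sm in simp)
      show "dt T m t x = - u t x * dx (m t) x - 2 * dx (u t) x * m t x"
        if "t \<in> {0..T}" "x \<in> {0..1}" for t x using eqs(3)[OF that] by simp
      show "u0 x - dx (dx u0) x = m 0 x" if "x \<in> {0..1}" for x using m0 init that by simp
      show "bilin_A u0 \<phi> = l2_inner (m 0) \<phi>" if \<phi>: "\<phi> \<in> fe_space r \<mu> (N, z)" for \<phi>
      proof -
        \<comment> \<open>\<open>u0\<close> agrees with \<open>u 0\<close> on \<open>[0,1]\<close>
          only, which is enough for the piecewise derivative.\<close>
        have "pw_deriv u0 (dx (u 0))" by (rule pw_deriv_cong[OF u1[OF T0]]) (use init in auto)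
        then have "bilin_A u0 \<phi> = l2_inner u0 \<phi> + l2_inner (dx (u 0)) (deriv \<phi>)"
          by (rule bilin_A_pw) (rule F.fe_pw[OF \<phi>])
        also have "l2_inner u0 \<phi> = l2_inner (u 0) \<phi>" using init by (intro l2_cong) auto
        finally show ?thesis using A[OF T0 \<phi>] by simp
      qed
      have "Q.cW M T * F.h \<le> max 0 W * h0"
        using Ph F.h_pos by (intro mult_mono) (auto simp: W_def Nz)
      also have "\<dots> < 1" by (simp add: h0_def)
      finally show "Q.cW M T * F.h < 1" .
    qed
  qed
qed

end
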